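(* Consider the scalar complex fast fading channel $Y_i=H_iX_i+Z_i$ described in the context, where $|H_i|$ are i.i.d. with a regular fading distribution. Let $\epsilon>0$ be fixed and let $\delta_c^*(n,\epsilon)$ be the supremum of the NLDs of $n$ complex-dimensional infinite constellations with average error probability at most $\epsilon$. Then, as $n\to\infty$, $$\delta_c^*(n,\epsilon)=\delta_c^*-\sqrt{\frac{V_c}{n}}Q^{-1}(\epsilon)+O\!\left(\frac{\ln n}{n}\right),$$ where, with $\delta_c(H)=\ln\!\left(\frac{|H|^2}{\pi e\sigma^2}\right)$, $\delta_c^*=E\{\delta_c(H)\}$ and $V_c=1+\mathrm{Var}(\delta_c(H))=1+\mathrm{Var}(\ln(|H|^2))$.
   Context: Channel: $Y_i=H_iX_i+Z_i$ with complex $X_i,H_i,Z_i$, mutually independent; $\{H_i\}$ i.i.d. with $E|H_i|^2=1$; $Z_i\sim CN(0,\sigma^2)$ i.i.d. with i.i.d. real and imaginary parts; receiver knows $\mathbf H=\mathrm{diag}(H_1,\dots,H_n)$. A PDF $f$ on $[0,\infty)$ is a regular fading distribution if for some $\alpha>0$, $f(h)\propto h^{\alpha-1}$ for all sufficiently small $h>0$. An $n$ complex-dimensional IC is a countable $S\subset\mathbb C^n$; $\mathrm{Cb}(a)=\{\mathbf x\in\mathbb C^n:|\mathrm{Re}x_i|,|\mathrm{Im}x_i|<a/2\}$; density $\gamma=\limsup_{a\to\infty}|S\cap\mathrm{Cb}(a)|/a^{2n}$; NLD $\delta_c=\frac1n\ln\gamma$. Average error probability (ML decoding, equiprobable codewords):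 $P_e(S)=E\{\limsup_{a\to\infty}\frac{1}{M(S_{\mathbf H},a)}\sum_{s_{rc}\in S_{\mathbf H}\cap\mathbf H\mathrm{Cb}(a)}\Pr\{s_{rc}+\mathbf z\notin W(s_{rc})\mid\mathbf H\}\}$, where $S_{\mathbf H}=\{\mathbf Hs:s\in S\}$, $M(S_{\mathbf H},a)=|S_{\mathbf H}\cap\mathbf H\mathrm{Cb}(a)|$, and $W(s_{rc})$ is the Voronoi cell of $s_{rc}$ in $S_{\mathbf H}$. $Q$ is the standard Gaussian complementary CDF. *)

theory Defs
  imports "HOL-Probability.Probability"
begin

definition cvec :: "nat \<Rightarrow> (nat \<Rightarrow> complex) set" where
  "cvec n = {x. \<forall>i\<ge>n. x i = 0}"

definition is_IC :: "nat \<Rightarrow> (nat \<Rightarrow> complex) set \<Rightarrow> bool" where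
  "is_IC n S \<longleftrightarrow> countable S \<and> S \<subseteq> cvec n"

definition Cb :: "nat \<Rightarrow> real \<Rightarrow> (nat \<Rightarrow> complex) set" where
  "Cb n a = {x \<in> cvec n. \<forall>i<n. \<bar>Re (x i)\<bar> < a / 2 \<and> \<bar>Im (x i)\<bar> < a / 2}"

definition ecount :: "'a set \<Rightarrow> ereal" where
  "ecount A = (if finite A then ereal (real (card A)) else \<infinity>)"

definition IC_density :: "nat \<Rightarrow> (nat \<Rightarrow> complex) set \<Rightarrow> ereal" where
  "IC_density n S = Limsup at_top (\<lambda>a::real. ecount (S \<inter> Cb n a) / ereal (a ^ (2 * n)))"

definition NLD :: "nat \<Rightarrow> (nat \<Rightarrow> complex) set \<Rightarrow> ereal" where
  "NLD n S = (let \<gamma> = IC_density n S in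
     if \<gamma> = \<infinity> then \<infinity> else if \<gamma> \<le> 0 then -\<infinity>
     else ereal (ln (real_of_ereal \<gamma>) / real n))"

definition chan :: "nat \<Rightarrow> (nat \<Rightarrow> complex) \<Rightarrow> (nat \<Rightarrow> complex) \<Rightarrow> (nat \<Rightarrow> complex)" where
  "chan n h x = (\<lambda>i. if i < n then h i * x i else 0)"

definition cdist :: "nat \<Rightarrow> (nat \<Rightarrow> complex) \<Rightarrow> (nat \<Rightarrow> complex) \<Rightarrow> real" where
  "cdist n x y = sqrt (\<Sum>i<n. (cmod (x i - y i))\<^sup>2)"

text \<open>Voronoi cell of s in T (ML decoding for Gaussian noise = minimum distance).\<close>
definition voronoi :: "nat \<Rightarrow> (nat \<Rightarrow> complex) set \<Rightarrow> (nat \<Rightarrow> complex) \<Rightarrow> (nat \<Rightarrow> complex) set" where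
  "voronoi n T s = {y. \<forall>t\<in>T. cdist n y s \<le> cdist n y t}"

text \<open>CN(0, sigma^2): circularly symmetric complex Gaussian (i.i.d. N(0, sigma^2/2) parts).\<close>
definition cgauss :: "real \<Rightarrow> complex measure" where
  "cgauss \<sigma> = density lborel (\<lambda>z. ennreal (exp (- (cmod z)\<^sup>2 / \<sigma>\<^sup>2) / (pi * \<sigma>\<^sup>2)))"

definition noise_vec :: "nat \<Rightarrow> real \<Rightarrow> (nat \<Rightarrow> complex) measure" where
  "noise_vec n \<sigma> = PiM {..<n} (\<lambda>_. cgauss \<sigma>)"

definition point_err :: "nat \<Rightarrow> real \<Rightarrow> (nat \<Rightarrow> complex) set \<Rightarrow> (nat \<Rightarrow> complex) \<Rightarrow> ennreal" where
  "point_err n \<sigma> T s = emeasure (noise_vec n \<sigma>)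
     {z \<in> space (noise_vec n \<sigma>). (\<lambda>i. s i + z i) \<notin> voronoi n T s}"

text \<open>Average over the finite set A of points of T (value 1 if A is infinite: this only
  happens on a null set of channel realizations for the constellations considered).\<close>
definition avg_err :: "nat \<Rightarrow> real \<Rightarrow> (nat \<Rightarrow> complex) set \<Rightarrow> (nat \<Rightarrow> complex) set \<Rightarrow> ennreal" where
  "avg_err n \<sigma> T A = (if finite A then (\<Sum>s\<in>A. point_err n \<sigma> T s) / of_nat (card A) else 1)"

definition cond_err :: "nat \<Rightarrow> real \<Rightarrow> (nat \<Rightarrow> complex) set \<Rightarrow> (nat \<Rightarrow> complex) \<Rightarrow> ennreal" where
  "cond_err n \<sigma> S h = (let SH = chan n h ` S in
     Limsup at_top (\<lambda>a::real. avg_err n \<sigma> SH (SH \<inter> chan n h ` Cb n a)))"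

definition avg_error_prob :: "nat \<Rightarrow> real \<Rightarrow> complex measure \<Rightarrow> (nat \<Rightarrow> complex) set \<Rightarrow> ennreal" where
  "avg_error_prob n \<sigma> \<mu>H S = (\<integral>\<^sup>+ h. cond_err n \<sigma> S h \<partial>(PiM {..<n} (\<lambda>_. \<mu>H)))"

text \<open>delta_c^*(n, eps): supremum of NLDs of ICs (with finitely many points in each cube,
  so that P_e is defined) having P_e <= eps.\<close>
definition opt_NLD :: "nat \<Rightarrow> real \<Rightarrow> complex measure \<Rightarrow> real \<Rightarrow> ereal" where
  "opt_NLD n \<sigma> \<mu>H \<epsilon> = Sup {NLD n S | S. is_IC n S \<and> (\<forall>a. finite (S \<inter> Cb n a))
       \<and> avg_error_prob n \<sigma> \<mu>H S \<le> ennreal \<epsilon>}"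

definition regular_fading_pdf :: "(real \<Rightarrow> real) \<Rightarrow> bool" where
  "regular_fading_pdf f \<longleftrightarrow> (\<forall>h\<ge>0. 0 \<le> f h) \<and> set_integrable lborel {0..} f
     \<and> (LINT h:{0..}|lborel. f h) = 1
     \<and> (\<exists>\<alpha>>0. \<exists>c>0. \<exists>h0>0. \<forall>h. 0 < h \<and> h < h0 \<longrightarrow> f h = c * h powr (\<alpha> - 1))"

definition Qfun :: "real \<Rightarrow> real" where
  "Qfun x = (LBINT t:{x<..}. std_normal_density t)"

definition Qinv :: "real \<Rightarrow> real" where
  "Qinv e = (THE x. Qfun x = e)"

end

theory Submission
  imports Defs
begin

text \<open>Write \<open>T\<^sub>i = ln |H\<^sub>i|\<^sup>2 - ln (\<pi> \<sigma>\<^sup>2) - |Z\<^sub>i|\<^sup>2/\<sigma>\<^sup>2\<close>; these variables are i.i.d. with mean \<open>\<delta>\<^sup>*\<close> and variance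
  \<open>V\<close>, and their sum is the logarithm of \<open>\<Prod>|H\<^sub>i|\<^sup>2\<close> times the noise density at \<open>Z\<close>. Up to errors of order
  \<open>1/\<surd>n\<close>, the best error probability at NLD \<open>\<delta>\<close> is the probability that \<open>\<Sum>T\<^sub>i\<close> is at most \<open>n\<delta> + O(ln n)\<close>.

  Converse: where the noise density is at most \<open>\<tau>\<close>, the probability of correct decoding is at most \<open>\<tau>\<close> times
  the volume of the Voronoi cell, and the cells of the points in a large cube share the volume of a slightly
  larger one. Achievability: choose the points of a periodic constellation one by one so that the average
  number of competitors closer to the received point than the transmitted one is, up to a constant factor,
  no larger than for uniformly random points; the volume searched is at most the reciprocal of the noise density.

  The sum is compared with a normal variable by Levy inversion. The exponential summand \<open>|Z\<^sub>i|\<^sup>2/\<sigma>\<^sup>2\<close> forces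
  the characteristic function of \<open>T\<^sub>i\<close> below \<open>(1 + t\<^sup>2)\<^sup>-\<^sup>1\<^sup>/\<^sup>2\<close>, so the rate \<open>1/\<surd>n\<close> follows from a third moment,
  which the regular fading law provides.\<close>

section \<open>Volume in complex coordinates\<close>

text \<open>Near the quantile the normal density is bounded below, so an error of order
  \<open>1 / sqrt n\<close> in probability costs only \<open>O(1 / n)\<close> in NLD. The
  \<open>ln n / n\<close> comes from offsetting the thresholds by \<open>ln n / 2\<close>, which
  makes the volume terms of both bounds of order \<open>exp (- ln n / 2) = 1 / sqrt n\<close>. In a
  periodic constellation the translates of the transmitted point are not controlled by averaging: a
  deep fade can bring them close. For fixed \<open>n\<close> the period is taken so large that this
  has probability at most \<open>1 / sqrt n\<close>, and the density is kept by taking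
  correspondingly many classes. The main term, the probability of a low information density, must
  enter achievability with coefficient exactly 1, while all other terms may lose constant factors.
  It is therefore split off before any averaging over classes. The error probability integrates a
  limsup whose measurability in the fading is never established. Both bounds compare it almost
  everywhere with measurable functions, and the nonnegative integral is monotone for arbitrary
  functions.\<close>

lemma lborel_complex_eq_distr:
  "(lborel :: complex measure) = distr (lborel \<Otimes>\<^sub>M lborel) borel (\<lambda>(x, y). Complex x y)"
proof (rule lborel_eqI)
  have m[measurable]: "(\<lambda>(x, y). Complex x y) \<in> borel_measurable (lborel \<Otimes>\<^sub>M lborel)"
    by (simp add: Complex_eq split_beta)
  fix l u :: complex assume lu: "\<And>b. b \<in> Basis \<Longrightarrow> l \<bullet> b \<le> u \<bullet> b"
  have le: "Re l \<le> Re u" "Im l \<le> Im u"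
    using lu[of 1] lu[of \<i>] by (auto simp: Basis_complex_def inner_complex_def)
  have b: "box l u = {z. Re l < Re z \<and> Re z < Re u \<and> Im l < Im z \<and> Im z < Im u}"
    by (auto simp: box_def Basis_complex_def inner_complex_def)
  have v: "(\<lambda>(x, y). Complex x y) -` box l u \<inter> space (lborel \<Otimes>\<^sub>M lborel) = {Re l<..<Re u} \<times> {Im l<..<Im u}"
    by (auto simp: b space_pair_measure)
  have "emeasure (distr (lborel \<Otimes>\<^sub>M lborel) borel (\<lambda>(x, y). Complex x y)) (box l u)
        = ennreal (Re u - Re l) * ennreal (Im u - Im l)"
    using le by (simp add: emeasure_distr v lborel.emeasure_pair_measure_Times)
  also have "\<dots> = ennreal ((Re u - Re l) * (Im u - Im l))"
    using le by (simp add: ennreal_mult)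
  also have "(Re u - Re l) * (Im u - Im l) = (\<Prod>b\<in>Basis. (u - l) \<bullet> b)"
    by (simp add: Basis_complex_def inner_complex_def)
  finally show "emeasure (distr (lborel \<Otimes>\<^sub>M lborel) borel (\<lambda>(x, y). Complex x y)) (box l u)
        = ennreal (\<Prod>b\<in>Basis. (u - l) \<bullet> b)" .
qed simp

lemma nn_integral_complex:
  assumes [measurable]: "f \<in> borel_measurable borel"
  shows "(\<integral>\<^sup>+z. f z \<partial>lborel) = (\<integral>\<^sup>+x. \<integral>\<^sup>+y. f (Complex x y) \<partial>lborel \<partial>lborel)"
proof -
  have m[measurable]: "(\<lambda>(x, y). Complex x y) \<in> borel_measurable (lborel \<Otimes>\<^sub>M lborel)"
    by (simp add: Complex_eq split_beta)
  have "(\<integral>\<^sup>+z. f z \<partial>lborel) = (\<integral>\<^sup>+p. f (case p of (x, y) \<Rightarrow> Complex x y) \<partial>(lborel \<Otimes>\<^sub>M lborel))"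
    by (subst lborel_complex_eq_distr, subst nn_integral_distr) auto
  also have "\<dots> = (\<integral>\<^sup>+x. \<integral>\<^sup>+y. f (Complex x y) \<partial>lborel \<partial>lborel)"
    by (subst lborel.nn_integral_fst[symmetric]) auto
  finally show ?thesis .
qed

lemma measurable_Complex[measurable (raw)]:
  assumes "f \<in> borel_measurable M" "g \<in> borel_measurable M"
  shows "(\<lambda>x. Complex (f x) (g x)) \<in> borel_measurable M"
  using assms by (simp add: Complex_eq)

text \<open>Multiplication by \<open>c = a + b i\<close> is the real matrix with rows
  \<open>(a, -b)\<close> and \<open>(b, a)\<close>, of determinant \<open>(cmod c)^2\<close>. It is
  reduced to one-dimensional affine substitutions. These divide by \<open>a\<close>, so purely
  imaginary \<open>c\<close>, which interchanges the axes, is treated separately.\<close>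

lemma nn_integral_complex_mult:
  fixes c :: complex
  assumes f[measurable]: "f \<in> borel_measurable borel" and c: "c \<noteq> 0"
  shows "(\<integral>\<^sup>+z. f z \<partial>lborel) = ennreal ((cmod c)\<^sup>2) * (\<integral>\<^sup>+z. f (c * z) \<partial>lborel)"
proof -
  define a b where "a = Re c" and "b = Im c"
  have c2: "(cmod c)\<^sup>2 = a\<^sup>2 + b\<^sup>2" by (simp add: a_def b_def cmod_power2)
  have pos: "a\<^sup>2 + b\<^sup>2 > 0" using c c2 by (metis zero_less_norm_iff zero_less_power)
  have cm: "c * Complex x y = Complex (a * x - b * y) (b * x + a * y)" for x y
    by (simp add: complex_eq_iff a_def b_def)
  have "(\<integral>\<^sup>+z. f (c * z) \<partial>lborel) = (\<integral>\<^sup>+x. \<integral>\<^sup>+y. f (Complex (a * x - b * y) (b * x + a * y)) \<partial>lborel \<partial>lborel)"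
    by (subst nn_integral_complex) (auto simp: cm)
  also have "ennreal ((cmod c)\<^sup>2) * \<dots> = (\<integral>\<^sup>+x. \<integral>\<^sup>+y. f (Complex x y) \<partial>lborel \<partial>lborel)"
  proof (cases "a = 0")
    case True
    then have b0: "b \<noteq> 0" using pos by auto
    have "(\<integral>\<^sup>+x. \<integral>\<^sup>+y. f (Complex x y) \<partial>lborel \<partial>lborel) = (\<integral>\<^sup>+y. \<integral>\<^sup>+x. f (Complex x y) \<partial>lborel \<partial>lborel)"
      by (rule lborel_pair.Fubini') measurable
    also have "\<dots> = \<bar>b\<bar> * (\<integral>\<^sup>+x. \<integral>\<^sup>+y. f (Complex y (0 + b * x)) \<partial>lborel \<partial>lborel)"
      by (subst nn_integral_real_affine[where c=b and t=0, OF _ b0]) auto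
    also have "\<dots> = \<bar>b\<bar> * (\<integral>\<^sup>+x. \<bar>-b\<bar> * (\<integral>\<^sup>+y. f (Complex (0 + (- b) * y) (0 + b * x)) \<partial>lborel) \<partial>lborel)"
      using b0 by (subst nn_integral_real_affine[where c="-b" and t=0]) auto
    also have "\<dots> = ennreal \<bar>b\<bar> * ennreal \<bar>b\<bar> * (\<integral>\<^sup>+x. (\<integral>\<^sup>+y. f (Complex (0 + (- b) * y) (0 + b * x)) \<partial>lborel) \<partial>lborel)"
      by (subst nn_integral_cmult) (auto simp: mult.assoc)
    also have "ennreal \<bar>b\<bar> * ennreal \<bar>b\<bar> = ennreal ((cmod c)\<^sup>2)"
      by (simp only: c2 True ennreal_mult[symmetric] abs_ge_zero) (simp add: power2_eq_square)
    finally show ?thesis using True by simp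
  next
    case False
    have d: "b\<^sup>2 / a + a \<noteq> 0" using pos False by (simp add: field_simps power2_eq_square)
    have "(\<integral>\<^sup>+x. \<integral>\<^sup>+y. f (Complex (a * x - b * y) (b * x + a * y)) \<partial>lborel \<partial>lborel)
        = (\<integral>\<^sup>+y. \<integral>\<^sup>+x. f (Complex (a * x - b * y) (b * x + a * y)) \<partial>lborel \<partial>lborel)"
      by (rule lborel_pair.Fubini') measurable
    \<comment> \<open>Substituting \<open>b/a * y + 1/a * x\<close> for \<open>x\<close> leaves
      \<open>x\<close> alone in the first coordinate; the second becomes affine in \<open>y\<close>
      with slope \<open>b^2/a + a = (cmod c)^2 / a\<close>.\<close>
    also have "\<dots> = (\<integral>\<^sup>+y. ennreal \<bar>1/a\<bar> * (\<integral>\<^sup>+x. f (Complex x (b/a * x + (b\<^sup>2/a + a) * y)) \<partial>lborel) \<partial>lborel)"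
    proof (rule nn_integral_cong)
      fix y
      have eq: "Complex (a * (b / a * y + 1 / a * x) - b * y) (b * (b / a * y + 1 / a * x) + a * y)
        = Complex x (b/a * x + (b\<^sup>2/a + a) * y)" for x
        using False by (simp add: field_simps power2_eq_square)
      show "(\<integral>\<^sup>+x. f (Complex (a * x - b * y) (b * x + a * y)) \<partial>lborel) =
          ennreal \<bar>1/a\<bar> * (\<integral>\<^sup>+x. f (Complex x (b/a * x + (b\<^sup>2/a + a) * y)) \<partial>lborel)"
        by (subst nn_integral_real_affine[where c="1/a" and t="b/a*y"]) (use False eq in auto)
    qed
    also have "\<dots> = ennreal \<bar>1/a\<bar> * (\<integral>\<^sup>+y. (\<integral>\<^sup>+x. f (Complex x (b/a * x + (b\<^sup>2/a + a) * y)) \<partial>lborel) \<partial>lborel)"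
      by (rule nn_integral_cmult) measurable
    also have "(\<integral>\<^sup>+y. (\<integral>\<^sup>+x. f (Complex x (b/a * x + (b\<^sup>2/a + a) * y)) \<partial>lborel) \<partial>lborel)
      = (\<integral>\<^sup>+x. (\<integral>\<^sup>+y. f (Complex x (b/a * x + (b\<^sup>2/a + a) * y)) \<partial>lborel) \<partial>lborel)"
      by (rule lborel_pair.Fubini') measurable
    finally have 1: "(\<integral>\<^sup>+x. \<integral>\<^sup>+y. f (Complex (a * x - b * y) (b * x + a * y)) \<partial>lborel \<partial>lborel)
      = ennreal \<bar>1/a\<bar> * (\<integral>\<^sup>+x. (\<integral>\<^sup>+y. f (Complex x (b/a * x + (b\<^sup>2/a + a) * y)) \<partial>lborel) \<partial>lborel)" .
    have "(\<integral>\<^sup>+x. \<integral>\<^sup>+y. f (Complex x y) \<partial>lborel \<partial>lborel) =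
      (\<integral>\<^sup>+x. ennreal \<bar>b\<^sup>2/a + a\<bar> * (\<integral>\<^sup>+y. f (Complex x (b/a * x + (b\<^sup>2/a + a) * y)) \<partial>lborel) \<partial>lborel)"
      by (intro nn_integral_cong nn_integral_real_affine d) measurable
    also have "\<dots> = ennreal \<bar>b\<^sup>2/a + a\<bar> * (\<integral>\<^sup>+x. (\<integral>\<^sup>+y. f (Complex x (b/a * x + (b\<^sup>2/a + a) * y)) \<partial>lborel) \<partial>lborel)"
      by (rule nn_integral_cmult) measurable
    also have "\<bar>b\<^sup>2/a + a\<bar> = (cmod c)\<^sup>2 * \<bar>1/a\<bar>"
    proof -
      have "b\<^sup>2/a + a = (cmod c)\<^sup>2 * (1/a)" unfolding c2 using False by (simp add: field_simps power2_eq_square)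
      then show ?thesis by (simp add: abs_mult)
    qed
    finally show ?thesis
      unfolding 1 by (simp only: ennreal_mult zero_le_power2 abs_ge_zero mult.assoc)
  qed
  also have "\<dots> = (\<integral>\<^sup>+z. f z \<partial>lborel)"
    by (subst nn_integral_complex) auto
  finally show ?thesis by simp
qed

lemma nn_integral_complex_affine:
  fixes c :: complex
  assumes f[measurable]: "f \<in> borel_measurable borel" and c: "c \<noteq> 0"
  shows "(\<integral>\<^sup>+z. f z \<partial>lborel) = ennreal ((cmod c)\<^sup>2) * (\<integral>\<^sup>+z. f (s + c * z) \<partial>lborel)"
proof -
  have "(\<integral>\<^sup>+z. f z \<partial>lborel) = (\<integral>\<^sup>+z. f (s + z) \<partial>lborel)"
    by (subst lborel_distr_plus[of s, symmetric], subst nn_integral_distr) auto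
  also have "\<dots> = ennreal ((cmod c)\<^sup>2) * (\<integral>\<^sup>+z. f (s + c * z) \<partial>lborel)"
    by (rule nn_integral_complex_mult) (use c in auto)
  finally show ?thesis .
qed

type_synonym point = "nat \<Rightarrow> complex"

definition cvol :: "nat \<Rightarrow> point measure" where
  "cvol n = PiM {..<n} (\<lambda>_. lborel)"

text \<open>The restriction keeps the image in the extensional function space on which
  \<open>cvol n\<close> lives. Translations by codewords, scalings by the fading, dilations about a
  point and reflections are all instances.\<close>

definition caff :: "nat \<Rightarrow> point \<Rightarrow> point \<Rightarrow> point \<Rightarrow> point" where
  "caff n s c z = (\<lambda>i\<in>{..<n}. s i + c i * z i)"

interpretation lborel_prod: product_sigma_finite "\<lambda>_. lborel"
  by standard

lemma space_cvol: "space (cvol n) = (\<Pi>\<^sub>E i\<in>{..<n}. UNIV)"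
  by (simp add: cvol_def space_PiM)

lemma sets_cvol[measurable_cong]: "sets (cvol n) = sets (PiM {..<n} (\<lambda>_. borel))"
  unfolding cvol_def by (rule sets_PiM_cong) auto

lemma measurable_caff[measurable]: "caff n s c \<in> cvol n \<rightarrow>\<^sub>M cvol n"
  unfolding caff_def cvol_def by measurable

lemma sigma_finite_cvol: "sigma_finite_measure (cvol n)"
  unfolding cvol_def by (intro lborel_prod.sigma_finite) simp

text \<open>The scaled image measure agrees with \<open>cvol n\<close> on rectangles, where the
  claim is the one-dimensional one; uniqueness of the product measure does the rest.\<close>

lemma nn_integral_caff:
  assumes f: "f \<in> borel_measurable (cvol n)" and c: "\<And>i. i < n \<Longrightarrow> c i \<noteq> 0"
  shows "(\<integral>\<^sup>+z. f z \<partial>cvol n) = ennreal (\<Prod>i<n. (cmod (c i))\<^sup>2) * (\<integral>\<^sup>+z. f (caff n s c z) \<partial>cvol n)"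
proof -
  let ?P = "scale_measure (ennreal (\<Prod>i<n. (cmod (c i))\<^sup>2)) (distr (cvol n) (cvol n) (caff n s c))"
  have "?P = PiM {..<n} (\<lambda>_. lborel)"
  proof (rule lborel_prod.PiM_eqI)
    fix A :: "nat \<Rightarrow> complex set" assume A: "\<And>i. i \<in> {..<n} \<Longrightarrow> A i \<in> sets lborel"
    have A': "Pi\<^sub>E {..<n} A \<in> sets (cvol n)" unfolding cvol_def using A by (intro sets_PiM_I_finite) auto
    have v: "caff n s c -` Pi\<^sub>E {..<n} A \<inter> space (cvol n) = (\<Pi>\<^sub>E i\<in>{..<n}. (\<lambda>z. s i + c i * z) -` A i)"
      by (auto simp: caff_def space_cvol PiE_iff extensional_def)
    have Am: "(\<lambda>z. s i + c i * z) -` A i \<in> sets borel" if "i < n" for i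
      using measurable_sets[of "\<lambda>z. s i + c i * z" borel borel "A i"] A[of i] that by auto
    have 1: "emeasure lborel (A i) = ennreal ((cmod (c i))\<^sup>2) * emeasure lborel ((\<lambda>z. s i + c i * z) -` A i)" if "i < n" for i
    proof -
      have "(\<lambda>z. indicator (A i) (s i + c i * z) :: ennreal) = indicator ((\<lambda>z. s i + c i * z) -` A i)"
        by (auto simp: fun_eq_iff indicator_def)
      then show ?thesis
        using nn_integral_complex_affine[of "indicator (A i)" "c i" "s i"] A[of i] that c[OF that] Am[OF that]
        by simp
    qed
    have "emeasure ?P (Pi\<^sub>E {..<n} A) = ennreal (\<Prod>i<n. (cmod (c i))\<^sup>2) * emeasure (cvol n) (\<Pi>\<^sub>E i\<in>{..<n}. (\<lambda>z. s i + c i * z) -` A i)"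
      using A' by (simp add: emeasure_scale_measure emeasure_distr v)
    also have "emeasure (cvol n) (\<Pi>\<^sub>E i\<in>{..<n}. (\<lambda>z. s i + c i * z) -` A i) = (\<Prod>i<n. emeasure lborel ((\<lambda>z. s i + c i * z) -` A i))"
      unfolding cvol_def using Am by (subst lborel_prod.emeasure_PiM) auto
    also have "ennreal (\<Prod>i<n. (cmod (c i))\<^sup>2) * \<dots> = (\<Prod>i<n. emeasure lborel (A i))"
      using 1 by (simp add: prod_ennreal[symmetric] prod.distrib[symmetric])
    finally show "emeasure ?P (Pi\<^sub>E {..<n} A) = (\<Prod>i\<in>{..<n}. emeasure lborel (A i))" .
  qed (auto simp: cvol_def)
  then have "(\<integral>\<^sup>+z. f z \<partial>cvol n) = (\<integral>\<^sup>+z. f z \<partial>?P)"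
    by (simp add: cvol_def)
  also have "\<dots> = ennreal (\<Prod>i<n. (cmod (c i))\<^sup>2) * (\<integral>\<^sup>+z. f (caff n s c z) \<partial>cvol n)"
    using f by (subst nn_integral_scale_measure) (auto simp: nn_integral_distr)
  finally show ?thesis .
qed

section \<open>A Berry--Esseen bound\<close>

text \<open>Rescaling of \<open>norm_power_diff\<close> from the unit disc. The factor
  \<open>r ^ (n - 1)\<close> is what matters: with \<open>r = 1 / sqrt (1 + t^2)\<close> it supplies
  the decay in \<open>t\<close> of the Levy integrand.\<close>

lemma norm_power_diff_le:
  fixes z w :: complex
  assumes "cmod z \<le> r" "cmod w \<le> r" "r > 0" "n \<ge> 1"
  shows "cmod (z ^ n - w ^ n) \<le> real n * cmod (z - w) * r ^ (n - 1)"
proof -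
  have n: "cmod (z / of_real r) \<le> 1" "cmod (w / of_real r) \<le> 1" using assms by (auto simp: norm_divide)
  have "cmod (z ^ n - w ^ n) = r ^ n * cmod ((z / of_real r) ^ n - (w / of_real r) ^ n)"
  proof -
    have "z ^ n - w ^ n = of_real (r ^ n) * ((z / of_real r) ^ n - (w / of_real r) ^ n)"
      using assms by (simp add: power_divide right_diff_distrib)
    then show ?thesis using assms by (simp add: norm_mult norm_power)
  qed
  also have "\<dots> \<le> r ^ n * (real n * cmod (z / of_real r - w / of_real r))"
    using assms by (intro mult_left_mono norm_power_diff n) auto
  also have "cmod (z / of_real r - w / of_real r) = cmod (z - w) / r"
    using assms by (simp add: diff_divide_distrib[symmetric] norm_divide)
  also have "r ^ n * (real n * (cmod (z - w) / r)) = real n * cmod (z - w) * r ^ (n - 1)"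
    using assms by (cases n) (auto simp: field_simps)
  finally show ?thesis .
qed

lemma exp_minus_taylor2:
  fixes u :: real assumes "u \<ge> 0"
  shows "\<bar>exp (- u) - (1 - u)\<bar> \<le> u\<^sup>2 / 2"
proof -
  have p: "1 + u + u\<^sup>2 / 2 > 0" using assms by (simp add: add_pos_nonneg)
  have "1 \<le> (1 - u + u\<^sup>2 / 2) * (1 + u + u\<^sup>2 / 2)"
    using zero_le_power[OF assms, of 4] by (simp add: algebra_simps power2_eq_square power4_eq_xxxx)
  then have "inverse (1 + u + u\<^sup>2 / 2) \<le> 1 - u + u\<^sup>2 / 2"
    using p by (simp add: field_simps)
  moreover have "exp (- u) \<le> inverse (1 + u + u\<^sup>2 / 2)"
    unfolding exp_minus using exp_lower_Taylor_quadratic[OF assms] p by (intro le_imp_inverse_le) auto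
  moreover have "exp (- u) \<ge> 1 - u" using exp_ge_add_one_self[of "-u"] by simp
  ultimately show ?thesis by auto
qed

lemma has_bochner_integral_inverse_square:
  fixes m :: real assumes m: "m > 0"
  shows "has_bochner_integral lborel (\<lambda>t. 1 / (1 + m * t\<^sup>2)) (pi / sqrt m)"
proof -
  have "has_bochner_integral lborel (\<lambda>t::real. inverse (1 + t\<^sup>2)) pi"
    using integrable_inverse_1_plus_square LBINT_inverse_1_plus_square
    by (simp add: has_bochner_integral_iff set_integrable_def interval_lebesgue_integral_def set_lebesgue_integral_def)
  then have "has_bochner_integral lborel (\<lambda>t::real. inverse (1 + (0 + sqrt m * t)\<^sup>2)) (pi /\<^sub>R \<bar>sqrt m\<bar>)"
    using m by (subst lborel_has_bochner_integral_real_affine_iff[symmetric]) auto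
  then show ?thesis using m by (simp add: power_mult_distrib inverse_eq_divide)
qed

text \<open>Lowering the exponent to \<open>4 * m\<close> gives the square of
  \<open>(1 + t^2) ^ m\<close>, which Bernoulli bounds below by \<open>(1 + m * t^2)^2\<close>; one
  of these two factors absorbs \<open>t^2\<close>. The right-hand side integrates to order
  \<open>n^(-3/2)\<close>, so the factor \<open>n\<close> of the telescoped power difference still
  leaves \<open>1 / sqrt n\<close>. The condition \<open>n \<ge> 5\<close> makes \<open>m\<close>
  positive.\<close>

lemma rate_integrand_bound:
  fixes t :: real
  assumes "n \<ge> 5" and m: "m = (n - 1) div 4"
  shows "t\<^sup>2 * (1 / sqrt (1 + t\<^sup>2)) ^ (n - 1) \<le> (1 / real m) * (1 / (1 + real m * t\<^sup>2))"
proof -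
  have m1: "m \<ge> 1" using assms by auto
  have p: "1 + t\<^sup>2 > 0" by (simp add: add_pos_nonneg)
  have "(1 / sqrt (1 + t\<^sup>2)) ^ (n - 1) \<le> (1 / sqrt (1 + t\<^sup>2)) ^ (4 * m)"
    using m p by (intro power_decreasing) auto
  also have "\<dots> = 1 / ((1 + t\<^sup>2) ^ m)\<^sup>2"
  proof -
    have "(1 / sqrt (1 + t\<^sup>2)) ^ (4 * m) = 1 / (((sqrt (1 + t\<^sup>2))\<^sup>2) ^ m)\<^sup>2"
      by (simp only: power_divide power_mult[symmetric] power_one) (simp add: mult.commute mult.left_commute)
    then show ?thesis using p by simp
  qed
  also have "\<dots> \<le> 1 / (1 + real m * t\<^sup>2)\<^sup>2"
  proof -
    have "(1 + t\<^sup>2) ^ m \<ge> 1 + real m * t\<^sup>2" by (rule Bernoulli_inequality) (use zero_le_power2[of t] in linarith)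
    then show ?thesis
      using m1 by (intro divide_left_mono power_mono mult_pos_pos zero_less_power) (auto simp: add_pos_nonneg)
  qed
  finally have "t\<^sup>2 * (1 / sqrt (1 + t\<^sup>2)) ^ (n - 1) \<le> t\<^sup>2 * (1 / (1 + real m * t\<^sup>2)\<^sup>2)"
    by (rule mult_left_mono) simp
  also have "\<dots> \<le> (1 / real m) * (1 / (1 + real m * t\<^sup>2))"
  proof -
    have q: "1 + real m * t\<^sup>2 > 0" by (simp add: add_pos_nonneg)
    have "t\<^sup>2 * real m \<le> 1 + real m * t\<^sup>2" by simp
    then show ?thesis using q m1 by (simp add: divide_simps power2_eq_square) 
  qed
  finally show ?thesis .
qed

section \<open>From characteristic functions to distribution functions\<close>

lemma (in real_distribution) nonatom_between:
  assumes "x < (y::real)" and N: "real_distribution N"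
  shows "\<exists>z. x < z \<and> z < y \<and> measure M {z} = 0 \<and> measure N {z} = 0"
proof -
  interpret N: real_distribution N by fact
  have "countable ({z. measure M {z} \<noteq> 0} \<union> {z. measure N {z} \<noteq> 0})"
    using countable_support N.countable_support by (simp)
  moreover have "uncountable {x<..<y}" using assms by (simp add: uncountable_open_interval)
  ultimately have "\<not> {x<..<y} \<subseteq> {z. measure M {z} \<noteq> 0} \<union> {z. measure N {z} \<noteq> 0}"
    using countable_subset by blast
  then show ?thesis by auto
qed

text \<open>Levy inversion speaks only of intervals whose endpoints carry no mass. Atoms are
  countable, so such endpoints are dense: sending \<open>a\<close> to minus infinity through them
  bounds the difference of the cdfs at every such \<open>b\<close>, and right continuity extends
  this to every \<open>x\<close>.\<close>

lemma cdf_diff_le_of_interval_diff_le: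
  assumes "real_distribution M" "real_distribution N"
    and K: "\<And>a b. a \<le> b \<Longrightarrow> measure M {a} = 0 \<Longrightarrow> measure M {b} = 0 \<Longrightarrow> measure N {a} = 0 \<Longrightarrow> measure N {b} = 0
      \<Longrightarrow> \<bar>measure M {a<..b} - measure N {a<..b}\<bar> \<le> K"
  shows "\<bar>cdf M x - cdf N x\<bar> \<le> K"
proof -
  interpret M: real_distribution M by fact
  interpret N: real_distribution N by fact
  have 1: "\<bar>cdf M b - cdf N b\<bar> \<le> K" if b: "measure M {b} = 0" "measure N {b} = 0" for b
  proof -
    have "\<forall>k::nat. \<exists>a. b - real k - 1 < a \<and> a < b - real k \<and> measure M {a} = 0 \<and> measure N {a} = 0"
      by (intro allI M.nonatom_between N.real_distribution_axioms) auto
    then obtain a where a: "\<And>k. b - real k - 1 < a k \<and> a k < b - real k \<and> measure M {a k} = 0 \<and> measure N {a k} = 0"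
      by metis
    have lim: "filterlim a at_bot sequentially"
    proof (rule filterlim_at_bot_mono[of "\<lambda>k. b - real k"])
      show "filterlim (\<lambda>k. b - real k) at_bot sequentially"
        unfolding filterlim_uminus_at_bot
        using filterlim_tendsto_add_at_top[OF tendsto_const filterlim_real_sequentially, of "-b"] by simp
      show "\<forall>\<^sub>F k in sequentially. a k \<le> b - real k" using a by (auto intro!: always_eventually less_imp_le)
    qed
    have "(\<lambda>k. \<bar>(cdf M b - cdf M (a k)) - (cdf N b - cdf N (a k))\<bar>) \<longlonglongrightarrow> \<bar>(cdf M b - 0) - (cdf N b - 0)\<bar>"
      using filterlim_compose[OF M.cdf_lim_at_bot lim] filterlim_compose[OF N.cdf_lim_at_bot lim]
      by (intro tendsto_intros)
    moreover have "\<bar>(cdf M b - cdf M (a k)) - (cdf N b - cdf N (a k))\<bar> \<le> K" for k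
    proof -
      have "a k < b" using a[of k] by (smt (verit) of_nat_0_le_iff)
      then show ?thesis using K[of "a k" b] a[of k] b
        by (simp add: M.cdf_diff_eq N.cdf_diff_eq)
    qed
    ultimately show ?thesis by (auto intro: tendsto_upperbound)
  qed
  have "\<forall>k::nat. \<exists>a. x < a \<and> a < x + 1 / (real k + 1) \<and> measure M {a} = 0 \<and> measure N {a} = 0"
    by (intro allI M.nonatom_between N.real_distribution_axioms) auto
  then obtain b where b: "\<And>k. x < b k \<and> b k < x + 1 / (real k + 1) \<and> measure M {b k} = 0 \<and> measure N {b k} = 0"
    by metis
  have "b \<longlonglongrightarrow> x"
  proof (rule tendsto_sandwich[of "\<lambda>_. x" _ _ "\<lambda>k. x + 1 / (real k + 1)"])
    have "(\<lambda>k. x + 1 / (real k + 1)) \<longlonglongrightarrow> x + 0"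
      using LIMSEQ_inverse_real_of_nat by (intro tendsto_intros) (simp add: inverse_eq_divide add.commute)
    then show "(\<lambda>k. x + 1 / (real k + 1)) \<longlonglongrightarrow> x" by simp
  qed (use b in \<open>auto intro!: always_eventually less_imp_le\<close>)
  then have lim: "filterlim b (at_right x) sequentially"
    using b by (auto simp: filterlim_at intro!: always_eventually)
  have "(\<lambda>k. \<bar>cdf M (b k) - cdf N (b k)\<bar>) \<longlonglongrightarrow> \<bar>cdf M x - cdf N x\<bar>"
    using filterlim_compose[OF M.cdf_is_right_cont[unfolded continuous_within] lim]
      filterlim_compose[OF N.cdf_is_right_cont[unfolded continuous_within] lim]
    by (intro tendsto_intros)
  then show ?thesis using 1 b by (auto intro: tendsto_upperbound)
qed

text \<open>The dominating function \<open>g\<close> depends neither on the truncation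
  \<open>T\<close> nor on the interval, so the bound is uniform. Its constant is the
  \<open>1 / (2 * pi)\<close> of the inversion formula times the 2 in \<open>Fb2\<close>.\<close>

lemma interval_diff_le_of_char:
  assumes "real_distribution M" "real_distribution N" "a \<le> b"
    and at: "measure M {a} = 0" "measure M {b} = 0" "measure N {a} = 0" "measure N {b} = 0"
    and g: "integrable lborel g" "\<And>t. t \<noteq> 0 \<Longrightarrow> cmod (char M t - char N t) / \<bar>t\<bar> \<le> g t"
  shows "\<bar>measure M {a<..b} - measure N {a<..b}\<bar> \<le> (\<integral>t. g t \<partial>lborel) / pi"
proof -
  interpret M: real_distribution M by fact
  interpret N: real_distribution N by fact
  define F where "F t = (iexp (-(t * a)) - iexp (-(t * b))) / (\<i> * complex_of_real t)" for t :: real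
  \<comment> \<open>This bound depends on the interval and serves only the integrability of the
    truncated integrands near \<open>t = 0\<close>; the final estimate uses
    \<open>Fb2\<close>.\<close>
  have Fb: "cmod (F t) \<le> b - a" if "t \<noteq> 0" for t
    using Levy_Inversion_aux2[of "-b" "-a" t] that \<open>a \<le> b\<close> by (simp add: F_def)
  have Fb2: "cmod (F t) \<le> 2 / \<bar>t\<bar>" if "t \<noteq> 0" for t
  proof -
    have "cmod (iexp (-(t * a)) - iexp (-(t * b))) \<le> 1 + 1"
      using norm_triangle_ineq4[of "iexp (-(t * a))" "iexp (-(t * b))"] norm_exp_i_times[of "-(t*a)"] norm_exp_i_times[of "-(t*b)"]
      by simp
    then show ?thesis using that by (simp add: F_def norm_divide norm_mult divide_right_mono)
  qed
  have [measurable]: "F \<in> borel_measurable borel" unfolding F_def by measurable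
  have g0: "0 \<le> g t" if "t \<noteq> 0" for t using g(2)[OF that] by (meson divide_nonneg_nonneg norm_ge_zero abs_ge_zero order_trans)
  have int: "interval_lebesgue_integrable lborel (ereal (- T)) (ereal T) (\<lambda>t. F t * char P t)"
    if P: "real_distribution P" for P T
  proof -
    interpret P: real_distribution P by fact
    show ?thesis
      unfolding interval_lebesgue_integrable_def set_integrable_def
      using P.cmod_char_le_1 Fb \<open>a \<le> b\<close>
      by (auto intro!: integrableI_bounded_set_indicator[where B="b - a"] AE_I[of _ _ "{0}"] simp: norm_mult mult_left_le_one_le)
        (metis mult_left_le norm_ge_zero order_trans)+
  qed
  have "(\<lambda>T::nat. 1 / (2 * pi) * (CLBINT t=-real T..real T. F t * char M t) - 1 / (2 * pi) * (CLBINT t=-real T..real T. F t * char N t))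
     \<longlonglongrightarrow> of_real (measure M {a<..b}) - of_real (measure N {a<..b})"
    using M.Levy_Inversion[OF \<open>a \<le> b\<close> at(1,2)] N.Levy_Inversion[OF \<open>a \<le> b\<close> at(3,4)]
    unfolding F_def[symmetric] by (intro tendsto_diff) simp_all
  then have lim: "(\<lambda>T::nat. cmod (1 / (2 * pi) * (CLBINT t=-real T..real T. F t * char M t) - 1 / (2 * pi) * (CLBINT t=-real T..real T. F t * char N t)))
     \<longlonglongrightarrow> \<bar>measure M {a<..b} - measure N {a<..b}\<bar>"
    by (rule tendsto_norm[THEN tendsto_eq_rhs]) (simp add: of_real_diff[symmetric] del: of_real_diff)
  have "cmod (1 / (2 * pi) * (CLBINT t=-real T..real T. F t * char M t) - 1 / (2 * pi) * (CLBINT t=-real T..real T. F t * char N t))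
      \<le> (\<integral>t. g t \<partial>lborel) / pi" for T :: nat
  proof -
    have "(CLBINT t=-real T..real T. F t * char M t) - (CLBINT t=-real T..real T. F t * char N t)
       = (CLBINT t=-real T..real T. F t * char M t - F t * char N t)"
      using int[OF M.real_distribution_axioms, of T] int[OF N.real_distribution_axioms, of T]
      by (subst interval_lebesgue_integral_diff(2)) auto
    also have "\<dots> = (CLINT t|lborel. indicator {-real T<..<real T} t *\<^sub>R (F t * (char M t - char N t)))"
      by (simp add: interval_lebesgue_integral_def set_lebesgue_integral_def algebra_simps)
    also have "cmod \<dots> \<le> (\<integral>t. 2 * g t \<partial>lborel)"
    proof (rule order_trans[OF integral_norm_bound integral_mono_AE])
      show "integrable lborel (\<lambda>t. 2 * g t)" using g by simp
      have "integrable lborel (\<lambda>t. indicator {-real T<..<real T} t *\<^sub>R (F t * char M t) - indicator {-real T<..<real T} t *\<^sub>R (F t * char N t))"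
        using int[OF M.real_distribution_axioms, of T] int[OF N.real_distribution_axioms, of T]
        by (intro Bochner_Integration.integrable_diff) (auto simp: interval_lebesgue_integrable_def set_integrable_def)
      then have "integrable lborel (\<lambda>t. indicator {-real T<..<real T} t *\<^sub>R (F t * (char M t - char N t)))"
        by (simp add: algebra_simps)
      then show "integrable lborel (\<lambda>t. cmod (indicator {-real T<..<real T} t *\<^sub>R (F t * (char M t - char N t))))"
        by (rule integrable_norm)
      have pt: "cmod (indicat_real {- real T<..<real T} t *\<^sub>R (F t * (char M t - char N t))) \<le> 2 * g t" if "t \<noteq> 0" for t
      proof -
        have "cmod (F t * (char M t - char N t)) \<le> 2 / \<bar>t\<bar> * cmod (char M t - char N t)"
          unfolding norm_mult by (intro mult_right_mono Fb2 that) simp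
        also have "\<dots> = 2 * (cmod (char M t - char N t) / \<bar>t\<bar>)" by simp
        also have "\<dots> \<le> 2 * g t" using g(2)[OF that] by simp
        finally show ?thesis using g0[OF that] by (simp add: indicator_def)
      qed
      show "AE t in lborel. cmod (indicat_real {- real T<..<real T} t *\<^sub>R (F t * (char M t - char N t))) \<le> 2 * g t"
        using AE_lborel_singleton[of 0] by eventually_elim (rule pt)
    qed
    finally have "cmod ((CLBINT t=-real T..real T. F t * char M t) - (CLBINT t=-real T..real T. F t * char N t)) \<le> 2 * (\<integral>t. g t \<partial>lborel)"
      by simp
    then show ?thesis
      unfolding right_diff_distrib[symmetric] norm_mult
      by (simp add: field_simps norm_divide norm_mult)
  qed
  with lim show ?thesis by (auto intro: tendsto_upperbound)
qed

definition normal_cdf :: "real \<Rightarrow> real" where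
  "normal_cdf x = measure std_normal_distribution {..x}"

lemma exp_half_square_le: "exp (- (t::real)\<^sup>2 / 2) \<le> 1 / sqrt (1 + t\<^sup>2)"
proof -
  have p: "1 + t\<^sup>2 > 0" by (simp add: add_pos_nonneg)
  have "sqrt (1 + t\<^sup>2) \<le> sqrt (exp (t\<^sup>2))" using exp_ge_add_one_self[of "t\<^sup>2"] by simp
  also have "\<dots> = exp (t\<^sup>2 / 2)" by (intro real_sqrt_unique) (simp_all add: power2_eq_square mult_exp_exp)
  finally have "1 / exp (t\<^sup>2 / 2) \<le> 1 / sqrt (1 + t\<^sup>2)" using p by (intro divide_left_mono) auto
  then show ?thesis by (simp add: exp_minus inverse_eq_divide)
qed

text \<open>A characteristic function bounded by that of an exponential variable makes the difference
  quotient integrable, so Levy inversion yields the uniform bound without a smoothing inequality.\<close>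

theorem berry_esseen_of_exponential_char:
  fixes \<nu> :: "real measure" and V :: real
  assumes "real_distribution \<nu>"
    and i3: "integrable \<nu> (\<lambda>x. \<bar>x\<bar> ^ 3)" and i1: "integrable \<nu> (\<lambda>x. x)" and i2: "integrable \<nu> (\<lambda>x. x\<^sup>2)"
    and mean: "(\<integral>x. x \<partial>\<nu>) = 0" and var: "(\<integral>x. x\<^sup>2 \<partial>\<nu>) = V" and V: "V \<ge> 1"
    and ch: "\<And>t. cmod (char \<nu> t) \<le> 1 / sqrt (1 + t\<^sup>2)"
  shows "\<exists>C\<ge>0. \<forall>n\<ge>5. \<forall>\<mu>. real_distribution \<mu> \<longrightarrow> (\<forall>t. char \<mu> t = char \<nu> t ^ n) \<longrightarrow>
           (\<forall>x. \<bar>cdf \<mu> x - normal_cdf (x / sqrt (n * V))\<bar> \<le> C / sqrt n)"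
proof -
  interpret \<nu>: real_distribution \<nu> by fact
  define \<rho> where "\<rho> = (\<integral>x. \<bar>x\<bar> ^ 3 \<partial>\<nu>)"
  have \<rho>0: "\<rho> \<ge> 0" unfolding \<rho>_def by (intro Bochner_Integration.integral_nonneg) simp
  \<comment> \<open>For \<open>\<bar>t\<bar> \<le> 1\<close>, the first summand is the third-order
    remainder of the characteristic function and the second that of the exponential; the 2 covers
    larger \<open>t\<close>, where both functions have modulus at most 1.\<close>
  define C where "C = \<rho> / 6 + V\<^sup>2 / 8 + 2"
  have C0: "C \<ge> 0" using \<rho>0 by (simp add: C_def)
  have \<psi>: "exp (- (V * t\<^sup>2) / 2) \<le> 1 / sqrt (1 + t\<^sup>2)" for t
  proof -
    have "t\<^sup>2 \<le> V * t\<^sup>2" using V mult_right_mono[of 1 V "t\<^sup>2"] by simp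
    then have "exp (- (V * t\<^sup>2) / 2) \<le> exp (- t\<^sup>2 / 2)" by simp
    then show ?thesis using exp_half_square_le[of t] by linarith
  qed
  have le1: "1 / sqrt (1 + t\<^sup>2) \<le> 1" for t :: real
    using real_sqrt_le_mono[of 1 "1 + t\<^sup>2"] by (simp add: divide_le_eq_1 add_pos_nonneg)
  have close: "cmod (char \<nu> t - exp (- (V * t\<^sup>2) / 2)) \<le> C * \<bar>t\<bar> ^ 3" for t
  proof (cases "\<bar>t\<bar> \<le> 1")
    case True
    have "cmod (char \<nu> t - (1 - t\<^sup>2 * V / 2)) \<le> (t\<^sup>2 / 6) * \<nu>.expectation (\<lambda>x. min (6 * x\<^sup>2) (\<bar>t\<bar> * \<bar>x\<bar> ^ 3))"
      using i1 i2 mean var by (intro \<nu>.char_approx3) auto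
    also have "\<nu>.expectation (\<lambda>x. min (6 * x\<^sup>2) (\<bar>t\<bar> * \<bar>x\<bar> ^ 3)) \<le> \<nu>.expectation (\<lambda>x. \<bar>t\<bar> * \<bar>x\<bar> ^ 3)"
      using i3 i2 by (intro integral_mono) (auto intro!: integrable_min)
    also have "\<dots> = \<bar>t\<bar> * \<rho>" by (simp add: \<rho>_def)
    finally have "cmod (char \<nu> t - (1 - t\<^sup>2 * V / 2)) \<le> (t\<^sup>2 / 6) * (\<bar>t\<bar> * \<rho>)"
      by (simp add: mult_left_mono)
    moreover have "\<bar>t\<bar> ^ 3 = t\<^sup>2 * \<bar>t\<bar>" by (simp add: power3_eq_cube power2_eq_square)
    ultimately have 1: "cmod (char \<nu> t - (1 - t\<^sup>2 * V / 2)) \<le> \<rho> / 6 * \<bar>t\<bar> ^ 3"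
      by (simp add: mult_ac)
    have "\<bar>exp (- (V * t\<^sup>2 / 2)) - (1 - V * t\<^sup>2 / 2)\<bar> \<le> (V * t\<^sup>2 / 2)\<^sup>2 / 2"
      using V by (intro exp_minus_taylor2) simp
    also have "\<dots> = V\<^sup>2 / 8 * \<bar>t\<bar> ^ 4" by (simp add: power2_eq_square power4_eq_xxxx)
    also have "\<dots> \<le> V\<^sup>2 / 8 * \<bar>t\<bar> ^ 3" using True by (intro mult_left_mono power_decreasing) auto
    finally have *: "\<bar>exp (- (V * t\<^sup>2 / 2)) - (1 - V * t\<^sup>2 / 2)\<bar> \<le> V\<^sup>2 / 8 * \<bar>t\<bar> ^ 3" .
    have 2: "cmod (complex_of_real (1 - t\<^sup>2 * V / 2) - complex_of_real (exp (- (V * t\<^sup>2) / 2))) \<le> V\<^sup>2 / 8 * \<bar>t\<bar> ^ 3"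
      using * unfolding of_real_diff[symmetric] norm_of_real by (simp add: mult.commute abs_minus_commute)
    have "cmod (char \<nu> t - exp (- (V * t\<^sup>2) / 2)) \<le> \<rho> / 6 * \<bar>t\<bar> ^ 3 + V\<^sup>2 / 8 * \<bar>t\<bar> ^ 3"
      using norm_triangle_mono[OF 1 2] by simp
    also have "\<dots> \<le> C * \<bar>t\<bar> ^ 3" by (simp add: C_def algebra_simps)
    finally show ?thesis .
  next
    case False
    have "cmod (char \<nu> t - exp (- (V * t\<^sup>2) / 2)) \<le> cmod (char \<nu> t) + cmod (exp (- (V * t\<^sup>2) / 2))"
      by (rule norm_triangle_ineq4)
    also have "\<dots> \<le> 1 + 1" using \<nu>.cmod_char_le_1[of t] \<psi>[of t] le1[of t] V by (intro add_mono) auto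
    also have "\<dots> \<le> C * 1" using \<rho>0 by (simp add: C_def)
    also have "\<dots> \<le> C * \<bar>t\<bar> ^ 3" using False C0 by (intro mult_left_mono one_le_power) auto
    finally show ?thesis .
  qed
  have main: "\<bar>cdf \<mu> x - normal_cdf (x / sqrt (n * V))\<bar> \<le> (C * 8 * sqrt 8) / sqrt n"
    if n: "n \<ge> 5" and \<mu>: "real_distribution \<mu>" and chm: "\<And>t. char \<mu> t = char \<nu> t ^ n" for n :: nat and \<mu> x
  proof -
    define s where "s = sqrt (n * V)"
    have s: "s > 0" using n V by (simp add: s_def)
    \<comment> \<open>The comparison law is normal with variance \<open>n * V\<close>, so that its
      characteristic function is an \<open>n\<close>-th power as well and the power difference can
      be telescoped.\<close>
    define N where "N = distr std_normal_distribution borel (\<lambda>x. s * x)"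
    interpret SN: real_distribution std_normal_distribution by (rule real_dist_normal_dist)
    have N: "real_distribution N" unfolding N_def by (rule SN.real_distribution_distr) simp
    have chN: "char N t = complex_of_real (exp (- (V * t\<^sup>2) / 2)) ^ n" for t
    proof -
      have "char N t = char std_normal_distribution (s * t)"
        unfolding char_def N_def by (simp add: integral_distr mult_ac)
      also have "\<dots> = complex_of_real (exp (- (s * t)\<^sup>2 / 2))" by (simp add: char_std_normal_distribution)
      also have "(s * t)\<^sup>2 = n * (V * t\<^sup>2)" using V by (simp add: s_def power_mult_distrib)
      also have "exp (- (n * (V * t\<^sup>2)) / 2) = exp (- (V * t\<^sup>2) / 2) ^ n" by (simp add: exp_of_nat_mult[symmetric])
      finally show ?thesis by simp
    qed
    have cdfN: "cdf N x = normal_cdf (x / s)"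
    proof -
      have "(\<lambda>y. s * y) -` {..x} = {..x / s}" using s by (auto simp: field_simps)
      then show ?thesis by (simp add: cdf_def N_def measure_distr normal_cdf_def)
    qed
    define m where "m = (n - 1) div 4"
    have "n \<le> 8 * m" "m \<ge> 1" using n unfolding m_def by presburger+
    then have m1: "real m \<ge> real n / 8" "m \<ge> 1" by linarith+
    define g where "g t = n * C * (1 / real m) * (1 / (1 + real m * t\<^sup>2))" for t :: real
    have hg: "has_bochner_integral lborel g (n * C * (1 / real m) * (pi / sqrt m))"
      unfolding g_def by (intro has_bochner_integral_mult_right has_bochner_integral_inverse_square) (use m1 in simp)
    have gb: "cmod (char \<mu> t - char N t) / \<bar>t\<bar> \<le> g t" if "t \<noteq> 0" for t
    proof -
      have "cmod (char \<mu> t - char N t) \<le> real n * cmod (char \<nu> t - exp (- (V * t\<^sup>2) / 2)) * (1 / sqrt (1 + t\<^sup>2)) ^ (n - 1)"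
        unfolding chm chN using ch \<psi>[of t] n by (intro norm_power_diff_le) (auto simp: add_pos_nonneg)
      also have "\<dots> \<le> real n * (C * \<bar>t\<bar> ^ 3) * (1 / sqrt (1 + t\<^sup>2)) ^ (n - 1)"
        by (intro mult_right_mono mult_left_mono close) auto
      also have "\<dots> = real n * C * \<bar>t\<bar> * (t\<^sup>2 * (1 / sqrt (1 + t\<^sup>2)) ^ (n - 1))"
        by (simp add: power3_eq_cube power2_eq_square mult_ac)
      also have "\<dots> \<le> real n * C * \<bar>t\<bar> * ((1 / real m) * (1 / (1 + real m * t\<^sup>2)))"
        using C0 by (intro mult_left_mono rate_integrand_bound n m_def) auto
      finally show ?thesis using that by (simp add: g_def field_simps)
    qed
    have "\<bar>cdf \<mu> x - cdf N x\<bar> \<le> (\<integral>t. g t \<partial>lborel) / pi"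
      using hg gb
      by (intro cdf_diff_le_of_interval_diff_le \<mu> N interval_diff_le_of_char) (auto simp: has_bochner_integral_iff)
    also have "\<dots> = C * n / (real m * sqrt m)" using hg by (simp add: has_bochner_integral_iff field_simps)
    \<comment> \<open>From \<open>m \<ge> n / 8\<close>; this is the origin of the factor
      \<open>8 * sqrt 8\<close>. The \<open>pi\<close> of the arctangent integral has cancelled
      against that of the inversion formula.\<close>
    also have "\<dots> \<le> C * n / (real n / 8 * sqrt (real n / 8))"
      using C0 n m1 by (intro divide_left_mono mult_mono) auto
    also have "\<dots> = (C * 8 * sqrt 8) / sqrt n" using n by (simp add: real_sqrt_divide field_simps)
    finally show ?thesis by (simp add: cdfN s_def)
  qed
  show ?thesis
    by (rule exI[of _ "C * 8 * sqrt 8"]) (use main C0 in auto)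
qed

section \<open>Complex Gaussian noise\<close>

text \<open>The disc of radius \<open>\<sigma> * sqrt u\<close> has area linear in \<open>u\<close>,
  which means a constant density on the half-line. The measure is infinite, so uniqueness goes
  through half-lines of finite measure that exhaust the line.\<close>

lemma distr_lborel_cmod_sq:
  assumes s: "\<sigma> > (0::real)"
  shows "distr lborel borel (\<lambda>z::complex. (cmod z)\<^sup>2 / \<sigma>\<^sup>2) = density lborel (\<lambda>u. ennreal (pi * \<sigma>\<^sup>2) * indicator {0..} u)"
    (is "?L = ?R")
proof -
  have L: "emeasure ?L {..u} = ennreal (pi * \<sigma>\<^sup>2 * max 0 u)" for u
  proof (cases "u \<ge> 0")
    case True
    have "(\<lambda>z::complex. (cmod z)\<^sup>2 / \<sigma>\<^sup>2) -` {..u} = cball 0 (\<sigma> * sqrt u)"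
    proof -
      have "(cmod z)\<^sup>2 / \<sigma>\<^sup>2 \<le> u \<longleftrightarrow> cmod z \<le> \<sigma> * sqrt u" for z
      proof -
        have "(cmod z)\<^sup>2 / \<sigma>\<^sup>2 \<le> u \<longleftrightarrow> (cmod z)\<^sup>2 \<le> (\<sigma> * sqrt u)\<^sup>2"
          using s True by (simp add: field_simps power_mult_distrib)
        also have "\<dots> \<longleftrightarrow> cmod z \<le> \<sigma> * sqrt u" using s True by (intro power_mono_iff) auto
        finally show ?thesis .
      qed
      then show ?thesis by (auto simp: dist_norm)
    qed
    then show ?thesis
      using s True by (simp add: emeasure_distr emeasure_cball unit_ball_vol_2 power_mult_distrib mult_ac)
  next
    case False
    have "\<not> (cmod z)\<^sup>2 / \<sigma>\<^sup>2 \<le> u" for z :: complex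
      using False divide_nonneg_nonneg[OF zero_le_power2[of "cmod z"] zero_le_power2[of \<sigma>]] by linarith
    then have "(\<lambda>z::complex. (cmod z)\<^sup>2 / \<sigma>\<^sup>2) -` {..u} = {}" by auto
    then show ?thesis using False by (simp add: emeasure_distr)
  qed
  have R: "emeasure ?R {..u} = ennreal (pi * \<sigma>\<^sup>2 * max 0 u)" for u
  proof -
    have "emeasure ?R {..u} = (\<integral>\<^sup>+x. ennreal (pi * \<sigma>\<^sup>2) * indicator {0..u} x \<partial>lborel)"
      by (subst emeasure_density) (auto intro!: nn_integral_cong simp: indicator_def)
    also have "\<dots> = ennreal (pi * \<sigma>\<^sup>2) * ennreal (max 0 u)"
      by (simp add: nn_integral_cmult emeasure_lborel_Icc_eq max_def ennreal_neg)
    finally show ?thesis by (simp add: ennreal_mult)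
  qed
  show ?thesis
  proof (rule measure_eqI_generator_eq[where E="range (\<lambda>u::real. {..u})" and \<Omega>=UNIV and A="\<lambda>i::nat. {..real i}"])
    show "Int_stable (range (\<lambda>u::real. {..u}))" by (auto simp: Int_stable_def)
    show "emeasure ?L X = emeasure ?R X" if "X \<in> range (\<lambda>u::real. {..u})" for X using that L R by auto
    show "sets ?L = sigma_sets UNIV (range (\<lambda>u::real. {..u}))" "sets ?R = sigma_sets UNIV (range (\<lambda>u::real. {..u}))"
      by (simp_all add: borel_eq_atMost)
    show "(\<Union>i::nat. {..real i}) = UNIV" by (auto intro: real_arch_simple)
    show "emeasure ?L {..real i} \<noteq> \<infinity>" for i by (simp add: L)
  qed auto
qed

text \<open>The Gaussian density is a function of the image variable, so it can be pulled through
  the image measure; the constant \<open>pi * \<sigma>\<^sup>2\<close> then cancels.\<close>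

lemma distr_cgauss_cmod_sq:
  assumes s: "\<sigma> > (0::real)"
  shows "distr (cgauss \<sigma>) borel (\<lambda>z. (cmod z)\<^sup>2 / \<sigma>\<^sup>2) = density lborel (exponential_density 1)"
proof -
  have "distr (cgauss \<sigma>) borel (\<lambda>z. (cmod z)\<^sup>2 / \<sigma>\<^sup>2)
      = distr (density lborel ((\<lambda>u. ennreal (exp (- u) / (pi * \<sigma>\<^sup>2))) \<circ> (\<lambda>z. (cmod z)\<^sup>2 / \<sigma>\<^sup>2))) borel (\<lambda>z. (cmod z)\<^sup>2 / \<sigma>\<^sup>2)"
    by (simp add: cgauss_def comp_def)
  also have "\<dots> = density (distr lborel borel (\<lambda>z::complex. (cmod z)\<^sup>2 / \<sigma>\<^sup>2)) (\<lambda>u. ennreal (exp (- u) / (pi * \<sigma>\<^sup>2)))"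
    by (subst density_distr) (auto simp: comp_def)
  also have "\<dots> = density lborel (\<lambda>u. ennreal (pi * \<sigma>\<^sup>2) * indicator {0..} u * ennreal (exp (- u) / (pi * \<sigma>\<^sup>2)))"
    unfolding distr_lborel_cmod_sq[OF s] by (subst density_density_eq) auto
  also have "\<dots> = density lborel (exponential_density 1)"
    by (intro density_cong)
      (use s in \<open>auto intro!: AE_I2 simp: exponential_density_def indicator_def ennreal_mult[symmetric]\<close>)
  finally show ?thesis .
qed

lemma sets_cgauss[simp, measurable_cong]: "sets (cgauss \<sigma>) = sets borel"
  by (simp add: cgauss_def)

lemma space_cgauss[simp]: "space (cgauss \<sigma>) = UNIV"
  by (simp add: cgauss_def)

text \<open>The normalisation is inherited from the exponential law, and no Gaussian integral is
  evaluated.\<close>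

lemma prob_space_cgauss: "\<sigma> > (0::real) \<Longrightarrow> prob_space (cgauss \<sigma>)"
  using prob_space_exponential_density[of 1] distr_cgauss_cmod_sq[of \<sigma>]
  by (intro prob_space_distrD[of "\<lambda>z. (cmod z)\<^sup>2 / \<sigma>\<^sup>2" "cgauss \<sigma>" borel]) auto

lemma distributed_cgauss_cmod_sq:
  "\<sigma> > 0 \<Longrightarrow> distributed (cgauss \<sigma>) lborel (\<lambda>z. (cmod z)\<^sup>2 / \<sigma>\<^sup>2) (exponential_density 1)"
  using distr_cgauss_cmod_sq[of \<sigma>] distr_cong[of "cgauss \<sigma>" "cgauss \<sigma>" lborel borel "\<lambda>z. (cmod z)\<^sup>2 / \<sigma>\<^sup>2"]
  by (simp add: distributed_def)

definition gdens :: "nat \<Rightarrow> real \<Rightarrow> point \<Rightarrow> real" where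
  "gdens n \<sigma> z = (\<Prod>i<n. exp (- (cmod (z i))\<^sup>2 / \<sigma>\<^sup>2) / (pi * \<sigma>\<^sup>2))"

lemma gdens_pos: "\<sigma> > 0 \<Longrightarrow> gdens n \<sigma> z > 0"
  unfolding gdens_def by (intro prod_pos) auto

lemma ln_gdens: "\<sigma> > 0 \<Longrightarrow> ln (gdens n \<sigma> z) = (\<Sum>i<n. - (cmod (z i))\<^sup>2 / \<sigma>\<^sup>2 - ln (pi * \<sigma>\<^sup>2))"
  unfolding gdens_def by (subst ln_prod) (auto simp: ln_div)

lemma measurable_gdens[measurable]: "gdens n \<sigma> \<in> borel_measurable (cvol n)"
  unfolding gdens_def cvol_def by measurable

lemma noise_vec_eq_density:
  assumes "\<sigma> > 0"
  shows "noise_vec n \<sigma> = density (cvol n) (\<lambda>z. ennreal (gdens n \<sigma> z))"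
proof -
  interpret G: prob_space "cgauss \<sigma>" by (rule prob_space_cgauss[OF assms])
  interpret P: product_sigma_finite "\<lambda>_::nat. cgauss \<sigma>" by standard
  have "density (cvol n) (\<lambda>z. ennreal (gdens n \<sigma> z)) = PiM {..<n} (\<lambda>_. cgauss \<sigma>)"
  proof (rule P.PiM_eqI)
    show "sets (density (cvol n) (\<lambda>z. ennreal (gdens n \<sigma> z))) = sets (PiM {..<n} (\<lambda>_. cgauss \<sigma>))"
      by (simp add: sets_cvol) (rule sets_PiM_cong, auto)
    fix A :: "nat \<Rightarrow> complex set" assume A: "\<And>i. i \<in> {..<n} \<Longrightarrow> A i \<in> sets (cgauss \<sigma>)"
    have A': "Pi\<^sub>E {..<n} A \<in> sets (cvol n)" unfolding cvol_def using A by (intro sets_PiM_I_finite) auto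
    have "emeasure (density (cvol n) (\<lambda>z. ennreal (gdens n \<sigma> z))) (Pi\<^sub>E {..<n} A)
       = (\<integral>\<^sup>+z. ennreal (gdens n \<sigma> z) * indicator (Pi\<^sub>E {..<n} A) z \<partial>cvol n)"
      using A' by (simp add: emeasure_density)
    also have "\<dots> = (\<integral>\<^sup>+z. (\<Prod>i<n. ennreal (exp (- (cmod (z i))\<^sup>2 / \<sigma>\<^sup>2) / (pi * \<sigma>\<^sup>2)) * indicator (A i) (z i)) \<partial>cvol n)"
    proof (rule nn_integral_cong)
      fix z assume "z \<in> space (cvol n)"
      then have "(indicator (Pi\<^sub>E {..<n} A) z :: ennreal) = (\<Prod>i<n. indicator (A i) (z i))"
        by (auto simp: space_cvol indicator_def PiE_iff prod_zero_iff split: if_splits)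
      then show "ennreal (gdens n \<sigma> z) * indicator (Pi\<^sub>E {..<n} A) z
         = (\<Prod>i<n. ennreal (exp (- (cmod (z i))\<^sup>2 / \<sigma>\<^sup>2) / (pi * \<sigma>\<^sup>2)) * indicator (A i) (z i))"
        by (simp add: gdens_def prod.distrib prod_ennreal)
    qed
    also have "\<dots> = (\<Prod>i<n. emeasure (cgauss \<sigma>) (A i))"
      unfolding cvol_def using A
      by (subst lborel_prod.product_nn_integral_prod) (auto simp: cgauss_def emeasure_density)
    finally show "emeasure (density (cvol n) (\<lambda>z. ennreal (gdens n \<sigma> z))) (Pi\<^sub>E {..<n} A)
       = (\<Prod>i\<in>{..<n}. emeasure (cgauss \<sigma>) (A i))" .
  qed simp
  then show ?thesis by (simp add: noise_vec_def)
qed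

lemma prob_space_noise_vec: "\<sigma> > 0 \<Longrightarrow> prob_space (noise_vec n \<sigma>)"
  unfolding noise_vec_def by (intro prob_space_PiM prob_space_cgauss)

lemma space_noise_vec: "space (noise_vec n \<sigma>) = space (cvol n)"
  by (simp add: noise_vec_def cvol_def space_PiM)

lemma sets_noise_vec[measurable_cong]: "sets (noise_vec n \<sigma>) = sets (cvol n)"
  unfolding noise_vec_def cvol_def by (rule sets_PiM_cong) auto

text \<open>With \<open>c = i t - 1\<close> the integrand is \<open>exp (c u)\<close>, whose
  antiderivative \<open>exp (c u) / c\<close> vanishes at infinity because \<open>c\<close> has real
  part -1.\<close>

lemma char_exponential:
  "char (density lborel (exponential_density 1)) t = 1 / (1 - \<i> * t)"
proof -
  let ?c = "\<i> * complex_of_real t - 1"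
  have c0: "?c \<noteq> 0" by (simp add: complex_eq_iff)
  have nrm: "cmod (exp (?c * complex_of_real u)) = exp (- u)" for u by simp
  have int: "integrable lborel (exponential_density 1)"
  proof -
    interpret prob_space "density lborel (exponential_density 1)" by (rule prob_space_exponential_density) simp
    show ?thesis using integrable_density[of "\<lambda>_. 1::real" lborel "exponential_density 1"] by (simp add: integrable_const)
  qed
  \<comment> \<open>The density equals 1 at 0 but the open half-line omits that point, so the two
    integrands agree only almost everywhere.\<close>
  have eq: "exponential_density 1 u *\<^sub>R iexp (t * u) = indicator {0<..} u *\<^sub>R exp (?c * complex_of_real u)" if "u \<noteq> 0" for u
  proof (cases "u > 0")
    case True
    have "exp (?c * complex_of_real u) = exp (- complex_of_real u) * iexp (t * u)"
      by (simp add: mult_exp_exp algebra_simps)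
    then show ?thesis using True
      by (simp add: exponential_density_def scaleR_conv_of_real flip: exp_of_real)
  qed (use that in \<open>simp add: exponential_density_def\<close>)
  have "char (density lborel (exponential_density 1)) t = (CLINT u|lborel. exponential_density 1 u *\<^sub>R iexp (t * u))"
    unfolding char_def by (subst integral_density) auto
  also have "\<dots> = (CLINT u|lborel. indicator {0<..} u *\<^sub>R exp (?c * complex_of_real u))"
    by (rule integral_cong_AE)
      (measurable, rule eventually_mono[OF AE_lborel_singleton[of 0]], rule eq)
  also have "\<dots> = (CLBINT u=0..\<infinity>. exp (?c * complex_of_real u))"
    by (simp add: interval_lebesgue_integral_def set_lebesgue_integral_def einterval_eq zero_ereal_def)
  also have "\<dots> = 0 - 1 / ?c"
  proof (rule interval_integral_FTC_integrable[where F="\<lambda>u. exp (?c * complex_of_real u) / ?c"])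
    show "((\<lambda>u. exp (?c * complex_of_real u) / ?c) has_vector_derivative exp (?c * complex_of_real u)) (at u)" for u
    proof -
      have "((\<lambda>w. exp (?c * w) / ?c) has_field_derivative exp (?c * complex_of_real u)) (at (complex_of_real u))"
        using c0 by (auto intro!: derivative_eq_intros)
      then show ?thesis by (rule has_vector_derivative_real_field)
    qed
    show "isCont (\<lambda>u. exp (?c * complex_of_real u)) u" for u by (intro continuous_intros)
    show "set_integrable lborel (einterval 0 \<infinity>) (\<lambda>u. exp (?c * complex_of_real u))"
      unfolding set_integrable_def
      by (rule Bochner_Integration.integrable_bound[OF int])
        (auto simp: zero_ereal_def exponential_density_def indicator_def nrm intro!: AE_I2)
    show "(((\<lambda>u. exp (?c * complex_of_real u) / ?c) \<circ> real_of_ereal) \<longlongrightarrow> 1 / ?c) (at_right 0)"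
    proof -
      have "((\<lambda>u::real. exp (?c * complex_of_real u) / ?c) \<longlongrightarrow> exp (?c * complex_of_real 0) / ?c) (at_right 0)"
        using c0 by (intro tendsto_intros) auto
      then show ?thesis unfolding zero_ereal_def ereal_tendsto_simps by simp
    qed
    have e0: "((\<lambda>u::real. exp (- u)) \<longlongrightarrow> 0) at_top"
      by (rule filterlim_compose[OF exp_at_bot filterlim_uminus_at_bot_at_top])
    have "((\<lambda>u. exp (- u) / cmod ?c) \<longlongrightarrow> 0 / cmod ?c) at_top"
      by (rule tendsto_divide[OF e0 tendsto_const]) (simp only: norm_eq_zero c0 not_False_eq_True)
    then have "((\<lambda>u. cmod (exp (?c * complex_of_real u) / ?c)) \<longlongrightarrow> 0) at_top"
      by (simp only: norm_divide nrm div_0)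
    then show "(((\<lambda>u. exp (?c * complex_of_real u) / ?c) \<circ> real_of_ereal) \<longlongrightarrow> 0) (at_left \<infinity>)"
      unfolding ereal_tendsto_simps by (rule tendsto_norm_zero_cancel)
  qed simp
  also have "\<dots> = 1 / (1 - \<i> * t)" using c0 by (simp add: divide_simps)
  finally show ?thesis .
qed

lemma cmod_char_exponential:
  "cmod (char (density lborel (exponential_density 1)) t) = 1 / sqrt (1 + t\<^sup>2)"
proof -
  have "cmod (1 - \<i> * t) = sqrt (1 + t\<^sup>2)" by (simp add: cmod_def)
  then show ?thesis by (simp add: char_exponential norm_divide)
qed

section \<open>The information density\<close>

text \<open>Generic in the field, so that the real instance yields moments and the complex instance
  the factorisation of characteristic functions.\<close>

lemma has_bochner_integral_pair_mult:
  fixes f :: "'a \<Rightarrow> 'c::{real_normed_field,banach,second_countable_topology}" and g :: "'b \<Rightarrow> 'c"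
  assumes "sigma_finite_measure M" "sigma_finite_measure N" and f: "integrable M f" and g: "integrable N g"
  shows "has_bochner_integral (M \<Otimes>\<^sub>M N) (\<lambda>p. f (fst p) * g (snd p)) (integral\<^sup>L M f * integral\<^sup>L N g)"
proof -
  interpret M: sigma_finite_measure M by fact
  interpret N: sigma_finite_measure N by fact
  interpret P: pair_sigma_finite M N ..
  have [measurable]: "f \<in> borel_measurable M" "g \<in> borel_measurable N" using f g by auto
  have int: "integrable (M \<Otimes>\<^sub>M N) (\<lambda>p. f (fst p) * g (snd p))"
  proof (rule P.Fubini_integrable)
    have "integrable M (\<lambda>x. norm (f x) * (LINT y|N. norm (g y)))" using f by (intro integrable_mult_left integrable_norm)
    then show "integrable M (\<lambda>x. LINT y|N. norm (f (fst (x, y)) * g (snd (x, y))))"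
      using g by (simp add: norm_mult)
    show "AE x in M. integrable N (\<lambda>y. f (fst (x, y)) * g (snd (x, y)))" using g by simp
  qed measurable
  have "integral\<^sup>L (M \<Otimes>\<^sub>M N) (\<lambda>p. f (fst p) * g (snd p)) = (\<integral>x. \<integral>y. f x * g y \<partial>N \<partial>M)"
    using P.integral_fst'[OF int] by simp
  also have "\<dots> = integral\<^sup>L M f * integral\<^sup>L N g" using f g by simp
  finally show ?thesis using int by (simp add: has_bochner_integral_iff)
qed

lemma abs_diff_cube_le: "\<bar>a - b\<bar> ^ 3 \<le> 8 * (\<bar>a\<bar> ^ 3 + \<bar>b :: real\<bar> ^ 3)"
proof -
  have "\<bar>a - b\<bar> ^ 3 \<le> (2 * max \<bar>a\<bar> \<bar>b\<bar>) ^ 3" by (intro power_mono) auto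
  also have "\<dots> = 8 * max \<bar>a\<bar> \<bar>b\<bar> ^ 3" by (simp add: power_mult_distrib)
  also have "\<dots> \<le> 8 * (\<bar>a\<bar> ^ 3 + \<bar>b\<bar> ^ 3)" by (auto simp: max_def)
  finally show ?thesis .
qed

lemma abs_le_one_plus_cube: "\<bar>x :: real\<bar> \<le> 1 + \<bar>x\<bar> ^ 3"
proof (cases "\<bar>x\<bar> \<le> 1")
  case False then show ?thesis using power_increasing[of 1 3 "\<bar>x\<bar>"] by simp
qed (simp add: add_increasing2)

lemma square_le_one_plus_cube: "(x :: real)\<^sup>2 \<le> 1 + \<bar>x\<bar> ^ 3"
proof (cases "\<bar>x\<bar> \<le> 1")
  case False then show ?thesis using power_increasing[of 2 3 "\<bar>x\<bar>"] by simp
next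
  case True
  then have "x\<^sup>2 \<le> 1" by (simp add: abs_square_le_1)
  moreover have "0 \<le> \<bar>x\<bar> ^ 3" by simp
  ultimately show ?thesis by linarith
qed

lemma (in prob_space) third_moment_imp:
  fixes X :: "'a \<Rightarrow> real"
  assumes [measurable]: "X \<in> borel_measurable M" and "integrable M (\<lambda>x. \<bar>X x\<bar> ^ 3)"
  shows "integrable M X" "integrable M (\<lambda>x. (X x)\<^sup>2)" "integrable M (\<lambda>x. \<bar>X x - c\<bar> ^ 3)"
proof -
  have i: "integrable M (\<lambda>x. 1 + \<bar>X x\<bar> ^ 3)" using assms by auto
  show "integrable M X"
    by (rule Bochner_Integration.integrable_bound[OF i]) (use abs_le_one_plus_cube in \<open>auto intro!: AE_I2 simp: abs_of_nonneg\<close>)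
  show "integrable M (\<lambda>x. (X x)\<^sup>2)"
    by (rule Bochner_Integration.integrable_bound[OF i]) (use square_le_one_plus_cube in \<open>auto intro!: AE_I2 simp: abs_of_nonneg\<close>)
  have "integrable M (\<lambda>x. 8 * (\<bar>X x\<bar> ^ 3 + \<bar>c\<bar> ^ 3))" using assms by auto
  then show "integrable M (\<lambda>x. \<bar>X x - c\<bar> ^ 3)"
    by (rule Bochner_Integration.integrable_bound) (use abs_diff_cube_le in \<open>auto intro!: AE_I2 simp: abs_of_nonneg\<close>)
qed

text \<open>Collects what the argument uses about the fading law: no mass at zero and a third
  logarithmic moment. The regular density enters only when these are verified.\<close>

locale fading_channel = prob_space \<mu>H for \<mu>H :: "complex measure" +
  fixes \<sigma> :: real
  assumes sets_H[simp, measurable_cong]: "sets \<mu>H = sets borel"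
    and \<sigma>_pos: "\<sigma> > 0"
    and AE_H_nz: "AE h in \<mu>H. h \<noteq> 0"
    and third_moment_H: "integrable \<mu>H (\<lambda>h. \<bar>ln ((cmod h)\<^sup>2)\<bar> ^ 3)"
begin

lemma space_H[simp]: "space \<mu>H = UNIV"
  using sets_eq_imp_space_eq[OF sets_H] by simp

definition meanlog :: real where "meanlog = (\<integral>h. ln ((cmod h)\<^sup>2) \<partial>\<mu>H)"
text \<open>The 1 here is the variance, and the 1 in \<open>\<delta>ch\<close> the mean, of the
  exponential variable \<open>(cmod z)\<^sup>2 / \<sigma>\<^sup>2\<close>. The latter accounts for
  the \<open>e\<close> in \<open>pi e \<sigma>\<^sup>2\<close>.\<close>

definition Vch :: real where "Vch = 1 + (\<integral>h. (ln ((cmod h)\<^sup>2) - meanlog)\<^sup>2 \<partial>\<mu>H)"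
definition \<delta>ch :: real where "\<delta>ch = meanlog - ln (pi * \<sigma>\<^sup>2) - 1"

text \<open>The per-symbol information density: its mean is the expected NLD and its variance the
  dispersion.\<close>

definition tinfo :: "complex \<Rightarrow> complex \<Rightarrow> real" where
  "tinfo h z = ln ((cmod h)\<^sup>2) - (cmod z)\<^sup>2 / \<sigma>\<^sup>2 - ln (pi * \<sigma>\<^sup>2)"

abbreviation fade_vec :: "nat \<Rightarrow> point measure" where
  "fade_vec n \<equiv> PiM {..<n} (\<lambda>_. \<mu>H)"

definition joint :: "nat \<Rightarrow> (point \<times> point) measure" where
  "joint n = fade_vec n \<Otimes>\<^sub>M noise_vec n \<sigma>"

lemma Vch_ge: "Vch \<ge> 1"
  unfolding Vch_def by (simp add: Bochner_Integration.integral_nonneg)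

lemma prob_space_joint: "prob_space (joint n)"
proof -
  interpret A: prob_space "fade_vec n" by (intro prob_space_PiM prob_space_axioms)
  interpret B: prob_space "noise_vec n \<sigma>" by (rule prob_space_noise_vec[OF \<sigma>_pos])
  interpret pair_prob_space "fade_vec n" "noise_vec n \<sigma>" ..
  show ?thesis unfolding joint_def by unfold_locales
qed

lemma measurable_joint_components[measurable]:
  assumes "i < n"
  shows "(\<lambda>p. fst p i) \<in> borel_measurable (joint n)" "(\<lambda>p. snd p i) \<in> borel_measurable (joint n)"
proof -
  have "(\<lambda>x. x i) \<in> borel_measurable (fade_vec n)" "(\<lambda>x. x i) \<in> borel_measurable (noise_vec n \<sigma>)"
    using measurable_component_singleton[of i "{..<n}" "\<lambda>_. \<mu>H"] measurable_component_singleton[of i "{..<n}" "\<lambda>_. cgauss \<sigma>"] assms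
    by (simp_all add: noise_vec_def cong: measurable_cong_sets)
  then show "(\<lambda>p. fst p i) \<in> borel_measurable (joint n)" "(\<lambda>p. snd p i) \<in> borel_measurable (joint n)"
    unfolding joint_def using measurable_compose[OF measurable_fst] measurable_compose[OF measurable_snd] by blast+
qed

lemma measurable_tinfo_sum[measurable]:
  "(\<lambda>p. \<Sum>i<n. tinfo (fst p i) (snd p i)) \<in> borel_measurable (joint n)"
  unfolding tinfo_def by measurable

definition tinfo_cdf :: "nat \<Rightarrow> real \<Rightarrow> real" where
  "tinfo_cdf n x = measure (joint n) {p \<in> space (joint n). (\<Sum>i<n. tinfo (fst p i) (snd p i)) \<le> x}"

lemma tinfo_cdf_nonneg[simp]: "0 \<le> tinfo_cdf n x"
  by (simp add: tinfo_cdf_def)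

text \<open>Fading part \<open>A\<close> and noise part \<open>B\<close> are centred separately. By
  independence one symbol has characteristic function \<open>cA t * cB t\<close>, where
  \<open>cA\<close> has modulus at most 1 whatever the fading law, and a block of \<open>n\<close>
  symbols has its \<open>n\<close>-th power, the form that
  \<open>berry_esseen_of_exponential_char\<close> asks for.\<close>

theorem tinfo_sum_berry_esseen:
  "\<exists>C\<ge>0. \<forall>n\<ge>5. \<forall>x. \<bar>tinfo_cdf n x - normal_cdf ((x - n * \<delta>ch) / sqrt (n * Vch))\<bar> \<le> C / sqrt n"
proof -
  let ?G = "cgauss \<sigma>"
  let ?L = "\<lambda>h. ln ((cmod h)\<^sup>2)"
  let ?E = "\<lambda>z. (cmod z)\<^sup>2 / \<sigma>\<^sup>2"
  interpret G: prob_space ?G by (rule prob_space_cgauss[OF \<sigma>_pos])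
  interpret P: pair_prob_space \<mu>H ?G ..
  define A where "A h = ?L h - meanlog" for h
  define B where "B z = ?E z - 1" for z
  have [measurable]: "A \<in> borel_measurable borel" "B \<in> borel_measurable borel"
    unfolding A_def B_def by measurable
  have UH[simp]: "prob UNIV = 1" and UG[simp]: "G.prob UNIV = 1"
    using prob_space G.prob_space by simp_all
  note D = distributed_cgauss_cmod_sq[OF \<sigma>_pos]
  have A3: "integrable \<mu>H (\<lambda>h. \<bar>A h\<bar> ^ 3)" and iL: "integrable \<mu>H ?L"
    unfolding A_def using third_moment_imp[OF _ third_moment_H] by auto
  have A1: "integrable \<mu>H A" and A2: "integrable \<mu>H (\<lambda>h. (A h)\<^sup>2)"
    using third_moment_imp[OF _ A3] by auto
  have EA: "integral\<^sup>L \<mu>H A = 0"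
    unfolding A_def using iL by (simp add: meanlog_def prob_space)
  have VA: "integral\<^sup>L \<mu>H (\<lambda>h. (A h)\<^sup>2) = Vch - 1" by (simp add: Vch_def A_def)
  have E3: "integrable ?G (\<lambda>z. ?E z ^ 3)" by (rule G.erlang_ith_moment_integrable[OF _ D]) simp
  have "integrable ?G (\<lambda>z. \<bar>?E z\<bar> ^ 3)" using E3 by simp
  note E = G.third_moment_imp[OF _ this, simplified]
  have B3: "integrable ?G (\<lambda>z. \<bar>B z\<bar> ^ 3)" unfolding B_def using E by simp
  have B1: "integrable ?G B" and B2: "integrable ?G (\<lambda>z. (B z)\<^sup>2)"
    using G.third_moment_imp[OF _ B3] by auto
  have EE: "G.expectation ?E = 1" using G.erlang_ith_moment[OF _ D, of 1] by (simp only: power_one_right) simp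
  have EB: "integral\<^sup>L ?G B = 0" unfolding B_def using E EE by (subst Bochner_Integration.integral_diff) (auto simp only: G.prob_space lebesgue_integral_const space_cgauss UG scaleR_one diff_self integrable_const G.integrable_const)
  have VB: "integral\<^sup>L ?G (\<lambda>z. (B z)\<^sup>2) = 1"
    using G.erlang_distributed_variance[OF _ D] unfolding EE B_def by simp
  define X where "X p = A (fst p) - B (snd p)" for p
  have [measurable]: "X \<in> borel_measurable (\<mu>H \<Otimes>\<^sub>M ?G)" unfolding X_def by measurable
  note pm = has_bochner_integral_pair_mult[OF sigma_finite_measure_axioms G.sigma_finite_measure_axioms]
  have fsti: "has_bochner_integral (\<mu>H \<Otimes>\<^sub>M ?G) (\<lambda>p. f (fst p)) (integral\<^sup>L \<mu>H f)" if "integrable \<mu>H f" for f :: "complex \<Rightarrow> real"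
    using pm[OF that, of "\<lambda>_. 1"] by (simp add: G.prob_space)
  have sndi: "has_bochner_integral (\<mu>H \<Otimes>\<^sub>M ?G) (\<lambda>p. f (snd p)) (integral\<^sup>L ?G f)" if "integrable ?G f" for f :: "complex \<Rightarrow> real"
    using pm[OF _ that, of "\<lambda>_. 1"] by (simp add: prob_space)
  have X1: "has_bochner_integral (\<mu>H \<Otimes>\<^sub>M ?G) X 0"
    unfolding X_def using has_bochner_integral_diff[OF fsti[OF A1] sndi[OF B1]] EA EB by simp
  \<comment> \<open>The cross term integrates to 0 because both parts are centred;
    \<open>Vch - 1\<close> and 1 are their variances.\<close>
  have "has_bochner_integral (\<mu>H \<Otimes>\<^sub>M ?G) (\<lambda>p. (A (fst p))\<^sup>2 + (B (snd p))\<^sup>2 - 2 * (A (fst p) * B (snd p)))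
      ((Vch - 1) + 1 - 2 * (0 * 0))"
    by (intro has_bochner_integral_diff has_bochner_integral_add has_bochner_integral_mult_right)
      (use fsti[OF A2] sndi[OF B2] pm[OF A1 B1] VA VB EA EB in auto)
  then have X2: "has_bochner_integral (\<mu>H \<Otimes>\<^sub>M ?G) (\<lambda>p. (X p)\<^sup>2) Vch"
    by (simp add: X_def power2_diff mult.assoc)
  have "integrable (\<mu>H \<Otimes>\<^sub>M ?G) (\<lambda>p. 8 * (\<bar>A (fst p)\<bar> ^ 3 + \<bar>B (snd p)\<bar> ^ 3))"
    using fsti[OF A3] sndi[OF B3] by (auto simp: has_bochner_integral_iff)
  then have X3: "integrable (\<mu>H \<Otimes>\<^sub>M ?G) (\<lambda>p. \<bar>X p\<bar> ^ 3)"
    by (rule Bochner_Integration.integrable_bound) (use abs_diff_cube_le in \<open>auto intro!: AE_I2 simp: X_def abs_of_nonneg\<close>)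
  define \<nu> where "\<nu> = distr (\<mu>H \<Otimes>\<^sub>M ?G) borel X"
  have \<nu>: "real_distribution \<nu>" unfolding \<nu>_def by (rule P.real_distribution_distr) simp
  define cA where "cA t = (CLINT h|\<mu>H. iexp (t * A h))" for t
  define cB where "cB t = (CLINT z|?G. iexp (- t * B z))" for t
  have iA: "integrable \<mu>H (\<lambda>h. iexp (t * A h))" for t by (rule integrable_const_bound[where B=1]) auto
  have iB: "integrable ?G (\<lambda>z. iexp (- t * B z))" for t by (rule G.integrable_const_bound[where B=1]) auto
  have ch: "char \<nu> t = cA t * cB t" for t
  proof -
    have "char \<nu> t = (CLINT p|(\<mu>H \<Otimes>\<^sub>M ?G). iexp (t * A (fst p)) * iexp (- t * B (snd p)))"
      unfolding char_def \<nu>_def by (subst integral_distr) (auto simp: X_def mult_exp_exp algebra_simps)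
    also have "\<dots> = cA t * cB t"
      using pm[OF iA[of t] iB[of t]] unfolding cA_def cB_def by (rule has_bochner_integral_integral_eq)
    finally show ?thesis .
  qed
  have cA1: "cmod (cA t) \<le> 1" for t
  proof -
    have "cmod (cA t) \<le> (\<integral>h. cmod (iexp (t * A h)) \<partial>\<mu>H)" unfolding cA_def by (rule integral_norm_bound)
    then show ?thesis by (simp add: prob_space)
  qed
  \<comment> \<open>Centring contributes only the factor \<open>iexp t\<close> of modulus one, and
    the minus sign turns \<open>t\<close> into \<open>- t\<close>, under which the modulus is
    even.\<close>
  have cBE: "cmod (cB t) = 1 / sqrt (1 + t\<^sup>2)" for t
  proof -
    have "cB t = (CLINT z|?G. iexp t * iexp (- t * ?E z))"
      unfolding cB_def B_def by (simp add: mult_exp_exp algebra_simps)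
    also have "\<dots> = iexp t * (CLINT z|?G. iexp (- t * ?E z))" by simp
    also have "(CLINT z|?G. iexp (- t * ?E z)) = char (distr ?G borel ?E) (- t)"
      unfolding char_def by (subst integral_distr) auto
    also have "cmod (iexp t * char (distr ?G borel ?E) (- t)) = 1 / sqrt (1 + t\<^sup>2)"
      by (simp add: distr_cgauss_cmod_sq[OF \<sigma>_pos] norm_mult cmod_char_exponential)
    finally show ?thesis .
  qed
  have chb: "cmod (char \<nu> t) \<le> 1 / sqrt (1 + t\<^sup>2)" for t
    unfolding ch norm_mult cBE using mult_right_mono[OF cA1[of t], of "1 / sqrt (1 + t\<^sup>2)"] by simp
  have "\<exists>C\<ge>0. \<forall>n\<ge>5. \<forall>\<mu>. real_distribution \<mu> \<longrightarrow> (\<forall>t. char \<mu> t = char \<nu> t ^ n) \<longrightarrow>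
           (\<forall>x. \<bar>cdf \<mu> x - normal_cdf (x / sqrt (n * Vch))\<bar> \<le> C / sqrt n)"
  proof (rule berry_esseen_of_exponential_char[OF \<nu> _ _ _ _ _ Vch_ge chb])
    show "integrable \<nu> (\<lambda>x. \<bar>x\<bar> ^ 3)" "integrable \<nu> (\<lambda>x. x)" "integrable \<nu> (\<lambda>x. x\<^sup>2)"
      unfolding \<nu>_def using X1 X2 X3 by (auto simp: integrable_distr_eq has_bochner_integral_iff)
    show "(\<integral>x. x \<partial>\<nu>) = 0" "(\<integral>x. x\<^sup>2 \<partial>\<nu>) = Vch"
      unfolding \<nu>_def using X1 X2 by (auto simp: integral_distr has_bochner_integral_iff)
  qed
  then obtain C where C: "C \<ge> 0" and BE: "\<And>n \<mu> x. n \<ge> 5 \<Longrightarrow> real_distribution \<mu> \<Longrightarrow> (\<And>t. char \<mu> t = char \<nu> t ^ n) \<Longrightarrow>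
      \<bar>cdf \<mu> x - normal_cdf (x / sqrt (real n * Vch))\<bar> \<le> C / sqrt (real n)"
    by blast
  have "\<bar>tinfo_cdf n x - normal_cdf ((x - n * \<delta>ch) / sqrt (n * Vch))\<bar> \<le> C / sqrt n" if n: "n \<ge> 5" for n :: nat and x :: real
  proof -
    interpret J: prob_space "joint n" by (rule prob_space_joint)
    interpret HP: product_sigma_finite "\<lambda>_::nat. \<mu>H" by standard
    interpret GP: product_sigma_finite "\<lambda>_::nat. ?G" by standard
    interpret HF: prob_space "fade_vec n" by (intro prob_space_PiM prob_space_axioms)
    interpret GF: prob_space "noise_vec n \<sigma>" by (rule prob_space_noise_vec[OF \<sigma>_pos])
    define Y where "Y p = (\<Sum>i<n. tinfo (fst p i) (snd p i)) - n * \<delta>ch" for p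
    have [measurable]: "Y \<in> borel_measurable (joint n)" unfolding Y_def by measurable
    have Y: "Y p = (\<Sum>i<n. A (fst p i)) - (\<Sum>i<n. B (snd p i))" for p
    proof -
      have "Y p = (\<Sum>i<n. tinfo (fst p i) (snd p i) - \<delta>ch)" by (simp add: Y_def sum_subtractf)
      also have "\<dots> = (\<Sum>i<n. A (fst p i) - B (snd p i))"
        by (intro sum.cong refl) (simp add: tinfo_def A_def B_def \<delta>ch_def)
      finally show ?thesis by (simp add: sum_subtractf)
    qed
    define \<mu> where "\<mu> = distr (joint n) borel Y"
    have \<mu>: "real_distribution \<mu>" unfolding \<mu>_def by (rule J.real_distribution_distr) simp
    have iAn: "integrable (fade_vec n) (\<lambda>h. \<Prod>i<n. iexp (t * A (h i)))" for t
      by (rule HF.integrable_const_bound[where B=1]) (auto simp: prod_norm[symmetric] intro!: AE_I2 prod_le_1)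
    have iBn: "integrable (noise_vec n \<sigma>) (\<lambda>z. \<Prod>i<n. iexp (- t * B (z i)))" for t
      unfolding noise_vec_def
      by (rule GF.integrable_const_bound[where B=1, unfolded noise_vec_def]) (auto simp: prod_norm[symmetric] intro!: AE_I2 prod_le_1)
    have "char \<mu> t = char \<nu> t ^ n" for t
    proof -
      have e: "iexp (t * Y p) = (\<Prod>i<n. iexp (t * A (fst p i))) * (\<Prod>i<n. iexp (- t * B (snd p i)))" for p
        by (simp add: Y exp_sum[symmetric] mult_exp_exp sum_distrib_left right_diff_distrib sum_negf)
      have "char \<mu> t = (CLINT p|joint n. (\<Prod>i<n. iexp (t * A (fst p i))) * (\<Prod>i<n. iexp (- t * B (snd p i))))"
        unfolding char_def \<mu>_def e[symmetric] by (subst integral_distr) auto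
      also have "\<dots> = (CLINT h|fade_vec n. (\<Prod>i<n. iexp (t * A (h i)))) * (CLINT z|noise_vec n \<sigma>. (\<Prod>i<n. iexp (- t * B (z i))))"
        unfolding joint_def
        by (rule has_bochner_integral_integral_eq[OF has_bochner_integral_pair_mult[OF HF.sigma_finite_measure_axioms GF.sigma_finite_measure_axioms iAn iBn]])
      also have "(CLINT h|fade_vec n. (\<Prod>i<n. iexp (t * A (h i)))) = cA t ^ n"
        by (subst HP.product_integral_prod) (use iA in \<open>auto simp: cA_def\<close>)
      also have "(CLINT z|noise_vec n \<sigma>. (\<Prod>i<n. iexp (- t * B (z i)))) = cB t ^ n"
        unfolding noise_vec_def by (subst GP.product_integral_prod) (use iB in \<open>auto simp: cB_def\<close>)
      finally show ?thesis by (simp add: ch power_mult_distrib)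
    qed
    from BE[OF n \<mu> this, of "x - n * \<delta>ch"]
    have "\<bar>cdf \<mu> (x - n * \<delta>ch) - normal_cdf ((x - n * \<delta>ch) / sqrt (n * Vch))\<bar> \<le> C / sqrt n" .
    moreover have "cdf \<mu> (x - n * \<delta>ch) = tinfo_cdf n x"
      unfolding cdf_def \<mu>_def tinfo_cdf_def by (subst measure_distr) (auto simp: Y_def intro!: arg_cong[where f="measure (joint n)"])
    ultimately show ?thesis by simp
  qed
  then show ?thesis using C by blast
qed

end

section \<open>The converse bound\<close>

lemma cdist_cong: "(\<And>i. i < n \<Longrightarrow> x i = x' i) \<Longrightarrow> (\<And>i. i < n \<Longrightarrow> y i = y' i) \<Longrightarrow> cdist n x y = cdist n x' y'"
  by (simp add: cdist_def)

lemma cdist_le_iff: "cdist n x y \<le> cdist n x' y' \<longleftrightarrow> (\<Sum>i<n. (cmod (x i - y i))\<^sup>2) \<le> (\<Sum>i<n. (cmod (x' i - y' i))\<^sup>2)"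
  by (simp add: cdist_def)

lemma voronoi_cong: "(\<And>i. i < n \<Longrightarrow> y i = y' i) \<Longrightarrow> y \<in> voronoi n T s \<longleftrightarrow> y' \<in> voronoi n T s"
  unfolding voronoi_def using cdist_cong[of n y y'] by auto

lemma measurable_component_cvol[measurable]: "i < n \<Longrightarrow> (\<lambda>y. y i) \<in> borel_measurable (cvol n)"
  using measurable_component_singleton[of i "{..<n}" "\<lambda>_. lborel :: complex measure"] by (simp add: cvol_def cong: measurable_cong_sets)

lemma measurable_cdist[measurable]: "(\<lambda>y. cdist n y s) \<in> borel_measurable (cvol n)"
  unfolding cdist_def by measurable

text \<open>\<open>voronoi\<close> inspects only the first \<open>n\<close> coordinates of arbitrary
  functions; intersecting it with the extensional space makes it a measurable set of
  \<open>cvol n\<close>.\<close>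

definition cell :: "nat \<Rightarrow> point set \<Rightarrow> point \<Rightarrow> point set" where
  "cell n T s = {y \<in> space (cvol n). y \<in> voronoi n T s}"

lemma sets_cell[measurable]: "countable T \<Longrightarrow> cell n T s \<in> sets (cvol n)"
  unfolding cell_def voronoi_def mem_Collect_eq
  by (intro sets.sets_Collect_countable_All') auto

text \<open>For nonvanishing \<open>h\<close> this is the image of a cube of side \<open>b\<close>
  under coordinatewise multiplication by \<open>h\<close>. With \<open>h\<close> constantly 1 it
  becomes the fundamental cube of the periodic constellations.\<close>

definition hbox :: "nat \<Rightarrow> point \<Rightarrow> real \<Rightarrow> point set" where
  "hbox n h b = {y \<in> space (cvol n). \<forall>i<n. \<bar>Re (y i / h i)\<bar> < b / 2 \<and> \<bar>Im (y i / h i)\<bar> < b / 2}"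

lemma sets_hbox[measurable]: "hbox n h b \<in> sets (cvol n)"
proof -
  have "hbox n h b = {y \<in> space (cvol n). \<forall>i\<in>{..<n}. \<bar>Re (y i / h i)\<bar> < b / 2 \<and> \<bar>Im (y i / h i)\<bar> < b / 2}"
    by (auto simp: hbox_def)
  also have "\<dots> \<in> sets (cvol n)" by measurable
  finally show ?thesis .
qed

lemma emeasure_hbox:
  assumes h: "\<And>i. i < n \<Longrightarrow> h i \<noteq> 0" and b: "b > 0"
  shows "emeasure (cvol n) (hbox n h b) = ennreal ((\<Prod>i<n. (cmod (h i))\<^sup>2) * b ^ (2 * n))"
proof -
  let ?B = "{z. \<bar>Re z\<bar> < b / 2 \<and> \<bar>Im z\<bar> < b / 2}"
  have B: "?B = box (Complex (-b/2) (-b/2)) (Complex (b/2) (b/2))"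
    by (auto simp: box_def Basis_complex_def inner_complex_def)
  have eB: "emeasure lborel ?B = ennreal (b ^ 2)"
    unfolding B using b by (subst emeasure_lborel_box) (auto simp: Basis_complex_def inner_complex_def power2_eq_square)
  have "emeasure (cvol n) (hbox n h b) = (\<integral>\<^sup>+z. indicator (hbox n h b) z \<partial>cvol n)" by simp
  also have "\<dots> = ennreal (\<Prod>i<n. (cmod (h i))\<^sup>2) * (\<integral>\<^sup>+z. indicator (hbox n h b) (caff n (\<lambda>_. 0) h z) \<partial>cvol n)"
    by (rule nn_integral_caff) (use h in auto)
  also have "(\<integral>\<^sup>+z. indicator (hbox n h b) (caff n (\<lambda>_. 0) h z) \<partial>cvol n) = (\<integral>\<^sup>+z. indicator (Pi\<^sub>E {..<n} (\<lambda>_. ?B)) z \<partial>cvol n)"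
    by (intro nn_integral_cong) (use h in \<open>auto simp: hbox_def caff_def space_cvol indicator_def PiE_iff\<close>)
  also have "\<dots> = emeasure (cvol n) (Pi\<^sub>E {..<n} (\<lambda>_. ?B))"
    unfolding cvol_def by (intro nn_integral_indicator sets_PiM_I_finite) (auto simp: B)
  also have "\<dots> = ennreal (b ^ (2 * n))"
  proof -
    have "emeasure (cvol n) (Pi\<^sub>E {..<n} (\<lambda>_. ?B)) = (\<Prod>i<n. emeasure lborel ?B)"
      unfolding cvol_def by (rule lborel_prod.emeasure_PiM) (auto simp: B)
    then show ?thesis unfolding eB using b by (simp add: ennreal_power power_mult)
  qed
  finally show ?thesis using b by (simp add: ennreal_mult prod_nonneg)
qed

text \<open>Shrinking a closed Voronoi cell towards its centre makes the cells disjoint, so ties need no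
  separate treatment.\<close>

lemma voronoi_shrink_strict:
  assumes y: "y \<in> voronoi n T s" and t: "t \<in> T" and d: "cdist n s t \<noteq> 0" and \<theta>: "0 < \<theta>" "\<theta> < 1"
    and w: "\<And>i. i < n \<Longrightarrow> w i = s i + of_real \<theta> * (y i - s i)"
  shows "cdist n w s < cdist n w t"
proof -
  have le: "(\<Sum>i<n. (cmod (y i - s i))\<^sup>2) \<le> (\<Sum>i<n. (cmod (y i - t i))\<^sup>2)"
    using y t by (simp add: voronoi_def cdist_le_iff)
  have pos: "(\<Sum>i<n. (cmod (s i - t i))\<^sup>2) > 0"
    using d sum_nonneg[of "{..<n}" "\<lambda>i. (cmod (s i - t i))\<^sup>2"] by (simp add: cdist_def order_less_le)
  \<comment> \<open>The difference of the squared distances to two centres is affine in the point,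
    hence along the segment it interpolates between its values at \<open>s\<close> and at
    \<open>y\<close>. The value at \<open>s\<close> is strictly positive.\<close>
  have id: "(cmod (w i - t i))\<^sup>2 - (cmod (w i - s i))\<^sup>2
      = (1 - \<theta>) * (cmod (s i - t i))\<^sup>2 + \<theta> * ((cmod (y i - t i))\<^sup>2 - (cmod (y i - s i))\<^sup>2)" if "i < n" for i
    unfolding w[OF that] cmod_power2 by (simp add: algebra_simps power2_eq_square)
  have "(\<Sum>i<n. (cmod (w i - t i))\<^sup>2) - (\<Sum>i<n. (cmod (w i - s i))\<^sup>2)
      = (\<Sum>i<n. (1 - \<theta>) * (cmod (s i - t i))\<^sup>2 + \<theta> * ((cmod (y i - t i))\<^sup>2 - (cmod (y i - s i))\<^sup>2))"
    unfolding sum_subtractf[symmetric] using id by (intro sum.cong) auto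
  also have "\<dots> = (1 - \<theta>) * (\<Sum>i<n. (cmod (s i - t i))\<^sup>2) + \<theta> * ((\<Sum>i<n. (cmod (y i - t i))\<^sup>2) - (\<Sum>i<n. (cmod (y i - s i))\<^sup>2))"
    by (simp add: sum.distrib sum_distrib_left sum_subtractf right_diff_distrib)
  also have "\<dots> > 0" using pos le \<theta> by (intro add_pos_nonneg mult_pos_pos mult_nonneg_nonneg) auto
  finally show ?thesis by (simp add: cdist_def)
qed

text \<open>The shrunken truncated cells \<open>D s\<close> are pairwise disjoint, and they stay in
  the box because it is convex and contains the centres. Their total volume is thus at most that of
  the box, and undoing the shrinking costs \<open>(1 / \<theta>) ^ (2 * n)\<close>.\<close>

lemma sum_cell_volume_le:
  assumes h: "\<And>i. i < n \<Longrightarrow> h i \<noteq> 0" and b: "b > 0" and T: "countable T" and A: "finite A" "A \<subseteq> T"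
    and sep: "\<And>s t. s \<in> A \<Longrightarrow> t \<in> A \<Longrightarrow> s \<noteq> t \<Longrightarrow> cdist n s t \<noteq> 0"
    and Ab: "\<And>s i. s \<in> A \<Longrightarrow> i < n \<Longrightarrow> \<bar>Re (s i / h i)\<bar> < b / 2 \<and> \<bar>Im (s i / h i)\<bar> < b / 2"
    and \<theta>: "0 < \<theta>" "\<theta> < 1"
  shows "(\<Sum>s\<in>A. emeasure (cvol n) (cell n T s \<inter> hbox n h b)) \<le> ennreal ((\<Prod>i<n. (cmod (h i))\<^sup>2) * (b / \<theta>) ^ (2 * n))"
proof -
  let ?W = "\<lambda>s. cell n T s \<inter> hbox n h b"
  \<comment> \<open>The dilation \<open>s + (w - s) / \<theta>\<close>, inverse to shrinking by
    \<open>\<theta>\<close> towards \<open>s\<close>; its preimage \<open>D s\<close> is the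
    shrunken cell.\<close>
  define g where "g s = caff n (\<lambda>i. s i - of_real (1 / \<theta>) * s i) (\<lambda>i. of_real (1 / \<theta>))" for s
  define D where "D s = {w \<in> space (cvol n). g s w \<in> ?W s}" for s
  have gm: "g s \<in> cvol n \<rightarrow>\<^sub>M cvol n" for s unfolding g_def by measurable
  have cb[measurable]: "?W s \<in> sets (cvol n)" for s using T by measurable
  have Dm: "D s \<in> sets (cvol n)" for s
    using measurable_sets[OF gm cb] by (simp add: D_def vimage_def Int_def conj_commute)
  have w_eq: "w i = s i + of_real \<theta> * (g s w i - s i)" if "i < n" for s w i
    using that \<theta> by (simp add: g_def caff_def field_simps)
  have vol: "emeasure (cvol n) (?W s) = ennreal ((1 / \<theta>) ^ (2 * n)) * emeasure (cvol n) (D s)" for s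
  proof -
    have "emeasure (cvol n) (?W s) = (\<integral>\<^sup>+y. indicator (?W s) y \<partial>cvol n)"
      by simp
    also have "\<dots> = ennreal (\<Prod>i<n. (cmod (of_real (1 / \<theta>)))\<^sup>2) * (\<integral>\<^sup>+w. indicator (?W s) (g s w) \<partial>cvol n)"
      unfolding g_def by (rule nn_integral_caff) (use \<theta> in auto)
    also have "(\<integral>\<^sup>+w. indicator (?W s) (g s w) \<partial>cvol n) = (\<integral>\<^sup>+w. indicator (D s) w \<partial>cvol n)"
      by (intro nn_integral_cong) (auto simp: D_def indicator_def)
    also have "\<dots> = emeasure (cvol n) (D s)" using Dm by simp
    finally show ?thesis using \<theta> by (simp add: power_mult norm_divide)
  qed
  have disj: "disjoint_family_on D A"
    unfolding disjoint_family_on_def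
  proof (intro ballI impI)
    fix s t assume st: "s \<in> A" "t \<in> A" "s \<noteq> t"
    have False if "w \<in> D s" "w \<in> D t" for w
    proof -
      have 1: "cdist n w s < cdist n w t"
        by (rule voronoi_shrink_strict[of "g s w" n T s t \<theta> w])
          (use that st A sep \<theta> w_eq in \<open>auto simp: D_def cell_def\<close>)
      have 2: "cdist n w t < cdist n w s"
        by (rule voronoi_shrink_strict[of "g t w" n T t s \<theta> w])
          (use that st A sep \<theta> w_eq in \<open>auto simp: D_def cell_def\<close>)
      from 1 2 show False by simp
    qed
    then show "D s \<inter> D t = {}" by blast
  qed
  have sub: "D s \<subseteq> hbox n h b" if s: "s \<in> A" for s
  proof
    fix w assume w: "w \<in> D s"
    have "\<bar>Re (w i / h i)\<bar> < b / 2 \<and> \<bar>Im (w i / h i)\<bar> < b / 2" if i: "i < n" for i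
    proof -
      define p where "p = s i / h i"
      define q where "q = g s w i / h i"
      have e: "w i / h i = of_real (1 - \<theta>) * p + of_real \<theta> * q"
        by (subst w_eq[OF i, of w s]) (use h[OF i] in \<open>simp add: p_def q_def field_simps\<close>)
      have p: "\<bar>Re p\<bar> < b / 2" "\<bar>Im p\<bar> < b / 2" using Ab[OF s i] by (auto simp: p_def)
      have q: "\<bar>Re q\<bar> < b / 2" "\<bar>Im q\<bar> < b / 2" using w i by (auto simp: q_def D_def hbox_def)
      have cv: "\<bar>(1 - \<theta>) * u + \<theta> * v\<bar> < b / 2" if "\<bar>u\<bar> < b / 2" "\<bar>v\<bar> < b / 2" for u v :: real
      proof -
        have "\<bar>(1 - \<theta>) * u + \<theta> * v\<bar> \<le> (1 - \<theta>) * \<bar>u\<bar> + \<theta> * \<bar>v\<bar>"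
          using \<theta> abs_triangle_ineq[of "(1 - \<theta>) * u" "\<theta> * v"] by (simp add: abs_mult)
        also have "\<dots> < (1 - \<theta>) * (b / 2) + \<theta> * (b / 2)"
          using that \<theta> by (intro add_strict_mono mult_strict_left_mono) auto
        also have "\<dots> = b / 2" by (simp add: field_simps)
        finally show ?thesis .
      qed
      show ?thesis unfolding e using cv[OF p(1) q(1)] cv[OF p(2) q(2)] by simp
    qed
    then show "w \<in> hbox n h b" using w by (auto simp: hbox_def D_def)
  qed
  have "(\<Sum>s\<in>A. emeasure (cvol n) (?W s)) = ennreal ((1 / \<theta>) ^ (2 * n)) * (\<Sum>s\<in>A. emeasure (cvol n) (D s))"
    unfolding vol by (simp add: sum_distrib_left)
  also have "(\<Sum>s\<in>A. emeasure (cvol n) (D s)) = emeasure (cvol n) (\<Union>s\<in>A. D s)"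
    by (rule sum_emeasure) (use A disj Dm in auto)
  also have "\<dots> \<le> emeasure (cvol n) (hbox n h b)" using sub by (intro emeasure_mono) auto
  also have "\<dots> = ennreal ((\<Prod>i<n. (cmod (h i))\<^sup>2) * b ^ (2 * n))" by (rule emeasure_hbox[OF h b])
  also have "ennreal ((1 / \<theta>) ^ (2 * n)) * \<dots> = ennreal ((\<Prod>i<n. (cmod (h i))\<^sup>2) * (b / \<theta>) ^ (2 * n))"
    using \<theta> b by (subst ennreal_mult[symmetric]) (auto simp: prod_nonneg power_divide)
  finally show ?thesis by (simp add: mult_left_mono)
qed

lemma point_err_compl:
  assumes \<sigma>: "\<sigma> > 0" and T: "countable T"
  shows "point_err n \<sigma> T s + emeasure (noise_vec n \<sigma>) {z \<in> space (cvol n). caff n s (\<lambda>_. 1) z \<in> cell n T s} = 1"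
proof -
  interpret G: prob_space "noise_vec n \<sigma>" by (rule prob_space_noise_vec[OF \<sigma>])
  let ?C = "{z \<in> space (cvol n). caff n s (\<lambda>_. 1) z \<in> cell n T s}"
  have eq: "caff n s (\<lambda>_. 1) z \<in> cell n T s \<longleftrightarrow> (\<lambda>i. s i + z i) \<in> voronoi n T s" if "z \<in> space (cvol n)" for z
    using voronoi_cong[of n "caff n s (\<lambda>_. 1) z" "\<lambda>i. s i + z i" T s] measurable_space[OF measurable_caff that, of s "\<lambda>_. 1"]
    by (auto simp: cell_def caff_def)
  have C: "?C \<in> sets (cvol n)"
    using measurable_sets[OF measurable_caff[of n s "\<lambda>_. 1"] sets_cell[OF T, of n s]] by (simp add: vimage_def Int_def conj_commute)
  have "point_err n \<sigma> T s = emeasure (noise_vec n \<sigma>) (space (noise_vec n \<sigma>) - ?C)"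
    unfolding point_err_def using eq by (intro arg_cong[where f="emeasure _"]) (auto simp: space_noise_vec)
  moreover have "emeasure (noise_vec n \<sigma>) (space (noise_vec n \<sigma>) - ?C) + emeasure (noise_vec n \<sigma>) ?C = emeasure (noise_vec n \<sigma>) (space (noise_vec n \<sigma>))"
    using C by (subst plus_emeasure) (auto simp: sets_noise_vec space_noise_vec intro!: arg_cong[where f="emeasure _"])
  ultimately show ?thesis by (simp add: G.emeasure_space_1)
qed

text \<open>As in binary hypothesis testing, the threshold \<^term>\<open>\<tau>\<close> splits the noise space: where the density is
  below it, probability is bounded by volume.\<close>

lemma correct_prob_le:
  assumes \<sigma>: "\<sigma> > 0" and T: "countable T" and h: "\<And>i. i < n \<Longrightarrow> h i \<noteq> 0" and \<tau>: "\<tau> \<ge> 0"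
    and s: "\<And>i. i < n \<Longrightarrow> \<bar>Re (s i / h i)\<bar> < a / 2 \<and> \<bar>Im (s i / h i)\<bar> < a / 2"
  shows "emeasure (noise_vec n \<sigma>) {z \<in> space (cvol n). caff n s (\<lambda>_. 1) z \<in> cell n T s}
     \<le> emeasure (noise_vec n \<sigma>) {z \<in> space (cvol n). \<exists>i<n. (b - a) / 2 \<le> cmod (z i) / cmod (h i)}
      + emeasure (noise_vec n \<sigma>) {z \<in> space (cvol n). \<tau> < gdens n \<sigma> z}
      + ennreal \<tau> * emeasure (cvol n) (cell n T s \<inter> hbox n h b)"
    (is "emeasure ?G ?C \<le> emeasure ?G ?X1 + emeasure ?G ?X2 + _")
proof -
  let ?W = "cell n T s \<inter> hbox n h b"
  let ?X3 = "{z \<in> space (cvol n). gdens n \<sigma> z \<le> \<tau> \<and> caff n s (\<lambda>_. 1) z \<in> ?W}"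
  have X1: "?X1 \<in> sets ?G"
  proof -
    have "?X1 = {z \<in> space (cvol n). \<exists>i\<in>{..<n}. (b - a) / 2 \<le> cmod (z i) / cmod (h i)}" by auto
    also have "\<dots> \<in> sets (cvol n)" by measurable
    finally show ?thesis by (simp add: sets_noise_vec)
  qed
  have X2: "?X2 \<in> sets ?G" unfolding sets_noise_vec by measurable
  have mc[measurable]: "Measurable.pred (cvol n) (\<lambda>z. caff n s (\<lambda>_. 1) z \<in> ?W)"
    using T by measurable
  have X3: "?X3 \<in> sets ?G" unfolding sets_noise_vec by measurable
  \<comment> \<open>Either some noise coordinate is large enough to leave the enlarged box, or the
    density exceeds the threshold, or the received point lies in the truncated cell at low
    density.\<close>
  have "?C \<subseteq> ?X1 \<union> ?X2 \<union> ?X3"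
  proof
    fix z assume z: "z \<in> ?C"
    show "z \<in> ?X1 \<union> ?X2 \<union> ?X3"
    proof (rule ccontr)
      assume c: "z \<notin> ?X1 \<union> ?X2 \<union> ?X3"
      have "caff n s (\<lambda>_. 1) z \<in> hbox n h b"
        unfolding hbox_def
      proof (intro CollectI conjI allI impI)
        show "caff n s (\<lambda>_. 1) z \<in> space (cvol n)" using z by (simp add: cell_def)
        fix i assume i: "i < n"
        have "cmod (z i / h i) < (b - a) / 2" using c z i by (auto simp: norm_divide not_le)
        then have "\<bar>Re (z i / h i)\<bar> < (b - a) / 2" "\<bar>Im (z i / h i)\<bar> < (b - a) / 2"
          using abs_Re_le_cmod[of "z i / h i"] abs_Im_le_cmod[of "z i / h i"] by linarith+
        moreover have tri: "\<bar>u + v\<bar> < b / 2" if "\<bar>u\<bar> < a / 2" "\<bar>v\<bar> < (b - a) / 2" for u v :: real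
          using add_strict_mono[OF that] by (intro le_less_trans[OF abs_triangle_ineq]) (simp add: field_simps)
        ultimately show "\<bar>Re (caff n s (\<lambda>_. 1) z i / h i)\<bar> < b / 2" "\<bar>Im (caff n s (\<lambda>_. 1) z i / h i)\<bar> < b / 2"
          using s[OF i] i by (auto simp: caff_def add_divide_distrib simp del: divide_less_eq_numeral1 less_divide_eq_numeral1 intro!: tri)
      qed
      then show False using c z by auto
    qed
  qed
  then have "emeasure ?G ?C \<le> emeasure ?G (?X1 \<union> ?X2 \<union> ?X3)" using X1 X2 X3 by (intro emeasure_mono) auto
  also have "\<dots> \<le> emeasure ?G ?X1 + emeasure ?G ?X2 + emeasure ?G ?X3"
    using X1 X2 X3 by (intro order_trans[OF emeasure_subadditive] add_mono order_refl) auto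
  also have "emeasure ?G ?X3 \<le> ennreal \<tau> * emeasure (cvol n) ?W"
  proof -
    have "emeasure ?G ?X3 = (\<integral>\<^sup>+z. ennreal (gdens n \<sigma> z) * indicator ?X3 z \<partial>cvol n)"
      unfolding noise_vec_eq_density[OF \<sigma>] using X3 by (subst emeasure_density) (auto simp: sets_noise_vec)
    also have "\<dots> \<le> (\<integral>\<^sup>+z. ennreal \<tau> * indicator ?W (caff n s (\<lambda>_. 1) z) \<partial>cvol n)"
      by (intro nn_integral_mono) (auto simp: indicator_def intro: ennreal_leI)
    also have "\<dots> = ennreal \<tau> * (\<integral>\<^sup>+z. indicator ?W (caff n s (\<lambda>_. 1) z) \<partial>cvol n)"
      using T by (intro nn_integral_cmult) measurable
    also have "(\<integral>\<^sup>+z. indicator ?W (caff n s (\<lambda>_. 1) z) \<partial>cvol n)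
        = (\<integral>\<^sup>+z. indicator ?W z \<partial>cvol n)"
      using nn_integral_caff[of "indicator ?W" n "\<lambda>_. 1" s] T by simp
    also have "\<dots> = emeasure (cvol n) ?W" using T by (intro nn_integral_indicator) measurable
    finally show ?thesis .
  qed
  finally show ?thesis by (simp add: add_mono)
qed

section \<open>From a fixed cube to the limsup over cubes\<close>

lemma frequently_le_Limsup:
  fixes f :: "'a \<Rightarrow> 'b::complete_linorder"
  shows "\<exists>\<^sub>F x in F. c \<le> f x \<Longrightarrow> c \<le> Limsup F f"
proof (rule ccontr)
  assume fr: "\<exists>\<^sub>F x in F. c \<le> f x" and "\<not> c \<le> Limsup F f"
  then have "\<forall>\<^sub>F x in F. f x < c" by (intro Limsup_lessD) simp
  then have "\<forall>\<^sub>F x in F. \<not> c \<le> f x" by (rule eventually_mono) simp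
  with fr show False by (simp add: frequently_def)
qed

lemma (in prob_space) tail_emeasure_small:
  fixes X :: "'a \<Rightarrow> real"
  assumes [measurable]: "X \<in> borel_measurable M" and \<zeta>: "\<zeta> > 0"
  shows "\<exists>a0. \<forall>a\<ge>a0. emeasure M {x \<in> space M. a \<le> X x} \<le> ennreal \<zeta>"
proof -
  define A where "A k = {x \<in> space M. real k \<le> X x}" for k
  have "(\<lambda>k. emeasure M (A k)) \<longlonglongrightarrow> emeasure M (\<Inter>k. A k)"
    by (rule Lim_emeasure_decseq) (auto simp: A_def decseq_def)
  also have "(\<Inter>k. A k) = {}"
  proof -
    have "\<exists>k. x \<notin> A k" for x
      using reals_Archimedean2[of "X x"] by (auto simp: A_def not_le)
    then show ?thesis by auto
  qed
  finally have "(\<lambda>k. emeasure M (A k)) \<longlonglongrightarrow> 0" by simp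
  then have "eventually (\<lambda>k. emeasure M (A k) < ennreal \<zeta>) sequentially"
    by (rule order_tendstoD) (use \<zeta> in simp)
  then obtain k where k: "emeasure M (A k) < ennreal \<zeta>" by (auto simp: eventually_sequentially)
  have "emeasure M {x \<in> space M. a \<le> X x} \<le> ennreal \<zeta>" if "a \<ge> real k" for a
  proof -
    have "emeasure M {x \<in> space M. a \<le> X x} \<le> emeasure M (A k)"
      using that by (intro emeasure_mono) (auto simp: A_def)
    then show ?thesis using k by simp
  qed
  then show ?thesis by blast
qed

lemma chan_inj_on_cvec:
  assumes h: "\<And>i. i < n \<Longrightarrow> h i \<noteq> 0"
  shows "inj_on (chan n h) (cvec n)"
proof (rule inj_onI)
  fix x y assume xy: "x \<in> cvec n" "y \<in> cvec n" and e: "chan n h x = chan n h y"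
  show "x = y"
  proof
    fix i show "x i = y i"
      using xy h fun_cong[OF e, of i] by (cases "i < n") (auto simp: chan_def cvec_def)
  qed
qed

text \<open>The cube is enlarged by \<open>1 + 1 / n\<close> and the cells are shrunk by its
  inverse; in \<open>2 * n\<close> real dimensions this gives the exponent \<open>4 * n\<close>.
  This is where the constant \<open>exp 4\<close> of the converse comes from.\<close>

lemma one_plus_inverse_power_le: "n \<ge> 1 \<Longrightarrow> (1 + 1 / real n) ^ (4 * n) \<le> exp 4"
proof -
  assume n: "n \<ge> 1"
  have "(1 + 1 / real n) ^ (4 * n) \<le> exp (1 / real n) ^ (4 * n)"
    by (intro power_mono exp_ge_add_one_self) simp
  also have "\<dots> = exp 4" using n by (simp add: exp_of_nat_mult[symmetric])
  finally show ?thesis .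
qed

lemma chan_image_cube:
  assumes h: "\<And>i. i < n \<Longrightarrow> h i \<noteq> 0" and S: "S \<subseteq> cvec n"
  shows "chan n h ` S \<inter> chan n h ` Cb n a = chan n h ` (S \<inter> Cb n a)"
proof -
  have "Cb n a \<subseteq> cvec n" by (auto simp: Cb_def)
  then show ?thesis using inj_on_image_Int[OF chan_inj_on_cvec[of n h, OF h] S, of "Cb n a"] by simp
qed

lemma card_chan_image_cube:
  assumes h: "\<And>i. i < n \<Longrightarrow> h i \<noteq> 0" and S: "S \<subseteq> cvec n"
  shows "card (chan n h ` (S \<inter> Cb n a)) = card (S \<inter> Cb n a)"
  by (rule card_image, rule inj_on_subset[OF chan_inj_on_cvec[OF h]]) (use S in auto)

lemma cdist_eq_0_iff:
  assumes "x \<in> cvec n" "y \<in> cvec n"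
  shows "cdist n x y = 0 \<longleftrightarrow> x = y"
  using assms by (auto simp: cdist_def sum_nonneg_eq_0_iff cvec_def fun_eq_iff) (metis lessThan_iff not_le)

text \<open>Summed over the \<open>m\<close> points in the cube, the correct decisions are bounded
  by \<open>m\<close> times the two exceptional probabilities plus \<open>\<tau>\<close> times a
  total cell volume of at most \<open>exp 4 * V * a ^ (2 * n)\<close>; dividing by
  \<open>m > \<gamma> * a ^ (2 * n)\<close> removes the cube. The additive form avoids truncated
  subtraction in \<open>ennreal\<close>.\<close>

lemma avg_err_lower:
  assumes \<sigma>: "\<sigma> > 0" and n: "n \<ge> 1" and S: "is_IC n S" and fin: "finite (S \<inter> Cb n a)"
    and h: "\<And>i. i < n \<Longrightarrow> h i \<noteq> 0" and \<gamma>: "\<gamma> > 0" and \<tau>: "\<tau> \<ge> 0" and a: "a > 0"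
    and card: "\<gamma> * a ^ (2 * n) < real (card (S \<inter> Cb n a))"
    and r: "emeasure (noise_vec n \<sigma>) {z \<in> space (cvol n). \<exists>i<n. a / (2 * real n) \<le> cmod (z i) / cmod (h i)} \<le> ennreal \<zeta>"
  shows "1 \<le> avg_err n \<sigma> (chan n h ` S) (chan n h ` S \<inter> chan n h ` Cb n a)
      + (ennreal \<zeta> + emeasure (noise_vec n \<sigma>) {z \<in> space (cvol n). \<tau> < gdens n \<sigma> z} + ennreal (\<tau> * (\<Prod>i<n. (cmod (h i))\<^sup>2) * exp 4 / \<gamma>))"
proof -
  define T where "T = chan n h ` S"
  define A where "A = T \<inter> chan n h ` Cb n a"
  define V where "V = (\<Prod>i<n. (cmod (h i))\<^sup>2)"
  define p where "p = emeasure (noise_vec n \<sigma>) {z \<in> space (cvol n). \<tau> < gdens n \<sigma> z}"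
  \<comment> \<open>The margin \<open>a / (2 * n)\<close> on each side grows with \<open>a\<close>,
    so noise eventually stays inside it, while the relative enlargement is small enough that its
    \<open>2 * n\<close>-th power stays bounded.\<close>
  define b where "b = (1 + 1 / real n) * a"
  define \<theta> where "\<theta> = 1 / (1 + 1 / real n)"
  define cor where "cor s = emeasure (noise_vec n \<sigma>) {z \<in> space (cvol n). caff n s (\<lambda>_. 1) z \<in> cell n T s}" for s
  have Sc: "S \<subseteq> cvec n" "countable S" using S by (auto simp: is_IC_def)
  have T: "countable T" using Sc by (simp add: T_def)
  have A': "A = chan n h ` (S \<inter> Cb n a)" unfolding A_def T_def by (rule chan_image_cube[OF h Sc(1)])
  have Af: "finite A" using fin by (simp add: A')
  have cA: "card A = card (S \<inter> Cb n a)" unfolding A' by (rule card_chan_image_cube[OF h Sc(1)])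
  have V0: "V \<ge> 0" by (simp add: V_def prod_nonneg)
  define m where "m = card A"
  have m: "real m > \<gamma> * a ^ (2 * n)" using card by (simp add: m_def cA)
  have m0: "m > 0" 
  proof -
    have "\<gamma> * a ^ (2 * n) > 0" using \<gamma> a by simp
    then have "real m > 0" using m by linarith
    then show ?thesis by simp
  qed
  have \<theta>: "0 < \<theta>" "\<theta> < 1" using n by (auto simp: \<theta>_def field_simps)
  have b: "b > 0" "a \<le> b" using a n by (simp_all add: b_def distrib_right add_pos_nonneg)
  have ba: "(b - a) / 2 = a / (2 * real n)" using n by (simp add: b_def field_simps)
  have Aa: "\<bar>Re (s i / h i)\<bar> < a / 2 \<and> \<bar>Im (s i / h i)\<bar> < a / 2" if "s \<in> A" "i < n" for s i
    using that h by (auto simp: A' chan_def Cb_def)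
  have "of_nat m = (\<Sum>s\<in>A. point_err n \<sigma> T s + cor s)"
    unfolding cor_def point_err_compl[OF \<sigma> T] by (simp add: m_def)
  also have "\<dots> \<le> (\<Sum>s\<in>A. point_err n \<sigma> T s + (ennreal \<zeta> + p + ennreal \<tau> * emeasure (cvol n) (cell n T s \<inter> hbox n h b)))"
  proof (intro sum_mono add_left_mono)
    fix s assume s: "s \<in> A"
    have "cor s \<le> emeasure (noise_vec n \<sigma>) {z \<in> space (cvol n). \<exists>i<n. (b - a) / 2 \<le> cmod (z i) / cmod (h i)}
      + p + ennreal \<tau> * emeasure (cvol n) (cell n T s \<inter> hbox n h b)"
      unfolding cor_def p_def by (rule correct_prob_le[OF \<sigma> T h \<tau> Aa[OF s]])
    also have "\<dots> \<le> ennreal \<zeta> + p + ennreal \<tau> * emeasure (cvol n) (cell n T s \<inter> hbox n h b)"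
      using r unfolding ba by (intro add_mono order_refl)
    finally show "cor s \<le> ennreal \<zeta> + p + ennreal \<tau> * emeasure (cvol n) (cell n T s \<inter> hbox n h b)" .
  qed
  also have "\<dots> = (\<Sum>s\<in>A. point_err n \<sigma> T s) + of_nat m * (ennreal \<zeta> + p) + ennreal \<tau> * (\<Sum>s\<in>A. emeasure (cvol n) (cell n T s \<inter> hbox n h b))"
    by (simp add: sum.distrib sum_distrib_left m_def add.assoc distrib_left)
  also have "\<dots> \<le> (\<Sum>s\<in>A. point_err n \<sigma> T s) + of_nat m * (ennreal \<zeta> + p) + ennreal \<tau> * ennreal (V * (b / \<theta>) ^ (2 * n))"
  proof (intro add_left_mono mult_left_mono)
    show "(\<Sum>s\<in>A. emeasure (cvol n) (cell n T s \<inter> hbox n h b)) \<le> ennreal (V * (b / \<theta>) ^ (2 * n))"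
      unfolding V_def
    proof (rule sum_cell_volume_le[OF h b(1) T Af])
      show "A \<subseteq> T" by (auto simp: A_def)
      have "A \<subseteq> cvec n" by (auto simp: A' chan_def cvec_def)
      then show "cdist n s t \<noteq> 0" if "s \<in> A" "t \<in> A" "s \<noteq> t" for s t
        using that cdist_eq_0_iff by blast
      show "\<bar>Re (s i / h i)\<bar> < b / 2 \<and> \<bar>Im (s i / h i)\<bar> < b / 2" if "s \<in> A" "i < n" for s i
        using Aa[OF that] b by auto
    qed (use \<theta> in auto)
  qed simp
  finally have 1: "of_nat m \<le> (\<Sum>s\<in>A. point_err n \<sigma> T s) + of_nat m * (ennreal \<zeta> + p) + ennreal (\<tau> * (V * (b / \<theta>) ^ (2 * n)))"
    using \<tau> V0 b \<theta> by (subst ennreal_mult) (auto intro!: mult_nonneg_nonneg)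
  have "(b / \<theta>) ^ (2 * n) = (1 + 1 / real n) ^ (4 * n) * a ^ (2 * n)"
  proof -
    have "b / \<theta> = (1 + 1 / real n)\<^sup>2 * a" by (simp add: b_def \<theta>_def power2_eq_square)
    then show ?thesis by (simp add: power_mult_distrib power_mult[symmetric])
  qed
  also have "\<dots> \<le> exp 4 * a ^ (2 * n)" using a by (intro mult_right_mono one_plus_inverse_power_le n) auto
  finally have 2: "\<tau> * (V * (b / \<theta>) ^ (2 * n)) \<le> \<tau> * (V * (exp 4 * a ^ (2 * n)))"
    using \<tau> V0 by (intro mult_left_mono) auto
  have 3: "\<tau> * (V * (b / \<theta>) ^ (2 * n)) / real m \<le> \<tau> * V * exp 4 / \<gamma>"
  proof -
    have "\<tau> * (V * (b / \<theta>) ^ (2 * n)) / real m \<le> \<tau> * (V * (exp 4 * a ^ (2 * n))) / (\<gamma> * a ^ (2 * n))"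
      using 2 m m0 \<gamma> a \<tau> V0 by (intro frac_le) auto
    also have "\<dots> = \<tau> * V * exp 4 / \<gamma>" using a by (simp add: field_simps)
    finally show ?thesis .
  qed
  have mm: "of_nat m / of_nat m = (1::ennreal)" using m0 by (intro ennreal_divide_self) (auto simp: of_nat_less_top)
  have "1 \<le> ((\<Sum>s\<in>A. point_err n \<sigma> T s) + of_nat m * (ennreal \<zeta> + p) + ennreal (\<tau> * (V * (b / \<theta>) ^ (2 * n)))) / of_nat m"
    using divide_right_mono_ennreal[OF 1, of "of_nat m"] mm by simp
  also have "\<dots> = (\<Sum>s\<in>A. point_err n \<sigma> T s) / of_nat m + (ennreal \<zeta> + p) + ennreal (\<tau> * (V * (b / \<theta>) ^ (2 * n))) / of_nat m"
  proof -
    have "of_nat m * (ennreal \<zeta> + p) / of_nat m = ennreal \<zeta> + p"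
      using mm by (metis ennreal_times_divide mult.commute mult.right_neutral)
    then show ?thesis by (simp add: add_divide_distrib_ennreal)
  qed
  also have "ennreal (\<tau> * (V * (b / \<theta>) ^ (2 * n))) / of_nat m = ennreal (\<tau> * (V * (b / \<theta>) ^ (2 * n)) / real m)"
    using m0 \<tau> V0 b \<theta> by (subst divide_ennreal[symmetric]) (auto simp: ennreal_of_nat_eq_real_of_nat intro!: mult_nonneg_nonneg)
  also have "(\<Sum>s\<in>A. point_err n \<sigma> T s) / of_nat m + (ennreal \<zeta> + p) + \<dots>
      \<le> (\<Sum>s\<in>A. point_err n \<sigma> T s) / of_nat m + (ennreal \<zeta> + p) + ennreal (\<tau> * V * exp 4 / \<gamma>)"
    using 3 by (intro add_left_mono ennreal_leI)
  finally show ?thesis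
    using Af unfolding T_def[symmetric] A_def[symmetric] p_def[symmetric] V_def[symmetric]
    by (simp add: avg_err_def m_def add.assoc)
qed

text \<open>Density and error are both upper limits, and the cube sizes on which the density exceeds
  \<open>\<gamma>\<close> need only be unbounded. A lower bound on the error for such sizes already
  bounds its limsup.\<close>

lemma cond_err_lower:
  assumes \<sigma>: "\<sigma> > 0" and n: "n \<ge> 1" and S: "is_IC n S" and fin: "\<And>a. finite (S \<inter> Cb n a)"
    and h: "\<And>i. i < n \<Longrightarrow> h i \<noteq> 0" and \<gamma>: "\<gamma> > 0" and \<tau>: "\<tau> \<ge> 0"
    and dens: "IC_density n S > ereal \<gamma>" and \<zeta>: "\<zeta> > 0"
  shows "1 \<le> cond_err n \<sigma> S h
      + (ennreal \<zeta> + emeasure (noise_vec n \<sigma>) {z \<in> space (cvol n). \<tau> < gdens n \<sigma> z} + ennreal (\<tau> * (\<Prod>i<n. (cmod (h i))\<^sup>2) * exp 4 / \<gamma>))"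
proof -
  interpret G: prob_space "noise_vec n \<sigma>" by (rule prob_space_noise_vec[OF \<sigma>])
  let ?K = "ennreal \<zeta> + emeasure (noise_vec n \<sigma>) {z \<in> space (cvol n). \<tau> < gdens n \<sigma> z} + ennreal (\<tau> * (\<Prod>i<n. (cmod (h i))\<^sup>2) * exp 4 / \<gamma>)"
  \<comment> \<open>A single variable dominating the escape events of all \<open>n\<close>
    coordinates, so that one tail estimate suffices.\<close>
  define X where "X z = 2 * real n * (\<Sum>i<n. cmod (z i) / cmod (h i))" for z :: "point"
  have "X \<in> borel_measurable (cvol n)" unfolding X_def by measurable
  then have Xm: "X \<in> borel_measurable (noise_vec n \<sigma>)" by (simp add: sets_noise_vec cong: measurable_cong_sets)
  obtain a0 where a0: "\<And>a. a \<ge> a0 \<Longrightarrow> emeasure (noise_vec n \<sigma>) {z \<in> space (noise_vec n \<sigma>). a \<le> X z} \<le> ennreal \<zeta>"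
    using G.tail_emeasure_small[OF Xm \<zeta>] by blast
  have r: "emeasure (noise_vec n \<sigma>) {z \<in> space (cvol n). \<exists>i<n. a / (2 * real n) \<le> cmod (z i) / cmod (h i)} \<le> ennreal \<zeta>"
    if a: "a \<ge> a0" for a
  proof -
    have "emeasure (noise_vec n \<sigma>) {z \<in> space (cvol n). \<exists>i<n. a / (2 * real n) \<le> cmod (z i) / cmod (h i)}
       \<le> emeasure (noise_vec n \<sigma>) {z \<in> space (noise_vec n \<sigma>). a \<le> X z}"
    proof (rule emeasure_mono)
      show "{z \<in> space (cvol n). \<exists>i<n. a / (2 * real n) \<le> cmod (z i) / cmod (h i)} \<subseteq> {z \<in> space (noise_vec n \<sigma>). a \<le> X z}"
      proof clarify
        fix z i assume z: "z \<in> space (cvol n)" and i: "i < n" "a / (2 * real n) \<le> cmod (z i) / cmod (h i)"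
        have "cmod (z i) / cmod (h i) \<le> (\<Sum>i<n. cmod (z i) / cmod (h i))"
          using i by (intro member_le_sum) auto
        then have "a / (2 * real n) \<le> (\<Sum>i<n. cmod (z i) / cmod (h i))" using i by linarith
        then show "z \<in> space (noise_vec n \<sigma>) \<and> a \<le> X z"
          using n z by (simp add: X_def space_noise_vec field_simps)
      qed
    qed (use Xm in measurable)
    then show ?thesis using a0[OF a] by simp
  qed
  have fr: "\<exists>\<^sub>F a in at_top. ereal \<gamma> < ecount (S \<inter> Cb n a) / ereal (a ^ (2 * n))"
  proof (rule ccontr)
    assume "\<not> ?thesis"
    then have "\<forall>\<^sub>F a in at_top. ecount (S \<inter> Cb n a) / ereal (a ^ (2 * n)) \<le> ereal \<gamma>"
      by (simp add: not_frequently not_less)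
    then have "IC_density n S \<le> ereal \<gamma>" unfolding IC_density_def by (rule Limsup_bounded)
    with dens show False by simp
  qed
  have "\<exists>\<^sub>F a in at_top. 1 - ?K \<le> avg_err n \<sigma> (chan n h ` S) (chan n h ` S \<inter> chan n h ` Cb n a)"
  proof (rule frequently_rev_mp[OF fr])
    show "\<forall>\<^sub>F a in at_top. ereal \<gamma> < ecount (S \<inter> Cb n a) / ereal (a ^ (2 * n)) \<longrightarrow>
        1 - ?K \<le> avg_err n \<sigma> (chan n h ` S) (chan n h ` S \<inter> chan n h ` Cb n a)"
      using eventually_gt_at_top[of 0] eventually_ge_at_top[of a0]
    proof eventually_elim
      case (elim a)
      show ?case
      proof
        assume "ereal \<gamma> < ecount (S \<inter> Cb n a) / ereal (a ^ (2 * n))"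
        then have "\<gamma> < real (card (S \<inter> Cb n a)) / a ^ (2 * n)"
          using fin[of a] elim by (simp add: ecount_def)
        then have c: "\<gamma> * a ^ (2 * n) < real (card (S \<inter> Cb n a))" using elim by (simp add: field_simps)
        have "1 \<le> avg_err n \<sigma> (chan n h ` S) (chan n h ` S \<inter> chan n h ` Cb n a) + ?K"
          by (rule avg_err_lower[OF \<sigma> n S fin h \<gamma> \<tau> elim(1) c r[OF elim(2)]])
        then show "1 - ?K \<le> avg_err n \<sigma> (chan n h ` S) (chan n h ` S \<inter> chan n h ` Cb n a)"
          by (subst ennreal_minus_le_iff) (auto simp: add.commute)
      qed
    qed
  qed
  then have "1 - ?K \<le> cond_err n \<sigma> S h"
    unfolding cond_err_def Let_def by (rule frequently_le_Limsup)
  then show ?thesis by (subst (asm) ennreal_minus_le_iff) (auto simp: add.commute)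
qed

lemma IC_density_gt_of_NLD:
  assumes n: "n \<ge> 1" and "NLD n S > ereal x"
  shows "IC_density n S > ereal (exp (real n * x))"
proof (cases "IC_density n S")
  case (real g)
  with assms have g: "g > 0" "x < ln g / real n" by (auto simp: NLD_def Let_def split: if_splits)
  then have "real n * x < ln g" using n by (simp add: field_simps)
  then have "exp (real n * x) < exp (ln g)" by (simp only: exp_less_mono)
  then show ?thesis using g real by simp
qed (use assms in \<open>auto simp: NLD_def Let_def\<close>)

section \<open>The converse averaged over the fading\<close>

context fading_channel begin

lemma AE_fade_nz: "AE h in fade_vec n. \<forall>i<n. h i \<noteq> 0"
proof -
  have "AE h in fade_vec n. \<forall>i\<in>{..<n}. h i \<noteq> 0"
    by (intro AE_finite_allI AE_PiM_component prob_space_axioms AE_H_nz) auto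
  then show ?thesis by (rule eventually_mono) auto
qed

lemma tinfo_sum_eq:
  assumes h: "\<And>i. i < n \<Longrightarrow> h i \<noteq> 0"
  shows "(\<Sum>i<n. tinfo (h i) (z i)) = ln ((\<Prod>i<n. (cmod (h i))\<^sup>2) * gdens n \<sigma> z)"
proof -
  have "(\<Prod>i<n. (cmod (h i))\<^sup>2) > 0" using h by (intro prod_pos) auto
  then have "ln ((\<Prod>i<n. (cmod (h i))\<^sup>2) * gdens n \<sigma> z) = ln (\<Prod>i<n. (cmod (h i))\<^sup>2) + ln (gdens n \<sigma> z)"
    using gdens_pos[OF \<sigma>_pos, of n z] by (rule ln_mult_pos)
  also have "ln (\<Prod>i<n. (cmod (h i))\<^sup>2) = (\<Sum>i<n. ln ((cmod (h i))\<^sup>2))"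
    using h by (subst ln_prod) auto
  finally show ?thesis by (simp add: ln_gdens[OF \<sigma>_pos] tinfo_def sum.distrib[symmetric] algebra_simps)
qed

lemma emeasure_joint:
  assumes "A \<in> sets (joint n)"
  shows "emeasure (joint n) A = (\<integral>\<^sup>+h. emeasure (noise_vec n \<sigma>) (Pair h -` A) \<partial>fade_vec n)"
    and "(\<lambda>h. emeasure (noise_vec n \<sigma>) (Pair h -` A)) \<in> borel_measurable (fade_vec n)"
proof -
  interpret G: prob_space "noise_vec n \<sigma>" by (rule prob_space_noise_vec[OF \<sigma>_pos])
  show "emeasure (joint n) A = (\<integral>\<^sup>+h. emeasure (noise_vec n \<sigma>) (Pair h -` A) \<partial>fade_vec n)"
    using assms unfolding joint_def by (rule G.emeasure_pair_measure_alt)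
  show "(\<lambda>h. emeasure (noise_vec n \<sigma>) (Pair h -` A)) \<in> borel_measurable (fade_vec n)"
    using assms unfolding joint_def by (rule G.measurable_emeasure_Pair)
qed

text \<open>In the loss \<open>(exp 4 + 1) / sqrt n\<close>, the \<open>exp 4\<close> is the volume
  term, and the 1 is the escape probability, made at most \<open>1 / sqrt n\<close> by taking cubes
  large enough.\<close>

theorem converse_bound:
  assumes n: "n \<ge> 1" and S: "is_IC n S" and fin: "\<And>a. finite (S \<inter> Cb n a)" and x: "NLD n S > ereal x"
  shows "ennreal (tinfo_cdf n (n * x - ln n / 2) - (exp 4 + 1) / sqrt n) \<le> avg_error_prob n \<sigma> \<mu>H S"
proof -
  interpret H: prob_space "fade_vec n" by (intro prob_space_PiM prob_space_axioms)
  interpret J: prob_space "joint n" by (rule prob_space_joint)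
  interpret G: prob_space "noise_vec n \<sigma>" by (rule prob_space_noise_vec[OF \<sigma>_pos])
  let ?A = "{p \<in> space (joint n). (\<Sum>i<n. tinfo (fst p i) (snd p i)) \<le> n * x - ln n / 2}"
  define c where "c = (exp 4 + 1) / sqrt n"
  define \<gamma> where "\<gamma> = exp (real n * x)"
  define g where "g h = emeasure (noise_vec n \<sigma>) (Pair h -` ?A)" for h
  have A[measurable]: "?A \<in> sets (joint n)" by measurable
  have gm[measurable]: "g \<in> borel_measurable (fade_vec n)" unfolding g_def by (rule emeasure_joint(2)[OF A])
  have dens: "IC_density n S > ereal \<gamma>" unfolding \<gamma>_def by (rule IC_density_gt_of_NLD[OF n x])
  have c0: "c \<ge> 0" by (simp add: c_def)
  \<comment> \<open>\<open>g\<close> is measurable in the fading and lies, up to \<open>c\<close>,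
    below \<open>cond_err\<close>; this passes to the integrals without measurability of
    \<open>cond_err\<close>.\<close>
  have key: "g h - ennreal c \<le> cond_err n \<sigma> S h" if hs: "h \<in> space (fade_vec n)" and h: "\<forall>i<n. h i \<noteq> 0" for h
  proof -
    define V where "V = (\<Prod>i<n. (cmod (h i))\<^sup>2)"
    \<comment> \<open>With a threshold depending on the fading,
      \<open>ln V + ln \<tau> = n * x - ln n / 2\<close> no longer does, so the low-density event is
      exactly a slice of the event on the information sum.\<close>
    define \<tau> where "\<tau> = \<gamma> / (V * sqrt n)"
    have V: "V > 0" unfolding V_def using h by (intro prod_pos) auto
    have \<tau>: "\<tau> > 0" using V n by (simp add: \<tau>_def \<gamma>_def)
    let ?B = "{z \<in> space (cvol n). \<tau> < gdens n \<sigma> z}"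
    have 1: "1 \<le> cond_err n \<sigma> S h + (ennreal (1 / sqrt n) + emeasure (noise_vec n \<sigma>) ?B + ennreal (\<tau> * (\<Prod>i<n. (cmod (h i))\<^sup>2) * exp 4 / \<gamma>))"
      by (rule cond_err_lower[OF \<sigma>_pos n S fin _ _ _ dens]) (use h \<tau> n in \<open>auto simp: \<gamma>_def\<close>)
    have 2: "\<tau> * (\<Prod>i<n. (cmod (h i))\<^sup>2) * exp 4 / \<gamma> = exp 4 / sqrt n"
      unfolding V_def[symmetric] using V by (simp add: \<tau>_def \<gamma>_def)
    have ev: "Pair h -` ?A = space (noise_vec n \<sigma>) - ?B"
    proof -
      have "(\<Sum>i<n. tinfo (h i) (z i)) \<le> n * x - ln n / 2 \<longleftrightarrow> \<not> \<tau> < gdens n \<sigma> z" for z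
      proof -
        have gp: "gdens n \<sigma> z > 0" by (rule gdens_pos[OF \<sigma>_pos])
        have "ln \<tau> = n * x - ln n / 2 - ln V"
          using V n by (simp add: \<tau>_def \<gamma>_def ln_div ln_mult ln_sqrt)
        moreover have "(\<Sum>i<n. tinfo (h i) (z i)) = ln V + ln (gdens n \<sigma> z)"
          using tinfo_sum_eq[of n h z] h V gp by (simp add: V_def[symmetric] ln_mult)
        ultimately have "(\<Sum>i<n. tinfo (h i) (z i)) \<le> n * x - ln n / 2 \<longleftrightarrow> ln (gdens n \<sigma> z) \<le> ln \<tau>" by linarith
        then show ?thesis using gp \<tau> by (simp add: not_less)
      qed
      then show ?thesis using hs by (auto simp: joint_def space_pair_measure space_noise_vec)
    qed
    have B: "?B \<in> sets (noise_vec n \<sigma>)" unfolding sets_noise_vec by measurable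
    have "emeasure (noise_vec n \<sigma>) (space (noise_vec n \<sigma>) - ?B) + emeasure (noise_vec n \<sigma>) ?B = emeasure (noise_vec n \<sigma>) (space (noise_vec n \<sigma>))"
      using B by (subst plus_emeasure) (auto simp: space_noise_vec intro!: arg_cong[where f="emeasure _"])
    then have gB: "g h + emeasure (noise_vec n \<sigma>) ?B = 1"
      unfolding g_def ev by (simp only: G.emeasure_space_1)
    have "g h + emeasure (noise_vec n \<sigma>) ?B \<le> cond_err n \<sigma> S h + ennreal c + emeasure (noise_vec n \<sigma>) ?B"
    proof -
      have "ennreal (1 / sqrt n) + ennreal (exp 4 / sqrt n) = ennreal c"
      proof -
        have c: "c = 1 / sqrt n + exp 4 / sqrt n" by (simp add: c_def add_divide_distrib)
        show ?thesis unfolding c by (rule ennreal_plus[symmetric]) auto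
      qed
      note e = this
      have "cond_err n \<sigma> S h + (ennreal (1 / sqrt n) + emeasure (noise_vec n \<sigma>) ?B + ennreal (exp 4 / sqrt n))
         = cond_err n \<sigma> S h + ennreal c + emeasure (noise_vec n \<sigma>) ?B"
        unfolding e[symmetric] by (simp only: ac_simps)
      then show ?thesis using 1 unfolding 2 gB by (simp only:)
    qed
    then have "emeasure (noise_vec n \<sigma>) ?B + g h \<le> emeasure (noise_vec n \<sigma>) ?B + (cond_err n \<sigma> S h + ennreal c)"
      by (simp only: ac_simps)
    then have "g h \<le> cond_err n \<sigma> S h + ennreal c"
      unfolding ennreal_add_left_cancel_le using G.emeasure_finite[of ?B] by auto
    then show ?thesis by (subst ennreal_minus_le_iff) (auto simp: add.commute)
  qed
  have "emeasure (joint n) ?A = (\<integral>\<^sup>+h. g h \<partial>fade_vec n)" unfolding g_def by (rule emeasure_joint(1)[OF A])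
  also have "\<dots> \<le> (\<integral>\<^sup>+h. (g h - ennreal c) + ennreal c \<partial>fade_vec n)"
  proof (rule nn_integral_mono)
    show "g h \<le> (g h - ennreal c) + ennreal c" for h
      using ennreal_minus_le_iff[of "g h" "ennreal c" "g h - ennreal c"] by (simp add: add.commute)
  qed
  also have "\<dots> = (\<integral>\<^sup>+h. (g h - ennreal c) \<partial>fade_vec n) + ennreal c"
    by (subst nn_integral_add) (auto simp: H.emeasure_space_1)
  also have "(\<integral>\<^sup>+h. (g h - ennreal c) \<partial>fade_vec n) \<le> avg_error_prob n \<sigma> \<mu>H S"
    unfolding avg_error_prob_def
  proof (rule nn_integral_mono_AE)
    show "AE h in fade_vec n. g h - ennreal c \<le> cond_err n \<sigma> S h"
      using AE_fade_nz AE_space by eventually_elim (rule key)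
  qed
  finally have "emeasure (joint n) ?A \<le> avg_error_prob n \<sigma> \<mu>H S + ennreal c" by (simp add: add_mono)
  then have "emeasure (joint n) ?A - ennreal c \<le> avg_error_prob n \<sigma> \<mu>H S"
    by (subst ennreal_minus_le_iff) (auto simp: add.commute)
  then show ?thesis unfolding c_def[symmetric] J.emeasure_eq_measure tinfo_cdf_def using c0 by (simp add: ennreal_minus)
qed

end

section \<open>Periodic constellations\<close>

definition gaussint :: "complex set" where
  "gaussint = range (\<lambda>(a, b). Complex (of_int a) (of_int b))"

definition glattice :: "nat \<Rightarrow> point set" where
  "glattice n = {\<kappa> \<in> cvec n. \<forall>i<n. \<kappa> i \<in> gaussint}"

lemma gaussint_iff: "z \<in> gaussint \<longleftrightarrow> Re z \<in> \<int> \<and> Im z \<in> \<int>"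
  by (auto simp: gaussint_def image_iff complex_eq_iff elim!: Ints_cases)

lemma gaussintE: "z \<in> gaussint \<Longrightarrow> \<exists>a b::int. z = Complex (of_int a) (of_int b)"
  by (auto simp: gaussint_def)

lemma gaussint_norm_ge_1:
  assumes "z \<in> gaussint" "z \<noteq> 0" shows "cmod z \<ge> 1"
proof -
  obtain a b :: int where z: "z = Complex a b" using assms by (auto simp: gaussint_def)
  then have "a \<noteq> 0 \<or> b \<noteq> 0" using assms by (auto simp: complex_eq_iff)
  then have "\<bar>real_of_int a\<bar> \<ge> 1 \<or> \<bar>real_of_int b\<bar> \<ge> 1" by linarith
  then show ?thesis using abs_Re_le_cmod[of z] abs_Im_le_cmod[of z] z by auto
qed

lemma countable_glattice: "countable (glattice n)"
proof -
  have "countable gaussint" unfolding gaussint_def by simp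
  then have c: "countable (PiE {..<n} (\<lambda>_. gaussint))" by (intro countable_PiE) auto
  have "glattice n \<subseteq> (\<lambda>f i. if i < n then f i else 0) ` (PiE {..<n} (\<lambda>_. gaussint))"
  proof
    fix \<kappa> assume l: "\<kappa> \<in> glattice n"
    have "\<kappa> = (\<lambda>i. if i < n then restrict \<kappa> {..<n} i else 0)" using l by (auto simp: glattice_def cvec_def)
    moreover have "restrict \<kappa> {..<n} \<in> PiE {..<n} (\<lambda>_. gaussint)" using l by (auto simp: glattice_def)
    ultimately show "\<kappa> \<in> (\<lambda>f i. if i < n then f i else 0) ` (PiE {..<n} (\<lambda>_. gaussint))" by blast
  qed
  then show ?thesis by (rule countable_subset[OF _ countable_image[OF c]])
qed

lemma glattice_diff: "\<kappa> \<in> glattice n \<Longrightarrow> \<mu> \<in> glattice n \<Longrightarrow> (\<lambda>i. \<kappa> i - \<mu> i) \<in> glattice n"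
  by (auto simp: glattice_def cvec_def gaussint_iff)

lemma glattice_uminus: "\<kappa> \<in> glattice n \<Longrightarrow> (\<lambda>i. - \<kappa> i) \<in> glattice n"
  by (auto simp: glattice_def cvec_def gaussint_iff)

lemma nn_integral_glattice_uminus:
  "(\<integral>\<^sup>+\<kappa>. f (\<lambda>i. - \<kappa> i) \<partial>count_space (glattice n)) = (\<integral>\<^sup>+\<kappa>. f \<kappa> \<partial>count_space (glattice n))"
proof (rule nn_integral_bij_count_space)
  show "bij_betw (\<lambda>\<kappa> i. - \<kappa> i) (glattice n) (glattice n)"
    by (rule bij_betw_byWitness[where f'="\<lambda>\<kappa> i. - \<kappa> i"]) (auto intro: glattice_uminus)
qed

abbreviation tplus :: "nat \<Rightarrow> real \<Rightarrow> point \<Rightarrow> point \<Rightarrow> point" where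
  "tplus n L \<kappa> \<equiv> caff n (\<lambda>i. of_real L * \<kappa> i) (\<lambda>_. 1)"

abbreviation tminus :: "nat \<Rightarrow> real \<Rightarrow> point \<Rightarrow> point \<Rightarrow> point" where
  "tminus n L \<kappa> \<equiv> caff n (\<lambda>i. - of_real L * \<kappa> i) (\<lambda>_. 1)"

abbreviation fcube :: "nat \<Rightarrow> real \<Rightarrow> point set" where
  "fcube n L \<equiv> hbox n (\<lambda>_. 1) L"

text \<open>In each real coordinate two lattice translates of the open cube containing the same
  point have centres less than \<open>L\<close> apart, while distinct multiples of \<open>L\<close>
  differ by at least \<open>L\<close>.\<close>

lemma fcube_translate_unique:
  assumes L: "L > 0" and l: "\<kappa> \<in> glattice n" "\<mu> \<in> glattice n"
    and y: "tminus n L \<kappa> y \<in> fcube n L" "tminus n L \<mu> y \<in> fcube n L"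
  shows "\<kappa> = \<mu>"
proof
  fix i
  show "\<kappa> i = \<mu> i"
  proof (cases "i < n")
    case True
    obtain a b c d :: int where e: "\<kappa> i = Complex a b" "\<mu> i = Complex c d"
      using l True gaussintE by (metis (mono_tags, lifting) glattice_def mem_Collect_eq)
    have "\<bar>Re (y i) - L * a\<bar> < L / 2" "\<bar>Re (y i) - L * c\<bar> < L / 2" "\<bar>Im (y i) - L * b\<bar> < L / 2" "\<bar>Im (y i) - L * d\<bar> < L / 2"
      using y True by (auto simp: hbox_def caff_def e)
    then have "\<bar>L * a - L * c\<bar> < L" "\<bar>L * b - L * d\<bar> < L" by linarith+
    then have "\<bar>L * real_of_int (a - c)\<bar> < L" "\<bar>L * real_of_int (b - d)\<bar> < L" by (simp_all add: right_diff_distrib)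
    moreover have "\<bar>u\<bar> < 1" if "\<bar>L * u\<bar> < L" for u
      using that L by (simp add: abs_mult)
    ultimately have "\<bar>real_of_int (a - c)\<bar> < 1" "\<bar>real_of_int (b - d)\<bar> < 1" by blast+
    then have "a = c" "b = d" by linarith+
    then show ?thesis using e by simp
  qed (use l in \<open>auto simp: glattice_def cvec_def\<close>)
qed

text \<open>Unfolding: moving the translation from \<open>f\<close> to the cube turns the sum over
  the lattice into integrals of \<open>f\<close> over disjoint cubes. Disjointness alone gives the
  inequality, which is all that an upper bound on confusion requires.\<close>

lemma nn_integral_fcube_periodized_le:
  assumes L: "L > 0" and f[measurable]: "f \<in> borel_measurable (cvol n)"
  shows "(\<integral>\<^sup>+x. (\<integral>\<^sup>+\<kappa>. f (tplus n L \<kappa> x) \<partial>count_space (glattice n)) * indicator (fcube n L) x \<partial>cvol n)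
    \<le> (\<integral>\<^sup>+x. f x \<partial>cvol n)"
proof -
  let ?G = "count_space (glattice n)"
  have "(\<integral>\<^sup>+x. (\<integral>\<^sup>+\<kappa>. f (tplus n L \<kappa> x) \<partial>?G) * indicator (fcube n L) x \<partial>cvol n)
    = (\<integral>\<^sup>+x. (\<integral>\<^sup>+\<kappa>. f (tplus n L \<kappa> x) * indicator (fcube n L) x \<partial>?G) \<partial>cvol n)"
    by (simp add: nn_integral_multc)
  also have "\<dots> = (\<integral>\<^sup>+\<kappa>. (\<integral>\<^sup>+x. f (tplus n L \<kappa> x) * indicator (fcube n L) x \<partial>cvol n) \<partial>?G)"
    by (rule nn_integral_count_space_nn_integral[OF countable_glattice]) measurable
  also have "\<dots> = (\<integral>\<^sup>+\<kappa>. (\<integral>\<^sup>+y. f y * indicator (fcube n L) (tminus n L \<kappa> y) \<partial>cvol n) \<partial>?G)"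
  proof (rule nn_integral_cong)
    fix \<kappa>
    have inv: "tplus n L \<kappa> (tminus n L \<kappa> y) = y" if "y \<in> space (cvol n)" for y
      using that by (auto simp: caff_def space_cvol PiE_def extensional_def)
    have "(\<integral>\<^sup>+x. f (tplus n L \<kappa> x) * indicator (fcube n L) x \<partial>cvol n)
      = ennreal (\<Prod>i<n. (cmod 1)\<^sup>2) * (\<integral>\<^sup>+y. f (tplus n L \<kappa> (tminus n L \<kappa> y))
           * indicator (fcube n L) (tminus n L \<kappa> y) \<partial>cvol n)"
      by (rule nn_integral_caff) auto
    also have "\<dots> = (\<integral>\<^sup>+y. f y * indicator (fcube n L) (tminus n L \<kappa> y) \<partial>cvol n)"
      by (simp only: norm_one power_one prod.neutral_const ennreal_1 mult_1, intro nn_integral_cong) (simp only: inv)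
    finally show "(\<integral>\<^sup>+x. f (tplus n L \<kappa> x) * indicator (fcube n L) x \<partial>cvol n)
      = (\<integral>\<^sup>+y. f y * indicator (fcube n L) (tminus n L \<kappa> y) \<partial>cvol n)" .
  qed
  also have "\<dots> = (\<integral>\<^sup>+y. (\<integral>\<^sup>+\<kappa>. f y * indicator (fcube n L) (tminus n L \<kappa> y) \<partial>?G) \<partial>cvol n)"
    by (rule nn_integral_count_space_nn_integral[OF countable_glattice, symmetric]) measurable
  also have "\<dots> \<le> (\<integral>\<^sup>+y. f y \<partial>cvol n)"
  proof (rule nn_integral_mono)
    fix y
    let ?U = "{\<kappa> \<in> glattice n. tminus n L \<kappa> y \<in> fcube n L}"
    have "(\<integral>\<^sup>+\<kappa>. f y * indicator (fcube n L) (tminus n L \<kappa> y) \<partial>?G)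
      = f y * (\<integral>\<^sup>+\<kappa>. indicator (fcube n L) (tminus n L \<kappa> y) \<partial>?G)"
      by (rule nn_integral_cmult) simp
    also have "\<dots> \<le> f y * 1"
    proof (rule mult_left_mono)
      have "(\<integral>\<^sup>+\<kappa>. indicator (fcube n L) (tminus n L \<kappa> y) \<partial>?G) = (\<integral>\<^sup>+\<kappa>. indicator ?U \<kappa> \<partial>?G)"
        by (intro nn_integral_cong) (auto simp: indicator_def)
      also have "\<dots> = emeasure ?G ?U" by (rule nn_integral_indicator) auto
      also have "\<dots> \<le> 1"
      proof (cases "?U = {}")
        case False
        then obtain \<kappa> where "\<kappa> \<in> ?U" by blast
        then have "?U = {\<kappa>}" using fcube_translate_unique[OF L] by blast
        then show ?thesis using \<open>\<kappa> \<in> ?U\<close> by (subst emeasure_count_space_finite) auto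
      qed (simp only: emeasure_empty zero_le)
      finally show "(\<integral>\<^sup>+\<kappa>. indicator (fcube n L) (tminus n L \<kappa> y) \<partial>?G) \<le> 1" .
    qed simp
    finally show "(\<integral>\<^sup>+\<kappa>. f y * indicator (fcube n L) (tminus n L \<kappa> y) \<partial>?G) \<le> f y" by simp
  qed
  finally show ?thesis .
qed

section \<open>Congruence classes modulo the lattice and the greedy choice of
  representatives\<close>

definition lcong :: "nat \<Rightarrow> real \<Rightarrow> point \<Rightarrow> point \<Rightarrow> bool" where
  "lcong n L u v \<longleftrightarrow> (\<exists>\<kappa>\<in>glattice n. \<forall>i<n. v i = u i + of_real L * \<kappa> i)"

definition incongruent :: "nat \<Rightarrow> real \<Rightarrow> nat \<Rightarrow> (nat \<Rightarrow> point) \<Rightarrow> bool" where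
  "incongruent n L M \<omega> \<longleftrightarrow> (\<forall>k<M. \<forall>j<k. \<not> lcong n L (\<omega> j) (\<omega> k))"

lemma null_sets_lcong:
  assumes n: "n \<ge> 1"
  shows "{x \<in> space (cvol n). lcong n L u x} \<in> null_sets (cvol n)"
proof -
  have single: "{x} \<in> null_sets (cvol n)" if x: "x \<in> space (cvol n)" for x
  proof -
    have e: "{x} = PiE {..<n} (\<lambda>i. {x i})" using PiE_singleton[of x "{..<n}"] x by (simp add: space_cvol PiE_def)
    have "emeasure (cvol n) (PiE {..<n} (\<lambda>i. {x i})) = (\<Prod>i<n. emeasure lborel {x i})"
      unfolding cvol_def by (rule lborel_prod.emeasure_PiM) auto
    also have "\<dots> = 0" using n by simp
    finally show ?thesis unfolding e by (auto simp: null_sets_def cvol_def intro!: sets_PiM_I_finite)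
  qed
  have c: "countable {x \<in> space (cvol n). lcong n L u x}"
  proof (rule countable_subset)
    show "{x \<in> space (cvol n). lcong n L u x} \<subseteq> (\<lambda>\<kappa>. restrict (\<lambda>i. u i + of_real L * \<kappa> i) {..<n}) ` glattice n"
    proof clarify
      fix x assume x: "x \<in> space (cvol n)" "lcong n L u x"
      then obtain \<kappa> where l: "\<kappa> \<in> glattice n" "\<forall>i<n. x i = u i + of_real L * \<kappa> i" by (auto simp: lcong_def)
      have "x = restrict (\<lambda>i. u i + of_real L * \<kappa> i) {..<n}" using x l by (auto simp: space_cvol PiE_def extensional_def fun_eq_iff)
      then show "x \<in> (\<lambda>\<kappa>. restrict (\<lambda>i. u i + of_real L * \<kappa> i) {..<n}) ` glattice n" using l by blast
    qed
  qed (use countable_glattice in simp)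
  have "{x \<in> space (cvol n). lcong n L u x} = (\<Union>x\<in>{x \<in> space (cvol n). lcong n L u x}. {x})" by auto
  also have "\<dots> \<in> null_sets (cvol n)" by (rule null_sets_UN'[OF c]) (use single in auto)
  finally show ?thesis .
qed

text \<open>The points are chosen one after the other by averaging. The factor 2 is slack which allows
  avoiding the null set of points congruent to earlier ones.\<close>

lemma greedy_codebook:
  assumes n: "n \<ge> 1" and L: "L > 0" and B: "B > 0"
    and gm: "\<And>u. u \<in> space (cvol n) \<Longrightarrow> g u \<in> borel_measurable (cvol n)"
    and gi: "\<And>u. u \<in> space (cvol n) \<Longrightarrow> (\<integral>\<^sup>+x. g u x * indicator (fcube n L) x \<partial>cvol n) \<le> ennreal B"
  shows "\<exists>\<omega>. \<forall>k<M. \<omega> k \<in> space (cvol n) \<and> (\<forall>j<k. \<not> lcong n L (\<omega> j) (\<omega> k))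
      \<and> (\<Sum>j<k. g (\<omega> j) (\<omega> k)) \<le> ennreal (2 * real k * B / L ^ (2 * n))"
proof (induction M)
  case (Suc M)
  then obtain \<omega> where \<omega>: "\<And>k. k < M \<Longrightarrow> \<omega> k \<in> space (cvol n) \<and> (\<forall>j<k. \<not> lcong n L (\<omega> j) (\<omega> k))
      \<and> (\<Sum>j<k. g (\<omega> j) (\<omega> k)) \<le> ennreal (2 * real k * B / L ^ (2 * n))" by blast
  define C where "C = (\<Union>j<M. {x \<in> space (cvol n). lcong n L (\<omega> j) x})"
  have C: "C \<in> null_sets (cvol n)" unfolding C_def
    by (rule null_sets_UN') (auto intro: null_sets_lcong[OF n])
  let ?Q = "fcube n L - C"
  have Qm: "?Q \<in> sets (cvol n)" using C by auto
  have volQ: "emeasure (cvol n) ?Q = ennreal (L ^ (2 * n))"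
    using emeasure_hbox[of n "\<lambda>_. 1" L] L C by (simp add: emeasure_Diff_null_set)
  have "\<exists>x\<in>?Q. (\<Sum>j<M. g (\<omega> j) x) \<le> ennreal (2 * real M * B / L ^ (2 * n))"
  proof (cases "M = 0")
    \<comment> \<open>With no earlier points both sides of the averaging vanish and give no
      contradiction; a point exists because \<open>?Q\<close> has positive volume.\<close>
    case True
    have "?Q \<noteq> {}"
    proof
      assume e: "?Q = {}"
      have "ennreal (L ^ (2 * n)) = 0" unfolding volQ[symmetric] e by (rule emeasure_empty)
      then have "L ^ (2 * n) \<le> 0" by (simp add: ennreal_eq_0_iff)
      then show False using zero_less_power[OF L, of "2 * n"] by linarith
    qed
    then show ?thesis using True by auto
  next
    case False
    show ?thesis
    proof (rule ccontr)
      assume "\<not> ?thesis"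
      then have gt: "ennreal (2 * real M * B / L ^ (2 * n)) \<le> (\<Sum>j<M. g (\<omega> j) x)" if "x \<in> ?Q" for x
        using that by (auto simp: not_le intro: less_imp_le)
      have "ennreal (2 * real M * B) = ennreal (2 * real M * B / L ^ (2 * n)) * emeasure (cvol n) ?Q"
        unfolding volQ using L B by (subst ennreal_mult[symmetric]) auto
      also have "\<dots> = (\<integral>\<^sup>+x. ennreal (2 * real M * B / L ^ (2 * n)) * indicator ?Q x \<partial>cvol n)"
        using Qm by (simp add: nn_integral_cmult_indicator)
      also have "\<dots> \<le> (\<integral>\<^sup>+x. (\<Sum>j<M. g (\<omega> j) x * indicator (fcube n L) x) \<partial>cvol n)"
        using gt by (intro nn_integral_mono) (auto simp: indicator_def sum_distrib_right[symmetric])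
      also have "\<dots> = (\<Sum>j<M. \<integral>\<^sup>+x. g (\<omega> j) x * indicator (fcube n L) x \<partial>cvol n)"
        using gm \<omega> by (intro nn_integral_sum) auto
      also have "\<dots> \<le> (\<Sum>j<M. ennreal B)" using gi \<omega> by (intro sum_mono) auto
      also have "\<dots> = ennreal (real M * B)" using B by (simp add: ennreal_mult ennreal_of_nat_eq_real_of_nat)
      finally have "2 * real M * B \<le> real M * B" using B by (simp add: ennreal_le_iff)
      then show False using B False by (simp add: mult_le_cancel_right)
    qed
  qed
  then obtain x where x: "x \<in> ?Q" "(\<Sum>j<M. g (\<omega> j) x) \<le> ennreal (2 * real M * B / L ^ (2 * n))" by blast
  have xs: "x \<in> space (cvol n)" using x by (auto simp: hbox_def)
  define \<omega>' where "\<omega>' k = (if k = M then x else \<omega> k)" for k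
  show ?case
  proof (intro exI[of _ \<omega>'] allI impI)
    fix k assume "k < Suc M"
    then consider "k < M" | "k = M" by linarith
    then show "\<omega>' k \<in> space (cvol n) \<and> (\<forall>j<k. \<not> lcong n L (\<omega>' j) (\<omega>' k))
      \<and> (\<Sum>j<k. g (\<omega>' j) (\<omega>' k)) \<le> ennreal (2 * real k * B / L ^ (2 * n))"
    proof cases
      case 1
      then have "(\<Sum>j<k. g (\<omega>' j) (\<omega>' k)) = (\<Sum>j<k. g (\<omega> j) (\<omega> k))" by (intro sum.cong) (auto simp: \<omega>'_def)
      then show ?thesis using \<omega>[OF 1] 1 by (auto simp: \<omega>'_def)
    next
      case 2
      then have "(\<Sum>j<k. g (\<omega>' j) (\<omega>' k)) = (\<Sum>j<M. g (\<omega> j) x)" by (intro sum.cong) (auto simp: \<omega>'_def)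
      then show ?thesis using x xs 2 by (auto simp: C_def \<omega>'_def)
    qed
  qed
qed simp

text \<open>Regroups ordered pairs by their later index: the greedy choice controls a new point
  against all earlier ones, in both roles.\<close>

lemma sum_pairs_offdiag:
  fixes P :: "nat \<Rightarrow> nat \<Rightarrow> ennreal"
  shows "(\<Sum>j<M. \<Sum>k\<in>{..<M} - {j}. P j k) = (\<Sum>k<M. \<Sum>j<k. P j k + P k j)"
proof (induction M)
  case (Suc M)
  have "(\<Sum>j<Suc M. \<Sum>k\<in>{..<Suc M} - {j}. P j k) = (\<Sum>j<M. \<Sum>k\<in>{..<Suc M} - {j}. P j k) + (\<Sum>k\<in>{..<Suc M} - {M}. P M k)"
    by simp
  also have "{..<Suc M} - {M} = {..<M}" by auto
  also have "(\<Sum>j<M. \<Sum>k\<in>{..<Suc M} - {j}. P j k) = (\<Sum>j<M. P j M + (\<Sum>k\<in>{..<M} - {j}. P j k))"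
  proof (rule sum.cong)
    fix j assume "j \<in> {..<M}"
    then have "{..<Suc M} - {j} = insert M ({..<M} - {j})" by auto
    then show "(\<Sum>k\<in>{..<Suc M} - {j}. P j k) = P j M + (\<Sum>k\<in>{..<M} - {j}. P j k)" by simp
  qed simp
  finally show ?case using Suc by (simp add: sum.distrib ac_simps)
qed simp

section \<open>Counting the points of a class in a cube\<close>

lemma card_int_interval:
  fixes r a L :: real
  assumes L: "L > 0" and a: "a > 0"
  defines "A \<equiv> {m::int. \<bar>r + L * m\<bar> < a / 2}"
  shows "finite A" "real (card A) \<le> a / L + 1" "real (card A) \<ge> a / L - 1"
proof -
  define x y where "x = (- a / 2 - r) / L" and "y = (a / 2 - r) / L"
  have yx: "y - x = a / L" by (simp add: x_def y_def diff_divide_distrib[symmetric])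
  \<comment> \<open>The interval is open, whence floor plus one and ceiling minus one; the count
    differs from the length \<open>a / L\<close> by at most 1.\<close>
  have "A = {\<lfloor>x\<rfloor> + 1..\<lceil>y\<rceil> - 1}"
  proof -
    have "\<bar>r + L * m\<bar> < a / 2 \<longleftrightarrow> m \<in> {\<lfloor>x\<rfloor> + 1..\<lceil>y\<rceil> - 1}" for m :: int
    proof -
      have 1: "- a / 2 - r < L * m \<longleftrightarrow> \<lfloor>x\<rfloor> < m"
        unfolding floor_less_iff x_def using L by (simp add: pos_divide_less_eq mult.commute)
      have 2: "L * m < a / 2 - r \<longleftrightarrow> m < \<lceil>y\<rceil>"
        unfolding less_ceiling_iff y_def using L by (simp add: pos_less_divide_eq mult.commute)
      have "\<bar>r + L * m\<bar> < a / 2 \<longleftrightarrow> - a / 2 - r < L * m \<and> L * m < a / 2 - r" by (simp only: abs_less_iff) argo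
      also have "\<dots> \<longleftrightarrow> m \<in> {\<lfloor>x\<rfloor> + 1..\<lceil>y\<rceil> - 1}" unfolding 1 2 by auto
      finally show ?thesis .
    qed
    then show ?thesis unfolding A_def by (intro set_eqI) (simp only: mem_Collect_eq)
  qed
  then have f: "finite A" and c: "card A = nat (\<lceil>y\<rceil> - 1 - \<lfloor>x\<rfloor>)" by auto
  show "finite A" by (rule f)
  have "a / L > 0" using L a by simp
  then show "real (card A) \<le> a / L + 1" "real (card A) \<ge> a / L - 1"
    unfolding c yx[symmetric] by linarith+
qed

text \<open>The count factorises over \<open>2 * n\<close> real coordinates, each an integer count
  in an interval of length \<open>a / L\<close>. The condition \<open>a \<ge> L\<close> keeps the
  lower factors nonnegative, as multiplying the inequalities requires.\<close>

lemma card_lattice_class_cube: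
  fixes w :: "point" and n :: nat
  assumes L: "L > 0" and a: "a \<ge> L"
  defines "A \<equiv> {x \<in> Cb n a. lcong n L w x}"
  shows "finite A" "real (card A) \<le> (a / L + 1) ^ (2 * n)" "real (card A) \<ge> (a / L - 1) ^ (2 * n)"
proof -
  define I where "I r = {m::int. \<bar>r + L * m\<bar> < a / 2}" for r
  define F where "F i = (\<lambda>(p, q). w i + of_real L * Complex (of_int p) (of_int q)) ` (I (Re (w i)) \<times> I (Im (w i)))" for i
  have a0: "a > 0" using L a by simp
  note Ic = card_int_interval[OF L a0, folded I_def]
  have inj: "inj_on (\<lambda>(p, q). w i + of_real L * Complex (of_int p) (of_int q)) X" for i and X :: "(int \<times> int) set"
    using L by (auto simp: inj_on_def complex_eq_iff)
  have Ff: "finite (F i)" for i unfolding F_def using Ic(1) by auto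
  have cF: "card (F i) = card (I (Re (w i))) * card (I (Im (w i)))" for i
    unfolding F_def by (subst card_image[OF inj]) (simp add: card_cartesian_product)
  have bij: "bij_betw (\<lambda>x. restrict x {..<n}) A (PiE {..<n} F)"
  proof (rule bij_betw_byWitness[where f'="\<lambda>f i. if i < n then f i else 0"])
    show "\<forall>x\<in>A. (\<lambda>i. if i < n then restrict x {..<n} i else 0) = x"
      by (auto simp: A_def Cb_def cvec_def fun_eq_iff)
    show "\<forall>f\<in>PiE {..<n} F. restrict (\<lambda>i. if i < n then f i else 0) {..<n} = f"
      by (auto simp: fun_eq_iff PiE_def extensional_def)
    show "(\<lambda>x. restrict x {..<n}) ` A \<subseteq> PiE {..<n} F"
    proof clarify
      fix x assume x: "x \<in> A"
      then obtain \<kappa> where l: "\<kappa> \<in> glattice n" "\<And>i. i < n \<Longrightarrow> x i = w i + of_real L * \<kappa> i" by (auto simp: A_def lcong_def)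
      have "x i \<in> F i" if i: "i < n" for i
      proof -
        obtain p q :: int where pq: "\<kappa> i = Complex p q" using l i by (auto simp: glattice_def gaussint_def)
        have "\<bar>Re (x i)\<bar> < a / 2" "\<bar>Im (x i)\<bar> < a / 2" using x i by (auto simp: A_def Cb_def)
        then have "p \<in> I (Re (w i))" "q \<in> I (Im (w i))" using l(2)[OF i] by (auto simp: I_def pq)
        then show ?thesis unfolding F_def using l(2)[OF i] pq by (intro image_eqI[of _ _ "(p, q)"]) auto
      qed
      then show "restrict x {..<n} \<in> PiE {..<n} F" by auto
    qed
    show "(\<lambda>f i. if i < n then f i else 0) ` PiE {..<n} F \<subseteq> A"
    proof clarify
      fix f assume f: "f \<in> PiE {..<n} F"
      then have "\<forall>i\<in>{..<n}. \<exists>l. l \<in> gaussint \<and> f i = w i + of_real L * l \<and> \<bar>Re (f i)\<bar> < a / 2 \<and> \<bar>Im (f i)\<bar> < a / 2"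
        by (force simp: F_def I_def gaussint_def PiE_def Pi_def)
      then obtain l where l: "\<And>i. i < n \<Longrightarrow> l i \<in> gaussint \<and> f i = w i + of_real L * l i \<and> \<bar>Re (f i)\<bar> < a / 2 \<and> \<bar>Im (f i)\<bar> < a / 2"
        by (metis lessThan_iff)
      have "(\<lambda>i. if i < n then l i else 0) \<in> glattice n" using l by (auto simp: glattice_def cvec_def)
      then have "lcong n L w (\<lambda>i. if i < n then f i else 0)"
        unfolding lcong_def using l by (intro bexI[of _ "\<lambda>i. if i < n then l i else 0"]) auto
      moreover have "\<bar>Re (f i)\<bar> < a / 2 \<and> \<bar>Im (f i)\<bar> < a / 2" if "i < n" for i using l[OF that] by blast
      ultimately show "(\<lambda>i. if i < n then f i else 0) \<in> A" by (auto simp: A_def Cb_def cvec_def)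
    qed
  qed
  have "finite (PiE {..<n} F)" using Ff by (intro finite_PiE) auto
  then show "finite A" using bij bij_betw_finite by blast
  have cA: "real (card A) = (\<Prod>i<n. real (card (I (Re (w i)))) * real (card (I (Im (w i)))))"
    using bij_betw_same_card[OF bij] by (simp add: card_PiE cF)
  have p: "(\<Prod>i<n. c * c) = c ^ (2 * n)" for c :: real by (simp add: power_mult power2_eq_square)
  have aL: "a / L - 1 \<ge> 0" using L a by simp
  show "real (card A) \<le> (a / L + 1) ^ (2 * n)"
    unfolding cA p[symmetric] using Ic(2) aL by (intro prod_mono conjI mult_mono) (auto intro: order_trans[OF aL])
  show "real (card A) \<ge> (a / L - 1) ^ (2 * n)"
    unfolding cA p[symmetric] using Ic(3) aL by (intro prod_mono conjI mult_mono) auto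
qed

section \<open>Achievability\<close>

lemma borel_measurable_nn_integral_count_space:
  fixes f :: "'i \<Rightarrow> 'a \<Rightarrow> ennreal"
  assumes I: "countable I" and f: "\<And>i. i \<in> I \<Longrightarrow> f i \<in> borel_measurable N"
  shows "(\<lambda>x. \<integral>\<^sup>+i. f i x \<partial>count_space I) \<in> borel_measurable N"
proof -
  interpret C: sigma_finite_measure "count_space I" by (rule sigma_finite_measure_count_space_countable[OF I])
  have "(\<lambda>(i, x). f i x) \<in> borel_measurable (count_space I \<Otimes>\<^sub>M N)"
    by (rule measurable_pair_measure_countable1[OF I]) (use f in auto)
  then have "(\<lambda>p. case (case p of (x, i) \<Rightarrow> (i, x)) of (i, x) \<Rightarrow> f i x) \<in> borel_measurable (N \<Otimes>\<^sub>M count_space I)"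
    by (rule measurable_compose[OF measurable_pair_swap'])
  from C.borel_measurable_nn_integral_fst[OF this] show ?thesis by simp
qed

text \<open>The union bound is phrased as an integral over counting measure so that it can be
  interchanged with the integral over the fading.\<close>

lemma emeasure_UN_le_nn_integral_count_space:
  assumes I: "countable I" and A: "\<And>i. i \<in> I \<Longrightarrow> A i \<in> sets M"
  shows "emeasure M (\<Union>i\<in>I. A i) \<le> (\<integral>\<^sup>+i. emeasure M (A i) \<partial>count_space I)"
proof -
  have U: "(\<Union>i\<in>I. A i) \<in> sets M" using I A by (rule sets.countable_UN'')
  have "emeasure M (\<Union>i\<in>I. A i) = (\<integral>\<^sup>+x. indicator (\<Union>i\<in>I. A i) x \<partial>M)" using U by simp
  also have "\<dots> \<le> (\<integral>\<^sup>+x. \<integral>\<^sup>+i. indicator (A i) x \<partial>count_space I \<partial>M)"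
  proof (rule nn_integral_mono)
    fix x
    show "indicator (\<Union>i\<in>I. A i) x \<le> (\<integral>\<^sup>+i. indicator (A i) x \<partial>count_space I)"
    proof (cases "x \<in> (\<Union>i\<in>I. A i)")
      case True
      then obtain j where j: "j \<in> I" "x \<in> A j" by blast
      have "1 = emeasure (count_space I) {j}" using j by (subst emeasure_count_space_finite) auto
      also have "\<dots> = (\<integral>\<^sup>+i. indicator {j} i \<partial>count_space I)" using j by (subst nn_integral_indicator) auto
      also have "\<dots> \<le> (\<integral>\<^sup>+i. indicator (A i) x \<partial>count_space I)"
        using j by (intro nn_integral_mono) (auto simp: indicator_def)
      finally show ?thesis using True by simp
    qed simp
  qed
  also have "\<dots> = (\<integral>\<^sup>+i. \<integral>\<^sup>+x. indicator (A i) x \<partial>M \<partial>count_space I)"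
    by (rule nn_integral_count_space_nn_integral[OF I]) (use A in auto)
  also have "\<dots> = (\<integral>\<^sup>+i. emeasure M (A i) \<partial>count_space I)"
    by (rule nn_integral_cong) (use A in auto)
  finally show ?thesis .
qed

text \<open>Here \<open>x\<close> is the displacement from the sent point to a competitor and
  \<open>z\<close> the noise: the competitor is at least as close to the received point as the sent
  one. Ties count against the decoder.\<close>

definition near :: "nat \<Rightarrow> point \<Rightarrow> point \<Rightarrow> point \<Rightarrow> bool" where
  "near n h x z \<longleftrightarrow> (\<Sum>i<n. (cmod (h i * x i - z i))\<^sup>2) \<le> (\<Sum>i<n. (cmod (z i))\<^sup>2)"

lemma near_cong: "(\<And>i. i < n \<Longrightarrow> x i = x' i) \<Longrightarrow> near n h x z = near n h x' z"
  unfolding near_def by simp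

text \<open>Markov's inequality: the density has mass at most 1 on its superlevel set.\<close>

lemma emeasure_gdens_superlevel_le:
  assumes \<sigma>: "\<sigma> > 0"
  shows "emeasure (cvol n) {w \<in> space (cvol n). (\<Sum>i<n. (cmod (w i))\<^sup>2) \<le> (\<Sum>i<n. (cmod (z i))\<^sup>2)} \<le> ennreal (1 / gdens n \<sigma> z)"
    (is "emeasure _ ?W \<le> _")
proof -
  interpret G: prob_space "noise_vec n \<sigma>" by (rule prob_space_noise_vec[OF \<sigma>])
  have g: "gdens n \<sigma> z > 0" by (rule gdens_pos[OF \<sigma>])
  have W: "?W \<in> sets (cvol n)" by measurable
  \<comment> \<open>The density decreases with the Euclidean norm, so the ball through
    \<open>z\<close> lies in its superlevel set.\<close>
  have le: "gdens n \<sigma> z \<le> gdens n \<sigma> w" if "w \<in> ?W" for w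
  proof -
    have "(\<Sum>i<n. (cmod (w i))\<^sup>2) / \<sigma>\<^sup>2 \<le> (\<Sum>i<n. (cmod (z i))\<^sup>2) / \<sigma>\<^sup>2" using that by (intro divide_right_mono) auto
    then have "ln (gdens n \<sigma> z) \<le> ln (gdens n \<sigma> w)"
      unfolding ln_gdens[OF \<sigma>] by (simp add: sum_subtractf sum_negf sum_divide_distrib)
    then show ?thesis using gdens_pos[OF \<sigma>] by simp
  qed
  have "ennreal (gdens n \<sigma> z) * emeasure (cvol n) ?W = (\<integral>\<^sup>+w. ennreal (gdens n \<sigma> z) * indicator ?W w \<partial>cvol n)"
    using W by (simp add: nn_integral_cmult_indicator)
  also have "\<dots> \<le> (\<integral>\<^sup>+w. ennreal (gdens n \<sigma> w) * indicator (space (cvol n)) w \<partial>cvol n)"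
    using le by (intro nn_integral_mono) (auto simp: indicator_def intro: ennreal_leI)
  also have "\<dots> = emeasure (noise_vec n \<sigma>) (space (noise_vec n \<sigma>))"
    unfolding space_noise_vec unfolding noise_vec_eq_density[OF \<sigma>] by (subst emeasure_density) auto
  also have "\<dots> = 1" by (rule G.emeasure_space_1)
  finally have "ennreal (gdens n \<sigma> z) * emeasure (cvol n) ?W \<le> 1" .
  then have "ennreal (1 / gdens n \<sigma> z) * (ennreal (gdens n \<sigma> z) * emeasure (cvol n) ?W) \<le> ennreal (1 / gdens n \<sigma> z) * 1"
    by (rule mult_left_mono) simp
  then show ?thesis using g by (simp add: mult.assoc[symmetric] ennreal_mult[symmetric])
qed

section \<open>Pairwise confusion probabilities and the codebook\<close>

context fading_channel begin

text \<open>Confusion is counted only where the information sum reaches \<open>y\<close>; elsewhere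
  the error is charged to \<open>bad_set\<close>. Without this restriction the integral over
  displacements could not be bounded by \<open>exp (- y)\<close>.\<close>

definition good_near :: "nat \<Rightarrow> real \<Rightarrow> point \<Rightarrow> (point \<times> point) set" where
  "good_near n y x = {p \<in> space (joint n). y \<le> (\<Sum>i<n. tinfo (fst p i) (snd p i)) \<and> near n (fst p) x (snd p)}"

definition near_prob :: "nat \<Rightarrow> real \<Rightarrow> point \<Rightarrow> ennreal" where
  "near_prob n y x = emeasure (joint n) (good_near n y x)"

lemma good_near_cong: "(\<And>i. i < n \<Longrightarrow> x i = x' i) \<Longrightarrow> good_near n y x = good_near n y x'"
  unfolding good_near_def using near_cong[of n x x'] by simp

lemma near_prob_cong: "(\<And>i. i < n \<Longrightarrow> x i = x' i) \<Longrightarrow> near_prob n y x = near_prob n y x'"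
  unfolding near_prob_def using good_near_cong[of n x x'] by simp

lemma sets_good_near_pair:
  "{q \<in> space (cvol n \<Otimes>\<^sub>M joint n). snd q \<in> good_near n y (fst q)} \<in> sets (cvol n \<Otimes>\<^sub>M joint n)"
proof -
  have 1[measurable]: "(\<lambda>q. fst q i) \<in> borel_measurable (cvol n \<Otimes>\<^sub>M joint n)" if "i < n" for i
    using that by (rule measurable_compose[OF measurable_fst measurable_component_cvol])
  have 2[measurable]: "(\<lambda>q. fst (snd q) i) \<in> borel_measurable (cvol n \<Otimes>\<^sub>M joint n)" "(\<lambda>q. snd (snd q) i) \<in> borel_measurable (cvol n \<Otimes>\<^sub>M joint n)" if "i < n" for i
    using that by (auto intro: measurable_compose[OF measurable_snd measurable_joint_components(1)] measurable_compose[OF measurable_snd measurable_joint_components(2)])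
  have 3[measurable]: "(\<lambda>q. \<Sum>i<n. tinfo (fst (snd q) i) (snd (snd q) i)) \<in> borel_measurable (cvol n \<Otimes>\<^sub>M joint n)"
    by (rule measurable_compose[OF measurable_snd measurable_tinfo_sum])
  have "{q \<in> space (cvol n \<Otimes>\<^sub>M joint n). snd q \<in> good_near n y (fst q)} = {q \<in> space (cvol n \<Otimes>\<^sub>M joint n).
     y \<le> (\<Sum>i<n. tinfo (fst (snd q) i) (snd (snd q) i)) \<and>
     (\<Sum>i<n. (cmod (fst (snd q) i * fst q i - snd (snd q) i))\<^sup>2) \<le> (\<Sum>i<n. (cmod (snd (snd q) i))\<^sup>2)}"
    by (auto simp: good_near_def near_def space_pair_measure)
  also have "\<dots> \<in> sets (cvol n \<Otimes>\<^sub>M joint n)" by measurable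
  finally show ?thesis .
qed

lemma sets_good_near[measurable]: "good_near n y x \<in> sets (joint n)"
proof -
  have x: "restrict x {..<n} \<in> space (cvol n)" by (simp add: space_cvol)
  have "Pair (restrict x {..<n}) -` {q \<in> space (cvol n \<Otimes>\<^sub>M joint n). snd q \<in> good_near n y (fst q)} \<in> sets (joint n)"
    by (rule sets_Pair1[OF sets_good_near_pair])
  also have "Pair (restrict x {..<n}) -` {q \<in> space (cvol n \<Otimes>\<^sub>M joint n). snd q \<in> good_near n y (fst q)} = good_near n y (restrict x {..<n})"
    using x by (auto simp: space_pair_measure good_near_def)
  also have "\<dots> = good_near n y x" by (rule good_near_cong) simp
  finally show ?thesis .
qed

lemma measurable_near_prob[measurable]: "near_prob n y \<in> borel_measurable (cvol n)"
proof -
  interpret J: prob_space "joint n" by (rule prob_space_joint)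
  have "(\<lambda>x. emeasure (joint n) (Pair x -` {q \<in> space (cvol n \<Otimes>\<^sub>M joint n). snd q \<in> good_near n y (fst q)})) \<in> borel_measurable (cvol n)"
    by (rule J.measurable_emeasure_Pair[OF sets_good_near_pair])
  then show ?thesis
    by (rule measurable_cong[THEN iffD1, rotated])
      (auto simp: near_prob_def space_pair_measure good_near_def intro!: arg_cong[where f="emeasure (joint n)"])
qed

text \<open>Integrate over the displacement first. For fixed fading and noise, the competing
  displacements fill a volume of at most 1 over the fading product times the noise density, which is
  the exponential of minus the information sum and hence at most \<open>exp (- y)\<close> on the
  counted event.\<close>

lemma nn_integral_near_prob_le:
  "(\<integral>\<^sup>+x. near_prob n y x \<partial>cvol n) \<le> ennreal (exp (- y))"
proof -
  interpret J: prob_space "joint n" by (rule prob_space_joint)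
  interpret V: sigma_finite_measure "cvol n" by (rule sigma_finite_cvol)
  interpret P: pair_sigma_finite "cvol n" "joint n" ..
  interpret H: prob_space "fade_vec n" by (intro prob_space_PiM prob_space_axioms)
  interpret G: prob_space "noise_vec n \<sigma>" by (rule prob_space_noise_vec[OF \<sigma>_pos])
  let ?U = "{q \<in> space (cvol n \<Otimes>\<^sub>M joint n). snd q \<in> good_near n y (fst q)}"
  have inner: "(\<integral>\<^sup>+x. indicator ?U (x, (h, z)) \<partial>cvol n) \<le> ennreal (exp (- y))"
    if h: "\<forall>i<n. h i \<noteq> 0" for h z
  proof (cases "y \<le> (\<Sum>i<n. tinfo (h i) (z i))")
    case True
    define Vh where "Vh = (\<Prod>i<n. (cmod (h i))\<^sup>2)"
    have Vh: "Vh > 0" unfolding Vh_def using h by (intro prod_pos) auto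
    have g: "gdens n \<sigma> z > 0" by (rule gdens_pos[OF \<sigma>_pos])
    let ?f = "indicator {x \<in> space (cvol n). near n h x z} :: _ \<Rightarrow> ennreal"
    have fm: "?f \<in> borel_measurable (cvol n)"
      unfolding near_def by measurable
    have "(\<integral>\<^sup>+x. indicator ?U (x, (h, z)) \<partial>cvol n) \<le> (\<integral>\<^sup>+x. ?f x \<partial>cvol n)"
      by (intro nn_integral_mono) (auto simp: indicator_def good_near_def)
    \<comment> \<open>The substitution \<open>x = (z + w) / h\<close> in each coordinate turns the
      condition into a ball condition on \<open>w\<close>; its Jacobian is the reciprocal fading
      product.\<close>
    also have "\<dots> = ennreal (\<Prod>i<n. (cmod (1 / h i))\<^sup>2) * (\<integral>\<^sup>+w. ?f (caff n (\<lambda>i. z i / h i) (\<lambda>i. 1 / h i) w) \<partial>cvol n)"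
      by (rule nn_integral_caff[OF fm]) (use h in auto)
    also have "(\<integral>\<^sup>+w. ?f (caff n (\<lambda>i. z i / h i) (\<lambda>i. 1 / h i) w) \<partial>cvol n)
       = (\<integral>\<^sup>+w. indicator {w \<in> space (cvol n). (\<Sum>i<n. (cmod (w i))\<^sup>2) \<le> (\<Sum>i<n. (cmod (z i))\<^sup>2)} w \<partial>cvol n)"
    proof (rule nn_integral_cong)
      fix w assume w: "w \<in> space (cvol n)"
      have "near n h (caff n (\<lambda>i. z i / h i) (\<lambda>i. 1 / h i) w) z \<longleftrightarrow> (\<Sum>i<n. (cmod (w i))\<^sup>2) \<le> (\<Sum>i<n. (cmod (z i))\<^sup>2)"
      proof -
        have "h i * caff n (\<lambda>i. z i / h i) (\<lambda>i. 1 / h i) w i - z i = w i" if "i < n" for i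
          using h that by (simp add: caff_def distrib_left)
        then show ?thesis by (simp add: near_def)
      qed
      then show "?f (caff n (\<lambda>i. z i / h i) (\<lambda>i. 1 / h i) w) = indicator {w \<in> space (cvol n). (\<Sum>i<n. (cmod (w i))\<^sup>2) \<le> (\<Sum>i<n. (cmod (z i))\<^sup>2)} w"
        using w measurable_space[OF measurable_caff w, of "\<lambda>i. z i / h i" "\<lambda>i. 1 / h i"] by (simp add: indicator_def)
    qed
    also have "\<dots> = emeasure (cvol n) {w \<in> space (cvol n). (\<Sum>i<n. (cmod (w i))\<^sup>2) \<le> (\<Sum>i<n. (cmod (z i))\<^sup>2)}"
      by (rule nn_integral_indicator) measurable
    also have "ennreal (\<Prod>i<n. (cmod (1 / h i))\<^sup>2) * \<dots> \<le> ennreal (\<Prod>i<n. (cmod (1 / h i))\<^sup>2) * ennreal (1 / gdens n \<sigma> z)"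
      by (intro mult_left_mono emeasure_gdens_superlevel_le[OF \<sigma>_pos]) simp
    also have "(\<Prod>i<n. (cmod (1 / h i))\<^sup>2) = 1 / Vh"
      by (simp add: Vh_def norm_divide power_divide prod_dividef)
    also have "ennreal (1 / Vh) * ennreal (1 / gdens n \<sigma> z) = ennreal (exp (- (\<Sum>i<n. tinfo (h i) (z i))))"
    proof -
      have "(\<Sum>i<n. tinfo (h i) (z i)) = ln (Vh * gdens n \<sigma> z)"
        unfolding Vh_def using h by (intro tinfo_sum_eq) auto
      then have "exp (- (\<Sum>i<n. tinfo (h i) (z i))) = 1 / (Vh * gdens n \<sigma> z)"
        using Vh g by (simp add: exp_minus inverse_eq_divide)
      then show ?thesis using Vh g by (simp add: ennreal_mult[symmetric])
    qed
    also have "\<dots> \<le> ennreal (exp (- y))" using True by (intro ennreal_leI) simp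
    finally show ?thesis .
  next
    case False
    then have "(\<integral>\<^sup>+x. indicator ?U (x, (h, z)) \<partial>cvol n) = (\<integral>\<^sup>+x. 0 \<partial>cvol n)"
      by (intro nn_integral_cong) (auto simp: indicator_def good_near_def)
    then show ?thesis by simp
  qed
  have Fm: "(\<lambda>p. \<integral>\<^sup>+x. indicator ?U (x, p) \<partial>cvol n) \<in> borel_measurable (joint n)"
  proof -
    have "(\<lambda>q. indicator ?U (case q of (p, x) \<Rightarrow> (x, p)) :: ennreal) \<in> borel_measurable (joint n \<Otimes>\<^sub>M cvol n)"
      by (rule measurable_compose[OF measurable_pair_swap' borel_measurable_indicator[OF sets_good_near_pair]])
    from V.borel_measurable_nn_integral_fst[OF this] show ?thesis by simp
  qed
  have "(\<integral>\<^sup>+x. near_prob n y x \<partial>cvol n) = (\<integral>\<^sup>+x. \<integral>\<^sup>+p. indicator ?U (x, p) \<partial>joint n \<partial>cvol n)"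
  proof (rule nn_integral_cong)
    fix x assume x: "x \<in> space (cvol n)"
    have "near_prob n y x = (\<integral>\<^sup>+p. indicator (good_near n y x) p \<partial>joint n)" by (simp add: near_prob_def)
    also have "\<dots> = (\<integral>\<^sup>+p. indicator ?U (x, p) \<partial>joint n)"
      using x by (intro nn_integral_cong) (auto simp: indicator_def space_pair_measure)
    finally show "near_prob n y x = (\<integral>\<^sup>+p. indicator ?U (x, p) \<partial>joint n)" .
  qed
  also have "\<dots> = (\<integral>\<^sup>+p. \<integral>\<^sup>+x. indicator ?U (x, p) \<partial>cvol n \<partial>joint n)"
    using borel_measurable_indicator[OF sets_good_near_pair[of n y]] by (intro P.Fubini'[symmetric]) (simp add: split_beta')
  also have "\<dots> = (\<integral>\<^sup>+h. \<integral>\<^sup>+z. \<integral>\<^sup>+x. indicator ?U (x, (h, z)) \<partial>cvol n \<partial>noise_vec n \<sigma> \<partial>fade_vec n)"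
    using Fm unfolding joint_def by (subst G.nn_integral_fst) auto
  also have "\<dots> \<le> (\<integral>\<^sup>+h. \<integral>\<^sup>+z. ennreal (exp (- y)) \<partial>noise_vec n \<sigma> \<partial>fade_vec n)"
  proof (rule nn_integral_mono_AE)
    show "AE h in fade_vec n. (\<integral>\<^sup>+z. \<integral>\<^sup>+x. indicator ?U (x, (h, z)) \<partial>cvol n \<partial>noise_vec n \<sigma>) \<le> (\<integral>\<^sup>+z. ennreal (exp (- y)) \<partial>noise_vec n \<sigma>)"
      using AE_fade_nz by eventually_elim (intro nn_integral_mono inner)
  qed
  also have "\<dots> = ennreal (exp (- y))" by (simp add: G.emeasure_space_1 H.emeasure_space_1)
  finally show ?thesis .
qed

text \<open>Union bound for the event that the information sum reaches \<open>y\<close> and some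
  point congruent to \<open>v\<close> competes with the sent point \<open>u\<close>.\<close>

definition pair_conf :: "nat \<Rightarrow> real \<Rightarrow> real \<Rightarrow> point \<Rightarrow> point \<Rightarrow> ennreal" where
  "pair_conf n y L u v = (\<integral>\<^sup>+\<kappa>. near_prob n y (\<lambda>i. v i - u i + of_real L * \<kappa> i) \<partial>count_space (glattice n))"

lemma pair_conf_fst: "pair_conf n y L u x = (\<integral>\<^sup>+\<kappa>. (\<lambda>x. near_prob n y (caff n (\<lambda>i. - u i) (\<lambda>_. 1) x)) (tplus n L \<kappa> x) \<partial>count_space (glattice n))"
  unfolding pair_conf_def by (intro nn_integral_cong near_prob_cong) (auto simp: caff_def)

text \<open>The lattice is symmetric under negation, so in its first argument, too, the sum is a
  periodisation, now of the reflected \<open>near_prob\<close>. Hence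
  \<open>nn_integral_fcube_periodized_le\<close> serves both roles of a point.\<close>

lemma pair_conf_snd: "pair_conf n y L x u = (\<integral>\<^sup>+\<kappa>. (\<lambda>x. near_prob n y (caff n u (\<lambda>_. - 1) x)) (tplus n L \<kappa> x) \<partial>count_space (glattice n))"
proof -
  have "pair_conf n y L x u = (\<integral>\<^sup>+\<kappa>. near_prob n y (\<lambda>i. u i - x i + of_real L * (- \<kappa> i)) \<partial>count_space (glattice n))"
    unfolding pair_conf_def by (rule nn_integral_glattice_uminus[where f="\<lambda>\<kappa>. near_prob n y (\<lambda>i. u i - x i + of_real L * \<kappa> i)", symmetric])
  also have "\<dots> = (\<integral>\<^sup>+\<kappa>. (\<lambda>x. near_prob n y (caff n u (\<lambda>_. - 1) x)) (tplus n L \<kappa> x) \<partial>count_space (glattice n))"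
    by (intro nn_integral_cong near_prob_cong) (auto simp: caff_def)
  finally show ?thesis .
qed

lemma measurable_pair_conf[measurable]: "pair_conf n y L u \<in> borel_measurable (cvol n)" "(\<lambda>x. pair_conf n y L x u) \<in> borel_measurable (cvol n)"
proof -
  show "pair_conf n y L u \<in> borel_measurable (cvol n)"
    unfolding pair_conf_fst by (intro borel_measurable_nn_integral_count_space countable_glattice) measurable
  show "(\<lambda>x. pair_conf n y L x u) \<in> borel_measurable (cvol n)"
    unfolding pair_conf_snd by (intro borel_measurable_nn_integral_count_space countable_glattice) measurable
qed

lemma nn_integral_pair_conf_le:
  assumes L: "L > 0"
  shows "(\<integral>\<^sup>+x. (pair_conf n y L u x + pair_conf n y L x u) * indicator (fcube n L) x \<partial>cvol n) \<le> ennreal (2 * exp (- y))"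
proof -
  have 1: "(\<integral>\<^sup>+x. pair_conf n y L u x * indicator (fcube n L) x \<partial>cvol n) \<le> ennreal (exp (- y))"
  proof -
    have "(\<integral>\<^sup>+x. pair_conf n y L u x * indicator (fcube n L) x \<partial>cvol n) \<le> (\<integral>\<^sup>+x. near_prob n y (caff n (\<lambda>i. - u i) (\<lambda>_. 1) x) \<partial>cvol n)"
      unfolding pair_conf_fst by (intro nn_integral_fcube_periodized_le[OF L]) measurable
    also have "\<dots> = (\<integral>\<^sup>+x. near_prob n y x \<partial>cvol n)" using nn_integral_caff[OF measurable_near_prob, of n "\<lambda>_. 1" y "\<lambda>i. - u i"] by simp
    finally show ?thesis using nn_integral_near_prob_le[of n y] by simp
  qed
  have 2: "(\<integral>\<^sup>+x. pair_conf n y L x u * indicator (fcube n L) x \<partial>cvol n) \<le> ennreal (exp (- y))"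
  proof -
    have "(\<integral>\<^sup>+x. pair_conf n y L x u * indicator (fcube n L) x \<partial>cvol n) \<le> (\<integral>\<^sup>+x. near_prob n y (caff n u (\<lambda>_. - 1) x) \<partial>cvol n)"
      unfolding pair_conf_snd by (intro nn_integral_fcube_periodized_le[OF L]) measurable
    also have "\<dots> = (\<integral>\<^sup>+x. near_prob n y x \<partial>cvol n)" using nn_integral_caff[OF measurable_near_prob, of n "\<lambda>_. - 1" y u] by simp
    finally show ?thesis using nn_integral_near_prob_le[of n y] by simp
  qed
  have "(\<integral>\<^sup>+x. (pair_conf n y L u x + pair_conf n y L x u) * indicator (fcube n L) x \<partial>cvol n)
     = (\<integral>\<^sup>+x. pair_conf n y L u x * indicator (fcube n L) x \<partial>cvol n) + (\<integral>\<^sup>+x. pair_conf n y L x u * indicator (fcube n L) x \<partial>cvol n)"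
    unfolding distrib_right by (rule nn_integral_add) measurable
  also have "\<dots> \<le> ennreal (exp (- y)) + ennreal (exp (- y))" using 1 2 by (rule add_mono)
  also have "\<dots> = ennreal (2 * exp (- y))" by (simp flip: ennreal_plus)
  finally show ?thesis .
qed

text \<open>One factor 2 comes from the two orders of a pair, the other from the slack in
  \<open>greedy_codebook\<close>; bounding each index \<open>k\<close> by \<open>M\<close> gives the
  square.\<close>

lemma exists_codebook:
  assumes n: "n \<ge> 1" and L: "L > 0"
  shows "\<exists>\<omega>. incongruent n L M \<omega> \<and>
    (\<Sum>j<M. \<Sum>k\<in>{..<M} - {j}. pair_conf n y L (\<omega> j) (\<omega> k)) \<le> ennreal (4 * exp (- y) * (real M)\<^sup>2 / L ^ (2 * n))"
proof -
  have "\<exists>\<omega>. \<forall>k<M. \<omega> k \<in> space (cvol n) \<and> (\<forall>j<k. \<not> lcong n L (\<omega> j) (\<omega> k)) \<and>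
      (\<Sum>j<k. pair_conf n y L (\<omega> j) (\<omega> k) + pair_conf n y L (\<omega> k) (\<omega> j)) \<le> ennreal (2 * real k * (2 * exp (- y)) / L ^ (2 * n))"
    by (rule greedy_codebook[OF n L]) (use nn_integral_pair_conf_le[OF L] in auto)
  then obtain \<omega> where \<omega>: "\<And>k. k < M \<Longrightarrow> (\<forall>j<k. \<not> lcong n L (\<omega> j) (\<omega> k)) \<and>
      (\<Sum>j<k. pair_conf n y L (\<omega> j) (\<omega> k) + pair_conf n y L (\<omega> k) (\<omega> j)) \<le> ennreal (2 * real k * (2 * exp (- y)) / L ^ (2 * n))"
    by blast
  have "(\<Sum>j<M. \<Sum>k\<in>{..<M} - {j}. pair_conf n y L (\<omega> j) (\<omega> k)) = (\<Sum>k<M. \<Sum>j<k. pair_conf n y L (\<omega> j) (\<omega> k) + pair_conf n y L (\<omega> k) (\<omega> j))"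
    by (rule sum_pairs_offdiag)
  also have "\<dots> \<le> (\<Sum>k<M. ennreal (4 * exp (- y) * real M / L ^ (2 * n)))"
  proof (rule sum_mono)
    fix k assume "k \<in> {..<M}"
    then have k: "k < M" by simp
    have "(\<Sum>j<k. pair_conf n y L (\<omega> j) (\<omega> k) + pair_conf n y L (\<omega> k) (\<omega> j)) \<le> ennreal (2 * real k * (2 * exp (- y)) / L ^ (2 * n))"
      using \<omega>[OF k] by blast
    also have "\<dots> \<le> ennreal (4 * exp (- y) * real M / L ^ (2 * n))"
      using k L by (intro ennreal_leI divide_right_mono) auto
    finally show "(\<Sum>j<k. pair_conf n y L (\<omega> j) (\<omega> k) + pair_conf n y L (\<omega> k) (\<omega> j)) \<le> ennreal (4 * exp (- y) * real M / L ^ (2 * n))" .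
  qed
  also have "\<dots> = ennreal (4 * exp (- y) * (real M)\<^sup>2 / L ^ (2 * n))"
    using L by (simp add: ennreal_of_nat_eq_real_of_nat ennreal_mult[symmetric] power2_eq_square mult_ac)
  finally show ?thesis using \<omega> unfolding incongruent_def by blast
qed

end

section \<open>Cardinality and density of periodic constellations\<close>

definition pcode :: "nat \<Rightarrow> real \<Rightarrow> nat \<Rightarrow> (nat \<Rightarrow> point) \<Rightarrow> point set" where
  "pcode n L M \<omega> = {x \<in> cvec n. \<exists>j<M. lcong n L (\<omega> j) x}"

lemma is_IC_pcode: "is_IC n (pcode n L M \<omega>)"
proof -
  have "pcode n L M \<omega> \<subseteq> (\<Union>j<M. (\<lambda>\<kappa> i. if i < n then \<omega> j i + of_real L * \<kappa> i else 0) ` glattice n)"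
  proof
    fix x assume "x \<in> pcode n L M \<omega>"
    then obtain j \<kappa> where x: "x \<in> cvec n" "j < M" "\<kappa> \<in> glattice n" "\<forall>i<n. x i = \<omega> j i + of_real L * \<kappa> i"
      by (auto simp: pcode_def lcong_def)
    have "x = (\<lambda>i. if i < n then \<omega> j i + of_real L * \<kappa> i else 0)" using x by (auto simp: cvec_def fun_eq_iff)
    then show "x \<in> (\<Union>j<M. (\<lambda>\<kappa> i. if i < n then \<omega> j i + of_real L * \<kappa> i else 0) ` glattice n)" using x by blast
  qed
  moreover have "countable (\<Union>j<M. (\<lambda>\<kappa> i. if i < n then \<omega> j i + of_real L * \<kappa> i else 0) ` glattice n)"
    using countable_glattice by (intro countable_UN) auto
  ultimately show ?thesis unfolding is_IC_def using countable_subset by (auto simp: pcode_def)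
qed

lemma pcode_Int_Cb: "pcode n L M \<omega> \<inter> Cb n a = (\<Union>j<M. {x \<in> Cb n a. lcong n L (\<omega> j) x})"
  by (auto simp: pcode_def Cb_def)

lemma finite_pcode_Cb:
  assumes L: "L > 0" shows "finite (pcode n L M \<omega> \<inter> Cb n a)"
proof -
  have "finite {x \<in> Cb n (max a L). lcong n L (\<omega> j) x}" for j
    by (rule card_lattice_class_cube(1)[OF L]) simp
  then have "finite (pcode n L M \<omega> \<inter> Cb n (max a L))" unfolding pcode_Int_Cb by blast
  moreover have "Cb n a \<subseteq> Cb n (max a L)" by (force simp: Cb_def)
  ultimately show ?thesis by (meson Int_mono finite_subset order_refl)
qed

lemma lcong_trans2:
  assumes "lcong n L u x" "lcong n L v x" shows "lcong n L u v"
proof -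
  obtain \<kappa> \<mu> where k: "\<kappa> \<in> glattice n" "\<forall>i<n. x i = u i + of_real L * \<kappa> i" "\<mu> \<in> glattice n" "\<forall>i<n. x i = v i + of_real L * \<mu> i"
    using assms by (auto simp: lcong_def)
  have "\<forall>i<n. v i = u i + of_real L * (\<kappa> i - \<mu> i)"
  proof (intro allI impI)
    fix i assume "i < n"
    then have e: "u i + of_real L * \<kappa> i = v i + of_real L * \<mu> i" using k by metis
    show "v i = u i + of_real L * (\<kappa> i - \<mu> i)" by (simp add: right_diff_distrib add_diff_eq e)
  qed
  then show ?thesis unfolding lcong_def by (rule bexI[OF _ glattice_diff[OF k(1,3)]])
qed

lemma pcode_classes_disjoint:
  fixes M j k :: nat
  assumes nc: "incongruent n L M \<omega>" and jk: "j < M" "k < M" "j \<noteq> k"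
  shows "{x \<in> Cb n a. lcong n L (\<omega> j) x} \<inter> {x \<in> Cb n a. lcong n L (\<omega> k) x} = {}"
proof -
  have "\<not> (lcong n L (\<omega> j) x \<and> lcong n L (\<omega> k) x)" for x
  proof (cases j k rule: linorder_cases)
    case less
    then show ?thesis using nc jk(2) less lcong_trans2[of n L "\<omega> j" x "\<omega> k"] unfolding incongruent_def by blast
  next
    case greater
    then show ?thesis using nc jk(1) greater lcong_trans2[of n L "\<omega> k" x "\<omega> j"] unfolding incongruent_def by blast
  qed (use jk in simp)
  then show ?thesis by auto
qed

lemma card_pcode_Cb:
  assumes L: "L > 0" and a: "a \<ge> L" and nc: "incongruent n L M \<omega>"
  shows "card (pcode n L M \<omega> \<inter> Cb n a) = (\<Sum>j<M. card {x \<in> Cb n a. lcong n L (\<omega> j) x})"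
    and "real (card (pcode n L M \<omega> \<inter> Cb n a)) \<ge> real M * (a / L - 1) ^ (2 * n)"
proof -
  have dj: "\<And>j k. j < M \<Longrightarrow> k < M \<Longrightarrow> j \<noteq> k \<Longrightarrow> {x \<in> Cb n a. lcong n L (\<omega> j) x} \<inter> {x \<in> Cb n a. lcong n L (\<omega> k) x} = {}"
    by (rule pcode_classes_disjoint[OF nc])
  show 1: "card (pcode n L M \<omega> \<inter> Cb n a) = (\<Sum>j<M. card {x \<in> Cb n a. lcong n L (\<omega> j) x})"
    unfolding pcode_Int_Cb
    by (rule card_UN_disjoint) (simp, use card_lattice_class_cube(1)[OF L a] in blast, use dj in blast)
  have "real M * (a / L - 1) ^ (2 * n) = (\<Sum>j<M. (a / L - 1) ^ (2 * n))" by simp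
  also have "\<dots> \<le> (\<Sum>j<M. real (card {x \<in> Cb n a. lcong n L (\<omega> j) x}))"
    by (intro sum_mono card_lattice_class_cube(3)[OF L a])
  finally show "real (card (pcode n L M \<omega> \<inter> Cb n a)) \<ge> real M * (a / L - 1) ^ (2 * n)" unfolding 1 by simp
qed

lemma tendsto_ratio_minus_one:
  assumes L: "L > (0::real)"
  shows "((\<lambda>a. (a / L - 1) / a) \<longlongrightarrow> 1 / L) at_top" "((\<lambda>a. (a / L + 1) / a) \<longlongrightarrow> 1 / L) at_top"
proof -
  have i: "((\<lambda>a::real. inverse a) \<longlongrightarrow> 0) at_top" by (rule tendsto_inverse_0_at_top[OF filterlim_ident])
  have "((\<lambda>a. 1 / L - inverse a) \<longlongrightarrow> 1 / L - 0) at_top" "((\<lambda>a. 1 / L + inverse a) \<longlongrightarrow> 1 / L + 0) at_top"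
    by (intro tendsto_intros i)+
  moreover have "\<forall>\<^sub>F a in at_top. 1 / L - inverse a = (a / L - 1) / a" "\<forall>\<^sub>F a in at_top. 1 / L + inverse a = (a / L + 1) / a"
    using eventually_gt_at_top[of 0] by (eventually_elim, simp add: field_simps)+
  ultimately show "((\<lambda>a. (a / L - 1) / a) \<longlongrightarrow> 1 / L) at_top" "((\<lambda>a. (a / L + 1) / a) \<longlongrightarrow> 1 / L) at_top"
    using tendsto_cong by force+
qed

text \<open>Classes need not have equally many points in a cube, but for large cubes the upper and
  lower counts differ by a factor of at most 2. This bounds the weight of a class in the average by
  \<open>2 / M\<close>.\<close>

lemma eventually_ratio_le_2:
  assumes L: "L > (0::real)"
  shows "\<forall>\<^sub>F a in at_top. (a / L + 1) ^ (2 * n) \<le> 2 * (a / L - 1) ^ (2 * n)"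
proof -
  have "((\<lambda>a. (((a / L + 1) / a) / ((a / L - 1) / a)) ^ (2 * n)) \<longlongrightarrow> ((1 / L) / (1 / L)) ^ (2 * n)) at_top"
    by (intro tendsto_intros tendsto_ratio_minus_one[OF L]) (use L in auto)
  then have "\<forall>\<^sub>F a in at_top. (((a / L + 1) / a) / ((a / L - 1) / a)) ^ (2 * n) < 2"
    by (rule order_tendstoD) (use L in simp)
  then show ?thesis using eventually_gt_at_top[of L]
  proof eventually_elim
    case (elim a)
    have a: "a > 0" "a / L - 1 > 0" using elim L by (auto simp: field_simps)
    have "((a / L + 1) / (a / L - 1)) ^ (2 * n) < 2" using elim a by simp
    then show ?case using a by (simp add: power_divide divide_less_eq less_imp_le)
  qed
qed

lemma IC_density_pcode_ge:
  assumes L: "L > 0" and nc: "incongruent n L M \<omega>"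
  shows "IC_density n (pcode n L M \<omega>) \<ge> ereal (real M / L ^ (2 * n))"
proof -
  have "((\<lambda>a. real M * ((a / L - 1) / a) ^ (2 * n)) \<longlongrightarrow> real M * (1 / L) ^ (2 * n)) at_top"
    by (intro tendsto_intros tendsto_ratio_minus_one[OF L])
  then have "((\<lambda>a. ereal (real M * ((a / L - 1) / a) ^ (2 * n))) \<longlongrightarrow> ereal (real M / L ^ (2 * n))) at_top"
    by (simp add: power_divide)
  then have "ereal (real M / L ^ (2 * n)) = Limsup at_top (\<lambda>a. ereal (real M * ((a / L - 1) / a) ^ (2 * n)))"
    by (intro lim_imp_Limsup[symmetric]) auto
  also have "\<dots> \<le> IC_density n (pcode n L M \<omega>)"
    unfolding IC_density_def
  proof (rule Limsup_mono)
    show "\<forall>\<^sub>F a in at_top. ereal (real M * ((a / L - 1) / a) ^ (2 * n)) \<le> ecount (pcode n L M \<omega> \<inter> Cb n a) / ereal (a ^ (2 * n))"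
      using eventually_ge_at_top[of L] 
    proof eventually_elim
      case (elim a)
      have a: "a > 0" using elim L by simp
      have "real M * ((a / L - 1) / a) ^ (2 * n) = real M * (a / L - 1) ^ (2 * n) / a ^ (2 * n)" by (simp add: power_divide)
      also have "\<dots> \<le> real (card (pcode n L M \<omega> \<inter> Cb n a)) / a ^ (2 * n)"
        using a by (intro divide_right_mono card_pcode_Cb(2)[OF L elim nc]) auto
      finally show ?case using finite_pcode_Cb[OF L] a by (simp add: ecount_def)
    qed
  qed
  finally show ?thesis .
qed

lemma NLD_pcode_ge:
  assumes n: "n \<ge> 1" and L: "L > 0" and M: "M \<ge> 1" and nc: "incongruent n L M \<omega>"
    and d: "real M / L ^ (2 * n) = exp (real n * \<delta>)"
  shows "NLD n (pcode n L M \<omega>) \<ge> ereal \<delta>"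
proof -
  have ge: "IC_density n (pcode n L M \<omega>) \<ge> ereal (exp (real n * \<delta>))"
    unfolding d[symmetric] by (rule IC_density_pcode_ge[OF L nc])
  show ?thesis
  proof (cases "IC_density n (pcode n L M \<omega>)")
    case (real g)
    then have g: "exp (real n * \<delta>) \<le> g" using ge by simp
    then have "ln (exp (real n * \<delta>)) \<le> ln g" by (intro ln_mono) (auto intro: less_le_trans[OF exp_gt_zero])
    moreover have "g > 0" using g exp_gt_zero less_le_trans by blast
    ultimately show ?thesis using real n by (simp add: NLD_def Let_def field_simps)
  qed (use ge in \<open>auto simp: NLD_def Let_def\<close>)
qed

section \<open>Error probability of periodic constellations\<close>

context fading_channel begin

definition bad_set :: "nat \<Rightarrow> real \<Rightarrow> (point \<times> point) set" where
  "bad_set n y = {p \<in> space (joint n). (\<Sum>i<n. tinfo (fst p i) (snd p i)) < y}"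

text \<open>A translate of the sent point can beat it only if \<open>L * cmod (h i)\<close> is at
  most twice the noise norm for some \<open>i\<close>, and then \<open>L\<close> is at most this
  sum. It is independent of \<open>L\<close>, so its tail can be made small by choosing the
  period.\<close>

definition reach :: "nat \<Rightarrow> (point \<times> point) \<Rightarrow> real" where
  "reach n p = (\<Sum>i<n. 2 * sqrt (\<Sum>i<n. (cmod (snd p i))\<^sup>2) / cmod (fst p i))"

definition self_set :: "nat \<Rightarrow> real \<Rightarrow> (point \<times> point) set" where
  "self_set n L = {p \<in> space (joint n). L \<le> reach n p}"

lemma measurable_reach[measurable]: "reach n \<in> borel_measurable (joint n)"
  unfolding reach_def by measurable

lemma sets_bad_self[measurable]: "bad_set n y \<in> sets (joint n)" "self_set n L \<in> sets (joint n)"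
  unfolding bad_set_def self_set_def by measurable

definition slice :: "nat \<Rightarrow> (point \<times> point) set \<Rightarrow> point \<Rightarrow> ennreal" where
  "slice n A h = emeasure (noise_vec n \<sigma>) (Pair h -` A)"

lemma measurable_slice: "A \<in> sets (joint n) \<Longrightarrow> slice n A \<in> borel_measurable (fade_vec n)"
  unfolding slice_def by (rule emeasure_joint(2))

lemma nn_integral_slice: "A \<in> sets (joint n) \<Longrightarrow> (\<integral>\<^sup>+h. slice n A h \<partial>fade_vec n) = emeasure (joint n) A"
  unfolding slice_def by (rule emeasure_joint(1)[symmetric])

text \<open>Conditional on the fading, the error contributions of other classes and of the own
  translates, without the bad event, which is common to all classes.\<close>

definition confusion :: "nat \<Rightarrow> real \<Rightarrow> real \<Rightarrow> nat \<Rightarrow> (nat \<Rightarrow> point) \<Rightarrow> nat \<Rightarrow> point \<Rightarrow> ennreal" where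
  "confusion n y L M \<omega> j h =
    (\<Sum>k\<in>{..<M} - {j}. \<integral>\<^sup>+\<kappa>. slice n (good_near n y (\<lambda>i. \<omega> k i - \<omega> j i + of_real L * \<kappa> i)) h \<partial>count_space (glattice n))
     + slice n (self_set n L) h"

lemma reach_ge:
  assumes h: "h i \<noteq> 0" and i: "i < n" and le: "L * cmod (h i) \<le> 2 * sqrt (\<Sum>i<n. (cmod (z i))\<^sup>2)"
  shows "L \<le> reach n (h, z)"
proof -
  have "L \<le> 2 * sqrt (\<Sum>i<n. (cmod (z i))\<^sup>2) / cmod (h i)" using le h by (simp add: pos_le_divide_eq)
  also have "\<dots> \<le> reach n (h, z)" unfolding reach_def fst_conv snd_conv
    by (rule member_le_sum[of i "{..<n}" "\<lambda>i. 2 * sqrt (\<Sum>i<n. (cmod (z i))\<^sup>2) / cmod (h i)"]) (use i in \<open>auto simp: sum_nonneg\<close>)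
  finally show ?thesis .
qed

text \<open>By periodicity the competitors seen from \<open>x\<close> depend only on its class, so
  the bound involves \<open>j\<close> alone. A closer competitor from another class falls under the
  bad event or under \<open>good_near\<close>, one from the own class under
  \<open>self_set\<close>.\<close>

lemma point_err_pcode_le:
  assumes hs: "h \<in> space (fade_vec n)" and h: "\<forall>i<n. h i \<noteq> 0" and L: "L > 0" and j: "j < M"
    and x: "lcong n L (\<omega> j) x"
  shows "point_err n \<sigma> (chan n h ` pcode n L M \<omega>) (chan n h x) \<le> slice n (bad_set n y) h + confusion n y L M \<omega> j h"
proof -
  let ?G = "noise_vec n \<sigma>"
  let ?T = "chan n h ` pcode n L M \<omega>"
  let ?GN = "\<lambda>k \<kappa>. Pair h -` good_near n y (\<lambda>i. \<omega> k i - \<omega> j i + of_real L * \<kappa> i)"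
  let ?Err = "{z \<in> space ?G. (\<lambda>i. chan n h x i + z i) \<notin> voronoi n ?T (chan n h x)}"
  let ?U = "\<Union>k\<in>{..<M} - {j}. \<Union>\<kappa>\<in>glattice n. ?GN k \<kappa>"
  have sl: "Pair h -` A \<in> sets ?G" if "A \<in> sets (joint n)" for A
    using that unfolding joint_def by (rule sets_Pair1)
  have inj: "(h, z) \<in> space (joint n)" if "z \<in> space ?G" for z
    using hs that by (simp add: joint_def space_pair_measure)
  have sub: "?Err \<subseteq> Pair h -` bad_set n y \<union> ?U \<union> Pair h -` self_set n L"
  proof
    fix z assume "z \<in> ?Err"
    then have z: "z \<in> space ?G" and "(\<lambda>i. chan n h x i + z i) \<notin> voronoi n ?T (chan n h x)" by auto
    then obtain x' where x': "x' \<in> pcode n L M \<omega>"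
      and lt: "\<not> cdist n (\<lambda>i. chan n h x i + z i) (chan n h x) \<le> cdist n (\<lambda>i. chan n h x i + z i) (chan n h x')"
      by (auto simp: voronoi_def)
    obtain k \<kappa>' where k: "k < M" "\<kappa>' \<in> glattice n" "\<forall>i<n. x' i = \<omega> k i + of_real L * \<kappa>' i"
      using x' by (auto simp: pcode_def lcong_def)
    obtain \<kappa> where \<kappa>: "\<kappa> \<in> glattice n" "\<forall>i<n. x i = \<omega> j i + of_real L * \<kappa> i"
      using x by (auto simp: lcong_def)
    define d where "d i = \<omega> k i - \<omega> j i + of_real L * (\<kappa>' i - \<kappa> i)" for i
    have dk: "(\<lambda>i. \<kappa>' i - \<kappa> i) \<in> glattice n" by (rule glattice_diff[OF k(2) \<kappa>(1)])
    have e: "cmod (chan n h x i + z i - chan n h x' i) = cmod (h i * d i - z i)" if "i < n" for i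
    proof -
      have "chan n h x i + z i - chan n h x' i = - (h i * d i - z i)"
        using that k \<kappa> by (simp add: chan_def d_def algebra_simps)
      then show ?thesis by (simp only: norm_minus_cancel)
    qed
    have lt2: "(\<Sum>i<n. (cmod (h i * d i - z i))\<^sup>2) < (\<Sum>i<n. (cmod (z i))\<^sup>2)"
      using lt unfolding cdist_le_iff not_le by (simp add: e)
    show "z \<in> Pair h -` bad_set n y \<union> ?U \<union> Pair h -` self_set n L"
    proof (cases "k = j")
      case False
      have nr: "near n h d z" using lt2 by (simp add: near_def)
      show ?thesis
      proof (cases "(\<Sum>i<n. tinfo (h i) (z i)) < y")
        case True
        then show ?thesis using inj[OF z] by (simp add: bad_set_def)
      next
        case False
        then have "z \<in> ?GN k (\<lambda>i. \<kappa>' i - \<kappa> i)" using inj[OF z] nr by (simp add: good_near_def d_def[abs_def])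
        then show ?thesis using dk k \<open>k \<noteq> j\<close> by blast
      qed
    next
      case True
      then have d: "d i = of_real L * (\<kappa>' i - \<kappa> i)" for i by (simp add: d_def)
      \<comment> \<open>A strictly closer competitor cannot have displacement zero.\<close>
      have "\<exists>i<n. d i \<noteq> 0"
      proof (rule ccontr)
        assume "\<not> ?thesis"
        then have "(\<Sum>i<n. (cmod (h i * d i - z i))\<^sup>2) = (\<Sum>i<n. (cmod (z i))\<^sup>2)" by (intro sum.cong) auto
        with lt2 show False by simp
      qed
      then obtain i where i: "i < n" "d i \<noteq> 0" by blast
      \<comment> \<open>A nonzero Gaussian integer has modulus at least 1, so after fading the
        competitor is displaced by at least \<open>L * cmod (h i)\<close> in this coordinate,
        although both points lie within the noise norm of the received one.\<close>
      have "\<kappa>' i - \<kappa> i \<in> gaussint" "\<kappa>' i - \<kappa> i \<noteq> 0" using dk i d by (auto simp: glattice_def)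
      then have "cmod (\<kappa>' i - \<kappa> i) \<ge> 1" by (rule gaussint_norm_ge_1)
      then have "L * cmod (h i) \<le> cmod (h i * d i)"
        using L mult_left_mono[of 1 "cmod (\<kappa>' i - \<kappa> i)" "L * cmod (h i)"] by (simp add: d norm_mult mult_ac)
      also have "\<dots> \<le> cmod (h i * d i - z i) + cmod (z i)" using norm_triangle_ineq[of "h i * d i - z i" "z i"] by simp
      also have "\<dots> \<le> sqrt (\<Sum>i<n. (cmod (z i))\<^sup>2) + sqrt (\<Sum>i<n. (cmod (z i))\<^sup>2)"
      proof (rule add_mono)
        have "(cmod (h i * d i - z i))\<^sup>2 \<le> (\<Sum>i<n. (cmod (h i * d i - z i))\<^sup>2)"
          using i by (intro member_le_sum[of i "{..<n}" "\<lambda>i. (cmod (h i * d i - z i))\<^sup>2"]) auto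
        then show "cmod (h i * d i - z i) \<le> sqrt (\<Sum>i<n. (cmod (z i))\<^sup>2)" using lt2 by (intro real_le_rsqrt) simp
        have "(cmod (z i))\<^sup>2 \<le> (\<Sum>i<n. (cmod (z i))\<^sup>2)"
          using i by (intro member_le_sum[of i "{..<n}" "\<lambda>i. (cmod (z i))\<^sup>2"]) auto
        then show "cmod (z i) \<le> sqrt (\<Sum>i<n. (cmod (z i))\<^sup>2)" by (intro real_le_rsqrt)
      qed
      finally have "L \<le> reach n (h, z)" using h i by (intro reach_ge[of h i]) auto
      then show ?thesis using inj[OF z] by (simp add: self_set_def)
    qed
  qed
  have Um: "(\<Union>\<kappa>\<in>glattice n. ?GN k \<kappa>) \<in> sets ?G" for k
    by (intro sets.countable_UN'' countable_glattice sl sets_good_near)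
  have "point_err n \<sigma> ?T (chan n h x) \<le> emeasure ?G (Pair h -` bad_set n y \<union> ?U \<union> Pair h -` self_set n L)"
    unfolding point_err_def using sub Um by (intro emeasure_mono) (auto intro!: sets.Un sl)
  also have "\<dots> \<le> emeasure ?G (Pair h -` bad_set n y) + emeasure ?G ?U + emeasure ?G (Pair h -` self_set n L)"
    using Um by (intro order_trans[OF emeasure_subadditive] add_mono order_refl) (auto intro!: sets.Un sl)
  also have "emeasure ?G ?U \<le> (\<Sum>k\<in>{..<M} - {j}. emeasure ?G (\<Union>\<kappa>\<in>glattice n. ?GN k \<kappa>))"
    using Um by (intro emeasure_subadditive_finite) auto
  also have "\<dots> \<le> (\<Sum>k\<in>{..<M} - {j}. \<integral>\<^sup>+\<kappa>. emeasure ?G (?GN k \<kappa>) \<partial>count_space (glattice n))"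
    by (intro sum_mono emeasure_UN_le_nn_integral_count_space countable_glattice sl sets_good_near)
  finally show ?thesis by (simp add: confusion_def slice_def add_mono add.assoc)
qed

text \<open>The cube average weights class \<open>j\<close> by its share of the points, at most
  \<open>2 / M\<close>. This factor is affordable for the confusion terms only.\<close>

lemma avg_err_pcode_le:
  assumes hs: "h \<in> space (fade_vec n)" and h: "\<forall>i<n. h i \<noteq> 0" and L: "L > 0" and M: "M \<ge> 1" and a: "a > L"
    and ratio: "(a / L + 1) ^ (2 * n) \<le> 2 * (a / L - 1) ^ (2 * n)"
    and nc: "incongruent n L M \<omega>"
  shows "avg_err n \<sigma> (chan n h ` pcode n L M \<omega>) (chan n h ` pcode n L M \<omega> \<inter> chan n h ` Cb n a)
    \<le> slice n (bad_set n y) h + ennreal (2 / real M) * (\<Sum>j<M. confusion n y L M \<omega> j h)"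
proof -
  let ?S = "pcode n L M \<omega>"
  define A where "A j = {x \<in> Cb n a. lcong n L (\<omega> j) x}" for j
  define e where "e = slice n (bad_set n y) h"
  define r where "r j = confusion n y L M \<omega> j h" for j
  define c where "c = card (?S \<inter> Cb n a)"
  have aL: "a \<ge> L" using a by simp
  have h': "\<And>i. i < n \<Longrightarrow> h i \<noteq> 0" using h by blast
  have Ssub: "?S \<subseteq> cvec n" by (auto simp: pcode_def)
  have im: "chan n h ` ?S \<inter> chan n h ` Cb n a = chan n h ` (?S \<inter> Cb n a)" by (rule chan_image_cube[OF h' Ssub])
  have inj: "inj_on (chan n h) (?S \<inter> Cb n a)" by (rule inj_on_subset[OF chan_inj_on_cvec[OF h']]) (use Ssub in auto)
  have fA: "finite (A j)" for j unfolding A_def by (rule card_lattice_class_cube(1)[OF L aL])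
  have dj: "\<And>j k. j < M \<Longrightarrow> k < M \<Longrightarrow> j \<noteq> k \<Longrightarrow> A j \<inter> A k = {}"
    unfolding A_def by (rule pcode_classes_disjoint[OF nc])
  have fin: "finite (?S \<inter> Cb n a)" by (rule finite_pcode_Cb[OF L])
  have cS: "c = (\<Sum>j<M. card (A j))" unfolding c_def A_def by (rule card_pcode_Cb(1)[OF L aL nc])
  have cge: "real c \<ge> real M * (a / L - 1) ^ (2 * n)" unfolding c_def by (rule card_pcode_Cb(2)[OF L aL nc])
  have q: "a / L - 1 > 0" using a L by simp
  have cpos: "c > 0"
  proof -
    have "real M * (a / L - 1) ^ (2 * n) > 0" using q M by simp
    then have "real c > 0" using cge by linarith
    then show ?thesis by simp
  qed
  have "(\<Sum>s\<in>chan n h ` (?S \<inter> Cb n a). point_err n \<sigma> (chan n h ` ?S) s) = (\<Sum>x\<in>?S \<inter> Cb n a. point_err n \<sigma> (chan n h ` ?S) (chan n h x))"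
    by (subst sum.reindex[OF inj]) simp
  also have "\<dots> = (\<Sum>j<M. \<Sum>x\<in>A j. point_err n \<sigma> (chan n h ` ?S) (chan n h x))"
    unfolding pcode_Int_Cb A_def[symmetric]
    by (rule sum.UNION_disjoint) (simp, use fA in blast, use dj in blast)
  also have "\<dots> \<le> (\<Sum>j<M. \<Sum>x\<in>A j. e + r j)"
    unfolding e_def r_def by (intro sum_mono point_err_pcode_le[OF hs h L]) (auto simp: A_def)
  also have "\<dots> = (\<Sum>j<M. of_nat (card (A j)) * e) + (\<Sum>j<M. of_nat (card (A j)) * r j)"
    by (simp add: distrib_left sum.distrib)
  \<comment> \<open>The class sizes add up exactly to \<open>c\<close>, so the main term keeps
    coefficient 1.\<close>
  also have "(\<Sum>j<M. of_nat (card (A j)) * e) = of_nat c * e" by (simp add: cS sum_distrib_right)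
  also have "(\<Sum>j<M. of_nat (card (A j)) * r j) \<le> (\<Sum>j<M. ennreal ((a / L + 1) ^ (2 * n)) * r j)"
    using card_lattice_class_cube(2)[OF L aL] unfolding A_def
    by (intro sum_mono mult_right_mono) (auto simp: ennreal_of_nat_eq_real_of_nat intro!: ennreal_leI)
  also have "\<dots> = ennreal ((a / L + 1) ^ (2 * n)) * (\<Sum>j<M. r j)" by (simp add: sum_distrib_left)
  finally have 1: "(\<Sum>s\<in>chan n h ` (?S \<inter> Cb n a). point_err n \<sigma> (chan n h ` ?S) s) \<le> of_nat c * e + ennreal ((a / L + 1) ^ (2 * n)) * (\<Sum>j<M. r j)"
    by (simp add: add_left_mono)
  have cc: "of_nat c * e / of_nat c = e"
  proof -
    have "of_nat c / of_nat c = (1::ennreal)" using cpos by (intro ennreal_divide_self) (auto simp: of_nat_less_top)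
    then show ?thesis by (metis ennreal_times_divide mult.commute mult.right_neutral)
  qed
  have rr: "ennreal ((a / L + 1) ^ (2 * n)) / of_nat c \<le> ennreal (2 / real M)"
  proof -
    have "ennreal ((a / L + 1) ^ (2 * n)) / of_nat c = ennreal ((a / L + 1) ^ (2 * n) / real c)"
      using cpos q by (subst divide_ennreal[symmetric]) (auto simp: ennreal_of_nat_eq_real_of_nat intro!: zero_le_power)
    also have "\<dots> \<le> ennreal (2 / real M)"
    proof (rule ennreal_leI)
      have "(a / L + 1) ^ (2 * n) / real c \<le> 2 * (a / L - 1) ^ (2 * n) / (real M * (a / L - 1) ^ (2 * n))"
      proof (rule frac_le)
        have p: "(a / L - 1) ^ (2 * n) > 0" using q by simp
        then show "0 \<le> 2 * (a / L - 1) ^ (2 * n)" by simp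
        show "0 < real M * (a / L - 1) ^ (2 * n)" using p M by (intro mult_pos_pos) auto
      qed (rule ratio, rule cge)
      also have "\<dots> = 2 / real M"
        by (rule nonzero_mult_divide_mult_cancel_right) (use zero_less_power[OF q, of "2 * n"] in linarith)
      finally show "(a / L + 1) ^ (2 * n) / real c \<le> 2 / real M" .
    qed
    finally show ?thesis .
  qed
  have "(\<Sum>s\<in>chan n h ` (?S \<inter> Cb n a). point_err n \<sigma> (chan n h ` ?S) s) / of_nat c
      \<le> (of_nat c * e + ennreal ((a / L + 1) ^ (2 * n)) * (\<Sum>j<M. r j)) / of_nat c"
    by (rule divide_right_mono_ennreal[OF 1])
  also have "\<dots> = e + ennreal ((a / L + 1) ^ (2 * n)) / of_nat c * (\<Sum>j<M. r j)"
  proof -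
    have "ennreal ((a / L + 1) ^ (2 * n)) * (\<Sum>j<M. r j) / of_nat c = ennreal ((a / L + 1) ^ (2 * n)) / of_nat c * (\<Sum>j<M. r j)"
      by (metis ennreal_times_divide mult.commute)
    then show ?thesis by (simp only: add_divide_distrib_ennreal cc)
  qed
  also have "\<dots> \<le> e + ennreal (2 / real M) * (\<Sum>j<M. r j)"
    using rr by (intro add_left_mono mult_right_mono) auto
  finally show ?thesis
    using fin card_image[OF inj] unfolding im by (simp add: avg_err_def c_def e_def r_def)
qed

lemma cond_err_pcode_le:
  assumes hs: "h \<in> space (fade_vec n)" and h: "\<forall>i<n. h i \<noteq> 0" and L: "L > 0" and M: "M \<ge> 1"
    and nc: "incongruent n L M \<omega>"
  shows "cond_err n \<sigma> (pcode n L M \<omega>) h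
    \<le> slice n (bad_set n y) h + ennreal (2 / real M) * (\<Sum>j<M. confusion n y L M \<omega> j h)"
  unfolding cond_err_def Let_def
proof (rule Limsup_bounded)
  show "\<forall>\<^sub>F a in at_top. avg_err n \<sigma> (chan n h ` pcode n L M \<omega>) (chan n h ` pcode n L M \<omega> \<inter> chan n h ` Cb n a)
    \<le> slice n (bad_set n y) h + ennreal (2 / real M) * (\<Sum>j<M. confusion n y L M \<omega> j h)"
    using eventually_gt_at_top[of L] eventually_ratio_le_2[OF L, of n]
    by eventually_elim (rule avg_err_pcode_le[OF hs h L M _ _ nc])
qed

lemma confusion_integral:
  shows "confusion n y L M \<omega> j \<in> borel_measurable (fade_vec n)"
    and "(\<integral>\<^sup>+h. confusion n y L M \<omega> j h \<partial>fade_vec n) = (\<Sum>k\<in>{..<M} - {j}. pair_conf n y L (\<omega> j) (\<omega> k)) + emeasure (joint n) (self_set n L)"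
proof -
  let ?f = "\<lambda>k h. \<integral>\<^sup>+\<kappa>. slice n (good_near n y (\<lambda>i. \<omega> k i - \<omega> j i + of_real L * \<kappa> i)) h \<partial>count_space (glattice n)"
  have m: "?f k \<in> borel_measurable (fade_vec n)" for k
    by (intro borel_measurable_nn_integral_count_space countable_glattice measurable_slice sets_good_near)
  have s: "slice n (self_set n L) \<in> borel_measurable (fade_vec n)" by (intro measurable_slice sets_bad_self)
  show "confusion n y L M \<omega> j \<in> borel_measurable (fade_vec n)"
    unfolding confusion_def[abs_def] by (intro borel_measurable_add borel_measurable_sum m s)
  have i: "(\<integral>\<^sup>+h. ?f k h \<partial>fade_vec n) = pair_conf n y L (\<omega> j) (\<omega> k)" for k
    by (subst nn_integral_count_space_nn_integral[OF countable_glattice])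
      (simp_all add: measurable_slice nn_integral_slice sets_good_near pair_conf_def near_prob_def)
  have "(\<integral>\<^sup>+h. confusion n y L M \<omega> j h \<partial>fade_vec n) = (\<integral>\<^sup>+h. (\<Sum>k\<in>{..<M} - {j}. ?f k h) \<partial>fade_vec n) + (\<integral>\<^sup>+h. slice n (self_set n L) h \<partial>fade_vec n)"
    unfolding confusion_def by (intro nn_integral_add borel_measurable_sum m s)
  also have "(\<integral>\<^sup>+h. (\<Sum>k\<in>{..<M} - {j}. ?f k h) \<partial>fade_vec n) = (\<Sum>k\<in>{..<M} - {j}. pair_conf n y L (\<omega> j) (\<omega> k))"
    using m by (subst nn_integral_sum) (auto simp: i)
  finally show "(\<integral>\<^sup>+h. confusion n y L M \<omega> j h \<partial>fade_vec n) = (\<Sum>k\<in>{..<M} - {j}. pair_conf n y L (\<omega> j) (\<omega> k)) + emeasure (joint n) (self_set n L)"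
    by (simp add: nn_integral_slice sets_bad_self)
qed

text \<open>With \<open>y = n * \<delta> + ln n / 2\<close> and
  \<open>M / L ^ (2 * n) = exp (n * \<delta>)\<close>, the codebook contributes
  \<open>4 / sqrt n\<close> per class and the own translates \<open>1 / sqrt n\<close>; the factor 2
  for unequal classes makes it 10.\<close>

theorem achievability_bound:
  assumes n: "n \<ge> 1"
  shows "\<exists>S. is_IC n S \<and> (\<forall>a. finite (S \<inter> Cb n a)) \<and> NLD n S \<ge> ereal \<delta> \<and>
    avg_error_prob n \<sigma> \<mu>H S \<le> ennreal (tinfo_cdf n (n * \<delta> + ln n / 2) + 10 / sqrt n)"
proof -
  interpret H: prob_space "fade_vec n" by (intro prob_space_PiM prob_space_axioms)
  interpret J: prob_space "joint n" by (rule prob_space_joint)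
  define y where "y = n * \<delta> + ln n / 2"
  define \<gamma> where "\<gamma> = exp (real n * \<delta>)"
  have \<gamma>: "\<gamma> > 0" by (simp add: \<gamma>_def)
  have sn: "1 / sqrt n > 0" using n by simp
  obtain a0 where a0: "\<And>a. a \<ge> a0 \<Longrightarrow> emeasure (joint n) {p \<in> space (joint n). a \<le> reach n p} \<le> ennreal (1 / sqrt n)"
    using J.tail_emeasure_small[OF measurable_reach sn] by blast
  define b where "b = max a0 1"
  \<comment> \<open>The density fixes \<open>M / L ^ (2 * n)\<close>, so enough classes push the
    period beyond \<open>a0\<close>, where \<open>self_set\<close> is rare.\<close>
  obtain M :: nat where "M \<ge> max 1 (\<gamma> * b ^ (2 * n))" using real_arch_simple by blast
  then have M: "M \<ge> 1" "real M \<ge> \<gamma> * b ^ (2 * n)" by auto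
  define L where "L = root (2 * n) (real M / \<gamma>)"
  have L2n: "L ^ (2 * n) = real M / \<gamma>" unfolding L_def using n M \<gamma> by (intro real_root_pow_pos2) auto
  have L: "L > 0" unfolding L_def using n M \<gamma> by (intro real_root_gt_zero) auto
  have "L \<ge> b"
  proof -
    have "b ^ (2 * n) \<le> real M / \<gamma>" using M \<gamma> by (simp add: pos_le_divide_eq mult.commute)
    then have "b ^ (2 * n) \<le> L ^ (2 * n)" by (simp add: L2n)
    then show ?thesis using n L by (simp add: power_mono_iff b_def)
  qed
  then have "L \<ge> a0" by (simp add: b_def)
  then have self: "emeasure (joint n) (self_set n L) \<le> ennreal (1 / sqrt n)" unfolding self_set_def by (rule a0)
  obtain \<omega> where nc: "incongruent n L M \<omega>"
    and pp: "(\<Sum>j<M. \<Sum>k\<in>{..<M} - {j}. pair_conf n y L (\<omega> j) (\<omega> k)) \<le> ennreal (4 * exp (- y) * (real M)\<^sup>2 / L ^ (2 * n))"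
    using exists_codebook[OF n L, of M y] by blast
  let ?S = "pcode n L M \<omega>"
  have ey: "exp (- y) = 1 / (\<gamma> * sqrt n)"
  proof -
    have "exp y = \<gamma> * exp (ln (sqrt n))" using n by (simp add: y_def \<gamma>_def exp_add ln_sqrt)
    also have "exp (ln (sqrt n)) = sqrt n" using n by (intro exp_ln) simp
    finally show ?thesis by (simp add: exp_minus inverse_eq_divide)
  qed
  have ppv: "4 * exp (- y) * (real M)\<^sup>2 / L ^ (2 * n) = 4 * real M / sqrt n"
    using M \<gamma> n unfolding ey L2n by (simp add: power2_eq_square field_simps)
  have "avg_error_prob n \<sigma> \<mu>H ?S \<le> (\<integral>\<^sup>+h. slice n (bad_set n y) h + ennreal (2 / real M) * (\<Sum>j<M. confusion n y L M \<omega> j h) \<partial>fade_vec n)"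
    unfolding avg_error_prob_def
  proof (rule nn_integral_mono_AE)
    show "AE h in fade_vec n. cond_err n \<sigma> ?S h \<le> slice n (bad_set n y) h + ennreal (2 / real M) * (\<Sum>j<M. confusion n y L M \<omega> j h)"
      using AE_fade_nz AE_space by eventually_elim (rule cond_err_pcode_le[OF _ _ L M(1) nc])
  qed
  also have "\<dots> = (\<integral>\<^sup>+h. slice n (bad_set n y) h \<partial>fade_vec n) + (\<integral>\<^sup>+h. ennreal (2 / real M) * (\<Sum>j<M. confusion n y L M \<omega> j h) \<partial>fade_vec n)"
    by (intro nn_integral_add borel_measurable_times_ennreal borel_measurable_const borel_measurable_sum
        confusion_integral(1) measurable_slice sets_bad_self)
  also have "(\<integral>\<^sup>+h. ennreal (2 / real M) * (\<Sum>j<M. confusion n y L M \<omega> j h) \<partial>fade_vec n)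
     = ennreal (2 / real M) * (\<Sum>j<M. (\<Sum>k\<in>{..<M} - {j}. pair_conf n y L (\<omega> j) (\<omega> k)) + emeasure (joint n) (self_set n L))"
    using confusion_integral(1) by (subst nn_integral_cmult) (auto simp: nn_integral_sum confusion_integral(2))
  also have "(\<Sum>j<M. (\<Sum>k\<in>{..<M} - {j}. pair_conf n y L (\<omega> j) (\<omega> k)) + emeasure (joint n) (self_set n L))
     \<le> ennreal (4 * real M / sqrt n) + (\<Sum>j<M. ennreal (1 / sqrt n))"
    unfolding sum.distrib using pp self unfolding ppv by (intro add_mono sum_mono) auto
  also have "\<dots> = ennreal (5 * real M / sqrt n)"
  proof -
    have "(\<Sum>j<M. ennreal (1 / sqrt n)) = ennreal (real M / sqrt n)"
      by (simp add: ennreal_of_nat_eq_real_of_nat ennreal_mult[symmetric])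
    moreover have "ennreal (4 * real M / sqrt n) + ennreal (real M / sqrt n) = ennreal (4 * real M / sqrt n + real M / sqrt n)"
      by (rule ennreal_plus[symmetric]) auto
    moreover have "4 * real M / sqrt n + real M / sqrt n = 5 * real M / sqrt n" unfolding add_divide_distrib[symmetric] by simp
    ultimately show ?thesis by (simp only:)
  qed
  also have "(\<integral>\<^sup>+h. slice n (bad_set n y) h \<partial>fade_vec n) = ennreal (measure (joint n) (bad_set n y))"
    by (simp add: nn_integral_slice sets_bad_self J.emeasure_eq_measure)
  finally have "avg_error_prob n \<sigma> \<mu>H ?S \<le> ennreal (measure (joint n) (bad_set n y)) + ennreal (2 / real M) * ennreal (5 * real M / sqrt n)"
    by (simp add: add_left_mono mult_left_mono)
  also have "ennreal (2 / real M) * ennreal (5 * real M / sqrt n) = ennreal (10 / sqrt n)"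
    using M by (simp add: ennreal_mult[symmetric])
  also have "ennreal (measure (joint n) (bad_set n y)) \<le> ennreal (tinfo_cdf n y)"
    unfolding tinfo_cdf_def by (intro ennreal_leI J.finite_measure_mono) (auto simp: bad_set_def)
  finally have "avg_error_prob n \<sigma> \<mu>H ?S \<le> ennreal (tinfo_cdf n y + 10 / sqrt n)"
    by (simp add: add_right_mono)
  moreover have "NLD n ?S \<ge> ereal \<delta>"
    by (rule NLD_pcode_ge[OF n L M(1) nc]) (use \<gamma> M n in \<open>auto simp: L2n \<gamma>_def[symmetric]\<close>)
  ultimately show ?thesis
    using is_IC_pcode finite_pcode_Cb[OF L] unfolding y_def by blast
qed

end

section \<open>Moments, the normal quantile and the expansion\<close>

text \<open>As higher-order patterns these rules match every application, which misleads the measurability prover on constants.\<close>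

declare measurable_component_cvol [measurable del] fading_channel.measurable_joint_components [measurable del]

text \<open>Each range uses \<open>ln x \<le> x powr a / a\<close> or monotonicity:
  \<open>a = 2/3\<close> above 1, whose cube is a multiple of \<open>x^2\<close>, and
  \<open>a = \<alpha> / 6\<close> for \<open>1 / x\<close> near 0, whose cube is a multiple of
  \<open>x powr (- (\<alpha> / 2))\<close>, a singularity the density can absorb.\<close>

lemma abs_ln_cube_bound:
  fixes x :: real
  assumes x: "x > 0" and h: "0 < h" "h < 1" and \<alpha>: "\<alpha> > 0"
  shows "\<bar>ln (x\<^sup>2)\<bar> ^ 3 \<le> 27 * x\<^sup>2 + (8 * \<bar>ln h\<bar> ^ 3 + 8 / (\<alpha> / 6) ^ 3 * (indicator {0<..<h} x * x powr (- (\<alpha> / 2))))"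
proof -
  have e: "\<bar>ln (x\<^sup>2)\<bar> ^ 3 = 8 * \<bar>ln x\<bar> ^ 3" using x by (simp add: ln_realpow abs_mult power_mult_distrib)
  have p: "0 \<le> 8 / (\<alpha> / 6) ^ 3 * (indicator {0<..<h} x * x powr (- (\<alpha> / 2)))" using \<alpha> by (simp add: indicator_def)
  have p2: "0 \<le> 8 * \<bar>ln h\<bar> ^ 3" "0 \<le> 27 * x\<^sup>2" by simp_all
  consider "x \<ge> 1" | "h \<le> x" "x < 1" | "x < h" by linarith
  then show ?thesis
  proof cases
    case 1
    have "ln x \<le> x powr (2/3) / (2/3)" using 1 by (intro ln_powr_bound) auto
    then have "(ln x) ^ 3 \<le> (x powr (2/3) / (2/3)) ^ 3" using 1 by (intro power_mono) auto
    also have "\<dots> = 27 / 8 * (x powr (2/3)) ^ 3" by (simp add: power_divide power3_eq_cube)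
    also have "(x powr (2/3)) ^ 3 = x\<^sup>2"
      using x by (simp add: powr_power powr_numeral)
    finally have "8 * (ln x) ^ 3 \<le> 27 * x\<^sup>2" by simp
    moreover have "\<bar>ln x\<bar> = ln x" using 1 by simp
    ultimately show ?thesis unfolding e using p p2 by (simp only:)
  next
    case 2
    have "\<bar>ln x\<bar> \<le> \<bar>ln h\<bar>" using 2 h x by (simp add: abs_if)
    then have "\<bar>ln x\<bar> ^ 3 \<le> \<bar>ln h\<bar> ^ 3" by (intro power_mono) auto
    then show ?thesis unfolding e using p p2 by linarith
  next
    case 3
    have x1: "x < 1" using 3 h by simp
    have "ln (1 / x) \<le> (1 / x) powr (\<alpha> / 6) / (\<alpha> / 6)" using x x1 \<alpha> by (intro ln_powr_bound) auto
    then have "\<bar>ln x\<bar> \<le> (1 / x) powr (\<alpha> / 6) / (\<alpha> / 6)" using x x1 by (simp add: ln_div abs_if)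
    then have "\<bar>ln x\<bar> ^ 3 \<le> ((1 / x) powr (\<alpha> / 6) / (\<alpha> / 6)) ^ 3" by (intro power_mono) auto
    also have "\<dots> = ((1 / x) powr (\<alpha> / 6)) ^ 3 / (\<alpha> / 6) ^ 3" by (rule power_divide)
    also have "((1 / x) powr (\<alpha> / 6)) ^ 3 = x powr (- (\<alpha> / 2))"
    proof -
      have "(1 / x) powr (\<alpha> / 6) = x powr (- (\<alpha> / 6))" using x by (simp add: powr_divide powr_minus_divide)
      moreover have "(x powr (- (\<alpha> / 6))) ^ 3 = x powr (- (\<alpha> / 2))"
        using x by (subst powr_realpow[symmetric]) (simp_all add: powr_powr)
      ultimately show ?thesis by simp
    qed
    finally have "8 * \<bar>ln x\<bar> ^ 3 \<le> 8 / (\<alpha> / 6) ^ 3 * (indicator {0<..<h} x * x powr (- (\<alpha> / 2)))"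
      using 3 x by simp
    then show ?thesis unfolding e using p2 by linarith
  qed
qed

lemma integrable_powr_near_0:
  assumes "\<beta> > (-1::real)" "h > 0"
  shows "integrable lborel (\<lambda>x. indicator {0<..<h} x * x powr \<beta>)"
proof -
  have "(\<lambda>x. x powr \<beta>) absolutely_integrable_on {0<..h}"
    using assms by (intro nonnegative_absolutely_integrable_1 integrable_on_powr_from_0') auto
  then have "integrable lborel (\<lambda>x. indicator {0<..h} x * x powr \<beta>)"
    unfolding set_integrable_def by (subst (asm) integrable_completion) auto
  then show ?thesis
    by (rule Bochner_Integration.integrable_bound) (auto simp: indicator_def intro!: AE_I2)
qed

lemma AE_nonzero_of_distributed_cmod:
  assumes "distributed M lborel (\<lambda>z::complex. cmod z) g"
  shows "AE z in M. z \<noteq> 0"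
proof -
  have [measurable]: "cmod \<in> M \<rightarrow>\<^sub>M lborel" using assms by (rule distributed_measurable)
  have [measurable]: "g \<in> borel_measurable lborel" using assms by (simp add: distributed_def)
  have "AE x in density lborel g. x \<noteq> 0"
    using AE_lborel_singleton[of 0] by (subst AE_density) auto
  then have "AE x in distr M lborel cmod. x \<noteq> 0" unfolding distributed_distr_eq_density[OF assms] .
  then have "AE z in M. cmod z \<noteq> 0" by (intro AE_distrD[OF distributed_measurable[OF assms]])
  then show ?thesis by simp
qed

text \<open>The second moment controls the logarithm for large fading, the power law of the density
  for deep fades; in between the logarithm is bounded.\<close>

lemma fading_channel_of_regular:
  fixes f :: "real \<Rightarrow> real"
  assumes f: "regular_fading_pdf f" and pr: "prob_space \<mu>H" and sets: "sets \<mu>H = sets borel"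
    and D: "distributed \<mu>H lborel (\<lambda>z. cmod z) (\<lambda>h. ennreal (indicator {0..} h * f h))"
    and i2: "integrable \<mu>H (\<lambda>z. (cmod z)\<^sup>2)" and \<sigma>: "\<sigma> > 0"
  shows "fading_channel \<mu>H \<sigma>"
proof -
  interpret prob_space \<mu>H by (rule pr)
  note [measurable_cong] = sets
  obtain \<alpha> c h0 where a: "\<alpha> > 0" "c > 0" "h0 > 0" and f0: "\<And>h. 0 < h \<Longrightarrow> h < h0 \<Longrightarrow> f h = c * h powr (\<alpha> - 1)"
    and fnn: "\<And>h. h \<ge> 0 \<Longrightarrow> f h \<ge> 0"
    using f unfolding regular_fading_pdf_def by blast
  define h where "h = min h0 (1/2)"
  have h: "0 < h" "h < 1" "h \<le> h0" using a by (auto simp: h_def)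
  note AEnz = AE_nonzero_of_distributed_cmod[OF D]
  \<comment> \<open>Multiplied by the density \<open>c * x powr (\<alpha> - 1)\<close> this leaves
    the exponent \<open>\<alpha> / 2 - 1\<close>, which is above -1.\<close>
  define g where "g x = indicator {0<..<h} x * x powr (- (\<alpha> / 2))" for x :: real
  have "integrable lborel (\<lambda>x. c * (indicator {0<..<h} x * x powr (\<alpha> / 2 - 1)))"
    using a h by (intro integrable_mult_right integrable_powr_near_0) auto
  also have "(\<lambda>x. c * (indicator {0<..<h} x * x powr (\<alpha> / 2 - 1))) = (\<lambda>x. indicator {0..} x * f x * g x)"
  proof
    fix x :: real
    show "c * (indicator {0<..<h} x * x powr (\<alpha> / 2 - 1)) = indicator {0..} x * f x * g x"
    proof (cases "x \<in> {0<..<h}")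
      case True
      have "x powr (\<alpha> / 2 - 1) = x powr (\<alpha> - 1) * x powr (- (\<alpha> / 2))" by (simp add: powr_add[symmetric])
      then show ?thesis using True h f0[of x] by (simp add: g_def)
    qed (simp add: g_def)
  qed
  finally have ig0: "integrable lborel (\<lambda>x. indicator {0..} x * f x * g x)" .
  have gm: "g \<in> borel_measurable lborel" unfolding g_def by measurable
  have nn: "0 \<le> indicator {0..} x * f x" for x using fnn[of x] by (simp add: indicator_def)
  have ig: "integrable \<mu>H (\<lambda>z. g (cmod z))" using distributed_integrable[OF D gm nn] ig0 by simp
  have bnd: "integrable \<mu>H (\<lambda>z. 27 * (cmod z)\<^sup>2 + (8 * \<bar>ln h\<bar> ^ 3 + 8 / (\<alpha> / 6) ^ 3 * g (cmod z)))"
    using i2 ig by auto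
  have "integrable \<mu>H (\<lambda>z. \<bar>ln ((cmod z)\<^sup>2)\<bar> ^ 3)"
  proof (rule Bochner_Integration.integrable_bound[OF bnd])
    show "AE z in \<mu>H. norm (\<bar>ln ((cmod z)\<^sup>2)\<bar> ^ 3) \<le> norm (27 * (cmod z)\<^sup>2 + (8 * \<bar>ln h\<bar> ^ 3 + 8 / (\<alpha> / 6) ^ 3 * g (cmod z)))"
      using AEnz
    proof eventually_elim
      case (elim z)
      have "\<bar>ln ((cmod z)\<^sup>2)\<bar> ^ 3 \<le> 27 * (cmod z)\<^sup>2 + (8 * \<bar>ln h\<bar> ^ 3 + 8 / (\<alpha> / 6) ^ 3 * g (cmod z))"
        unfolding g_def using elim h a by (intro abs_ln_cube_bound) auto
      moreover have "0 \<le> \<bar>ln ((cmod z)\<^sup>2)\<bar> ^ 3" by simp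
      ultimately show ?case by simp
    qed
  qed measurable
  then show ?thesis
    using AEnz sets \<sigma> by unfold_locales
qed

section \<open>The normal distribution function and its inverse\<close>

lemma prob_space_std_normal: "prob_space std_normal_distribution"
  using real_dist_normal_dist by (simp add: real_distribution_def)

lemma measure_std_normal_eq:
  assumes "A \<in> sets borel"
  shows "emeasure std_normal_distribution A = (\<integral>\<^sup>+x. ennreal (std_normal_density x) * indicator A x \<partial>lborel)"
  using assms by (simp add: emeasure_density)

lemma std_normal_singleton: "measure std_normal_distribution {x} = 0"
proof -
  have "emeasure std_normal_distribution {x} = (\<integral>\<^sup>+y. ennreal (std_normal_density y) * indicator {x} y \<partial>lborel)"
    by (rule measure_std_normal_eq) simp
  also have "\<dots> = (\<integral>\<^sup>+y. ennreal (std_normal_density x) * indicator {x} y \<partial>lborel)"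
    by (intro nn_integral_cong) (auto simp: indicator_def)
  also have "\<dots> = 0" by (subst nn_integral_cmult_indicator) auto
  finally show ?thesis by (simp add: measure_def)
qed

lemma normal_cdf_uminus: "normal_cdf (- x) = 1 - normal_cdf x"
proof -
  interpret N: prob_space std_normal_distribution by (rule prob_space_std_normal)
  have "emeasure std_normal_distribution {.. - x} = (\<integral>\<^sup>+t. ennreal (std_normal_density t) * indicator {.. - x} t \<partial>lborel)"
    by (rule measure_std_normal_eq) simp
  also have "\<dots> = ennreal \<bar>-1\<bar> * (\<integral>\<^sup>+t. ennreal (std_normal_density (0 + (-1) * t)) * indicator {.. - x} (0 + (-1) * t) \<partial>lborel)"
    by (rule nn_integral_real_affine) auto
  also have "\<dots> = (\<integral>\<^sup>+t. ennreal (std_normal_density t) * indicator {x..} t \<partial>lborel)"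
    by (simp, intro nn_integral_cong) (auto simp: indicator_def normal_density_def)
  also have "\<dots> = emeasure std_normal_distribution {x..}" by (rule measure_std_normal_eq[symmetric]) simp
  finally have 1: "measure std_normal_distribution {.. - x} = measure std_normal_distribution {x..}" by (simp add: measure_def)
  have "{x..} = {x} \<union> {x<..}" by auto
  then have "measure std_normal_distribution {x..} = measure std_normal_distribution {x} + measure std_normal_distribution {x<..}"
    by (simp only:) (rule N.finite_measure_Union; auto)
  also have "measure std_normal_distribution {x<..} = 1 - measure std_normal_distribution {..x}"
  proof -
    have "space std_normal_distribution - {..x} = {x<..}" by auto
    then show ?thesis using N.prob_compl[of "{..x}"] by simp
  qed
  finally show ?thesis unfolding normal_cdf_def 1 by (simp add: std_normal_singleton)
qed

text \<open>This converts a probability deficit into a shift of the argument: a shift by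
  \<open>t\<close> buys at least \<open>m * t\<close>.\<close>

lemma normal_cdf_diff_ge:
  assumes ab: "a \<le> b" and m: "\<And>t. a \<le> t \<Longrightarrow> t \<le> b \<Longrightarrow> m \<le> std_normal_density t" and m0: "m \<ge> 0"
  shows "normal_cdf b - normal_cdf a \<ge> m * (b - a)"
proof -
  interpret N: prob_space std_normal_distribution by (rule prob_space_std_normal)
  have "ennreal (m * (b - a)) = (\<integral>\<^sup>+t. ennreal m * indicator {a<..b} t \<partial>lborel)"
    using ab m0 by (subst nn_integral_cmult_indicator) (auto simp: ennreal_mult)
  also have "\<dots> \<le> (\<integral>\<^sup>+t. ennreal (std_normal_density t) * indicator {a<..b} t \<partial>lborel)"
    using m by (intro nn_integral_mono) (auto simp: indicator_def intro!: ennreal_leI)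
  also have "\<dots> = emeasure std_normal_distribution {a<..b}" by (rule measure_std_normal_eq[symmetric]) simp
  finally have "m * (b - a) \<le> measure std_normal_distribution {a<..b}"
    by (simp add: N.emeasure_eq_measure ennreal_le_iff)
  also have "\<dots> = normal_cdf b - normal_cdf a"
  proof -
    have "{..b} = {..a} \<union> {a<..b}" using ab by auto
    then have "measure std_normal_distribution {..b} = measure std_normal_distribution {..a} + measure std_normal_distribution {a<..b}"
      by (simp only:) (rule N.finite_measure_Union; auto)
    then show ?thesis by (simp add: normal_cdf_def)
  qed
  finally show ?thesis .
qed

lemma std_normal_density_ge:
  assumes "\<bar>t\<bar> \<le> r" shows "std_normal_density r \<le> std_normal_density t"
proof -
  have "t\<^sup>2 \<le> r\<^sup>2" using assms abs_le_square_iff[of t r] by simp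
  then show ?thesis by (simp add: normal_density_def divide_right_mono)
qed

lemma strict_mono_normal_cdf: "strict_mono normal_cdf"
proof (rule strict_monoI)
  fix a b :: real assume ab: "a < b"
  define r where "r = max \<bar>a\<bar> \<bar>b\<bar>"
  have "normal_cdf b - normal_cdf a \<ge> std_normal_density r * (b - a)"
    by (rule normal_cdf_diff_ge) (use ab in \<open>auto simp: r_def intro!: std_normal_density_ge\<close>)
  moreover have "std_normal_density r * (b - a) > 0" using ab by (simp add: normal_density_pos)
  ultimately show "normal_cdf a < normal_cdf b" by linarith
qed

lemma normal_cdf_eq_cdf: "normal_cdf = cdf std_normal_distribution"
  by (simp add: fun_eq_iff normal_cdf_def cdf_def)

lemma normal_cdf_surj:
  assumes "0 < e" "e < 1" shows "\<exists>x. normal_cdf x = e"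
proof -
  interpret N: real_distribution std_normal_distribution by (rule real_dist_normal_dist)
  have cont: "isCont normal_cdf x" for x
    unfolding normal_cdf_eq_cdf N.isCont_cdf by (rule std_normal_singleton)
  have "\<forall>\<^sub>F x in at_bot. normal_cdf x < e"
    unfolding normal_cdf_eq_cdf by (rule order_tendstoD(2)[OF N.cdf_lim_at_bot assms(1)])
  then obtain a where a: "normal_cdf a < e" using eventually_happens' trivial_limit_at_bot_linorder by blast
  have "\<forall>\<^sub>F x in at_top. normal_cdf x > e"
    unfolding normal_cdf_eq_cdf by (rule order_tendstoD(1)[OF N.cdf_lim_at_top_prob assms(2)])
  then obtain b where b: "normal_cdf b > e" using eventually_happens' trivial_limit_at_top_linorder by blast
  have "a \<le> b" using a b strict_mono_normal_cdf by (meson less_trans not_le strict_mono_less less_asym)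
  then show ?thesis using IVT[of normal_cdf a e b] a b cont by auto
qed

lemma Qfun_eq: "Qfun x = normal_cdf (- x)"
proof -
  interpret N: prob_space std_normal_distribution by (rule prob_space_std_normal)
  have "Qfun x = measure std_normal_distribution {x<..}"
    unfolding Qfun_def set_lebesgue_integral_def
    by (subst integral_eq_nn_integral)
      (auto simp: measure_def measure_std_normal_eq indicator_def intro!: arg_cong[where f=enn2real] nn_integral_cong AE_I2)
  also have "\<dots> = 1 - normal_cdf x"
  proof -
    have "space std_normal_distribution - {..x} = {x<..}" by auto
    then show ?thesis using N.prob_compl[of "{..x}"] by (simp add: normal_cdf_def)
  qed
  finally show ?thesis by (simp add: normal_cdf_uminus)
qed

text \<open>Surjectivity onto the open unit interval and strict monotonicity make the description in
  \<open>Qinv\<close> denote.\<close>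

lemma normal_cdf_Qinv:
  assumes "0 < e" "e < 1" shows "normal_cdf (- Qinv e) = e"
proof -
  obtain x where x: "normal_cdf x = e" using normal_cdf_surj[OF assms] by blast
  have "Qinv e = - x" unfolding Qinv_def
    by (rule the_equality) (use x strict_mono_eq[OF strict_mono_normal_cdf] in \<open>auto simp: Qfun_eq\<close>)
  then show ?thesis using x by simp
qed

lemma ln_over_sqrt_tendsto_0: "((\<lambda>n::nat. ln (real n) / sqrt (real n)) \<longlongrightarrow> 0) sequentially"
proof -
  have "filterlim (\<lambda>n. sqrt (real n)) at_top sequentially"
    by (rule filterlim_compose[OF sqrt_at_top filterlim_real_sequentially])
  from filterlim_compose[OF ln_x_over_x_tendsto_0 this]
  have "(\<lambda>n. 2 * (ln (sqrt (real n)) / sqrt (real n))) \<longlonglongrightarrow> 2 * 0" by (intro tendsto_intros)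
  then show ?thesis by (simp add: ln_sqrt)
qed

section \<open>From the two bounds to the expansion\<close>

context fading_channel begin

text \<open>The converse at \<open>x0 + c\<close> and achievability at \<open>x0 - c\<close> lead to
  the normal arguments \<open>- q + t\<close> and \<open>- q - t\<close>, where \<open>m * t\<close>
  outweighs the Berry-Esseen error and the losses of both bounds.\<close>

theorem second_order_expansion:
  assumes \<epsilon>: "0 < \<epsilon>" "\<epsilon> < 1"
  shows "\<exists>C N. \<forall>n\<ge>N. \<bar>opt_NLD n \<sigma> \<mu>H \<epsilon> - ereal (\<delta>ch - sqrt (Vch / real n) * Qinv \<epsilon>)\<bar>
            \<le> ereal (C * ln (real n) / real n)"
proof -
  define q where "q = Qinv \<epsilon>"
  have q: "normal_cdf (- q) = \<epsilon>" unfolding q_def by (rule normal_cdf_Qinv[OF \<epsilon>])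
  \<comment> \<open>The least value of the normal density within distance 1 of \<open>- q\<close> is
    at least this, so it is a valid slope as long as the shift \<open>t\<close> is at most
    1.\<close>
  define m where "m = std_normal_density (\<bar>q\<bar> + 1)"
  have m: "m > 0" by (simp add: m_def normal_density_pos)
  obtain C0 where C0: "C0 \<ge> 0" and BE: "\<And>n x. n \<ge> 5 \<Longrightarrow> \<bar>tinfo_cdf n x - normal_cdf ((x - real n * \<delta>ch) / sqrt (real n * Vch))\<bar> \<le> C0 / sqrt (real n)"
    using tinfo_sum_berry_esseen by blast
  \<comment> \<open>Chosen to exceed both \<open>C0 + exp 4 + 1\<close>, needed in the converse, and
    \<open>C0 + 10\<close>, needed in achievability.\<close>
  define K where "K = C0 + exp 4 + 12"
  have K: "K > 0" using C0 by (simp add: K_def add_nonneg_pos)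
  \<comment> \<open>The \<open>1 / 2\<close> pays for the threshold offset \<open>ln n / 2\<close>;
    the rest is the shift \<open>t\<close> converted back to the scale of the information sum, as
    \<open>ct\<close> records.\<close>
  define C where "C = 1 / 2 + K * sqrt Vch / m"
  have V: "Vch > 0" using Vch_ge by linarith
  have "\<forall>\<^sub>F n in sequentially. ln (real n) / sqrt (real n) < m / K"
    by (rule order_tendstoD(2)[OF ln_over_sqrt_tendsto_0]) (use m K in simp)
  then obtain N0 where N0: "\<And>n. n \<ge> N0 \<Longrightarrow> ln (real n) / sqrt (real n) < m / K"
    by (auto simp: eventually_sequentially)
  have main: "\<bar>opt_NLD n \<sigma> \<mu>H \<epsilon> - ereal (\<delta>ch - sqrt (Vch / real n) * q)\<bar> \<le> ereal (C * ln (real n) / real n)"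
    if n: "n \<ge> max N0 5" for n
  proof -
    have n5: "n \<ge> 5" and n1: "n \<ge> 1" and np: "real n > 0" using n by auto
    define t where "t = K / m * (ln n / sqrt n)"
    \<comment> \<open>This absorbs the errors of order \<open>1 / sqrt n\<close> into
      \<open>ln n / sqrt n\<close>; \<open>n \<ge> 5\<close> is enough since
      \<open>exp 1 \<le> 3\<close>.\<close>
    have ln1: "ln (real n) \<ge> 1"
    proof -
      have "exp 1 \<le> (3::real)" using exp_le by simp
      also have "\<dots> \<le> real n" using n5 by simp
      finally have "ln (exp 1) \<le> ln (real n)" by (intro ln_mono) auto
      then show ?thesis by simp
    qed
    have t0: "t \<ge> 0" using K m ln1 by (simp add: t_def)
    have t1: "t \<le> 1"
    proof -
      have "t \<le> K / m * (m / K)" unfolding t_def using N0[of n] n K m by (intro mult_left_mono) auto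
      then show ?thesis using K m by simp
    qed
    have mt: "m * t \<ge> K / sqrt n"
    proof -
      have "m * t = K * (ln n / sqrt n)" using m by (simp add: t_def)
      also have "\<dots> \<ge> K * (1 / sqrt n)" using K ln1 by (intro mult_left_mono divide_right_mono) auto
      finally show ?thesis by simp
    qed
    have dens: "m \<le> std_normal_density s" if "- q - 1 \<le> s" "s \<le> - q + 1" for s
      unfolding m_def using that by (intro std_normal_density_ge) (auto simp: abs_if)
    have up: "normal_cdf (- q + t) \<ge> \<epsilon> + K / sqrt n"
    proof -
      have "normal_cdf (- q + t) - normal_cdf (- q) \<ge> m * ((- q + t) - (- q))"
        by (rule normal_cdf_diff_ge) (use t0 t1 m dens in auto)
      then show ?thesis using mt q by simp
    qed
    have down: "normal_cdf (- q - t) \<le> \<epsilon> - K / sqrt n"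
    proof -
      have "normal_cdf (- q) - normal_cdf (- q - t) \<ge> m * ((- q) - (- q - t))"
        by (rule normal_cdf_diff_ge) (use t0 t1 m dens in auto)
      then show ?thesis using mt q by simp
    qed
    define x0 where "x0 = \<delta>ch - sqrt (Vch / n) * q"
    define c where "c = C * ln n / n"
    have sV: "sqrt (n * Vch) > 0" using np V by simp
    have s1: "n * sqrt (Vch / n) = sqrt (n * Vch)"
      using np V by (simp add: real_sqrt_divide real_sqrt_mult field_simps)
    have nc: "n * c = C * ln n" using np by (simp add: c_def)
    have ct: "(C - 1/2) * ln n = t * sqrt (n * Vch)"
      using np m V by (simp add: C_def t_def real_sqrt_mult)
    have arg_up: "((n * (x0 + c) - ln n / 2) - n * \<delta>ch) / sqrt (n * Vch) = - q + t"
    proof -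
      have "(n * (x0 + c) - ln n / 2) - n * \<delta>ch = - (n * sqrt (Vch / n)) * q + (n * c - ln n / 2)"
        by (simp add: x0_def algebra_simps)
      also have "\<dots> = (- q + t) * sqrt (n * Vch)" unfolding s1 nc distrib_right using ct by (simp add: left_diff_distrib)
      finally show ?thesis using sV by (simp only: nonzero_mult_div_cancel_right less_imp_neq[THEN not_sym] not_False_eq_True)
    qed
    have arg_down: "((n * (x0 - c) + ln n / 2) - n * \<delta>ch) / sqrt (n * Vch) = - q - t"
    proof -
      have "(n * (x0 - c) + ln n / 2) - n * \<delta>ch = - (n * sqrt (Vch / n)) * q - (n * c - ln n / 2)"
        by (simp add: x0_def algebra_simps)
      also have "\<dots> = (- q - t) * sqrt (n * Vch)" unfolding s1 nc left_diff_distrib using ct by (simp add: left_diff_distrib)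
      finally show ?thesis using sV by (simp only: nonzero_mult_div_cancel_right less_imp_neq[THEN not_sym] not_False_eq_True)
    qed
    have Fup: "tinfo_cdf n (n * (x0 + c) - ln n / 2) \<ge> \<epsilon> + K / sqrt n - C0 / sqrt n"
      using BE[OF n5, of "n * (x0 + c) - ln n / 2"] up unfolding arg_up by linarith
    have Fdown: "tinfo_cdf n (n * (x0 - c) + ln n / 2) \<le> \<epsilon> - K / sqrt n + C0 / sqrt n"
      using BE[OF n5, of "n * (x0 - c) + ln n / 2"] down unfolding arg_down by linarith
    have upper: "opt_NLD n \<sigma> \<mu>H \<epsilon> \<le> ereal (x0 + c)"
      unfolding opt_NLD_def
    proof (rule Sup_least, clarify)
      fix S assume S: "is_IC n S" "\<forall>a. finite (S \<inter> Cb n a)" "avg_error_prob n \<sigma> \<mu>H S \<le> ennreal \<epsilon>"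
      show "NLD n S \<le> ereal (x0 + c)"
      proof (rule ccontr)
        assume "\<not> ?thesis"
        then have "ennreal (tinfo_cdf n (n * (x0 + c) - ln n / 2) - (exp 4 + 1) / sqrt n) \<le> avg_error_prob n \<sigma> \<mu>H S"
          using S by (intro converse_bound n1) auto
        then have "ennreal (tinfo_cdf n (n * (x0 + c) - ln n / 2) - (exp 4 + 1) / sqrt n) \<le> ennreal \<epsilon>" using S(3) by (rule order_trans)
        then have "tinfo_cdf n (n * (x0 + c) - ln n / 2) - (exp 4 + 1) / sqrt n \<le> \<epsilon>" using \<epsilon> by (simp add: ennreal_le_iff)
        then have "K / sqrt n - C0 / sqrt n - (exp 4 + 1) / sqrt n \<le> 0" using Fup by linarith
        moreover have "K / sqrt n - C0 / sqrt n - (exp 4 + 1) / sqrt n = 11 / sqrt n"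
          by (simp add: K_def diff_divide_distrib[symmetric])
        ultimately show False using np by (simp add: divide_le_0_iff)
      qed
    qed
    have lower: "ereal (x0 - c) \<le> opt_NLD n \<sigma> \<mu>H \<epsilon>"
    proof -
      obtain S where S: "is_IC n S" "\<forall>a. finite (S \<inter> Cb n a)" "NLD n S \<ge> ereal (x0 - c)"
        "avg_error_prob n \<sigma> \<mu>H S \<le> ennreal (tinfo_cdf n (n * (x0 - c) + ln n / 2) + 10 / sqrt n)"
        using achievability_bound[OF n1, of "x0 - c"] by blast
      have "tinfo_cdf n (n * (x0 - c) + ln n / 2) + 10 / sqrt n \<le> \<epsilon>"
      proof -
        have "K / sqrt n - C0 / sqrt n - 10 / sqrt n = (exp 4 + 2) / sqrt n"
          by (simp add: K_def diff_divide_distrib[symmetric])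
        moreover have "(exp 4 + 2) / sqrt n \<ge> (0::real)" by (intro divide_nonneg_nonneg add_nonneg_nonneg) auto
        ultimately show ?thesis using Fdown by linarith
      qed
      then have "avg_error_prob n \<sigma> \<mu>H S \<le> ennreal \<epsilon>" using S(4) by (meson ennreal_leI order_trans)
      then have "NLD n S \<le> opt_NLD n \<sigma> \<mu>H \<epsilon>" unfolding opt_NLD_def using S by (intro Sup_upper) blast
      then show ?thesis using S(3) by simp
    qed
    obtain r where r: "opt_NLD n \<sigma> \<mu>H \<epsilon> = ereal r"
      using upper lower by (cases "opt_NLD n \<sigma> \<mu>H \<epsilon>") auto
    have "\<bar>r - x0\<bar> \<le> c" using upper lower unfolding r by (simp add: abs_le_iff)
    then show ?thesis unfolding r x0_def[symmetric] c_def[symmetric] by simp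
  qed
  show ?thesis unfolding q_def[symmetric] using main by blast
qed

end

text \<open>The logarithm of the quotient splits only at nonzero fading, hence the almost-everywhere
  argument; \<open>exp 1\<close> supplies the 1 in \<open>\<delta>ch\<close>.\<close>

lemma integral_ln_scaled:
  assumes "fading_channel \<mu>H \<sigma>"
  shows "(\<integral>z. ln ((cmod z)\<^sup>2 / (pi * exp 1 * \<sigma>\<^sup>2)) \<partial>\<mu>H) = fading_channel.\<delta>ch \<mu>H \<sigma>"
proof -
  interpret fading_channel \<mu>H \<sigma> by fact
  have i: "integrable \<mu>H (\<lambda>h. ln ((cmod h)\<^sup>2))" using third_moment_imp(1)[OF _ third_moment_H] by simp
  have "(\<integral>z. ln ((cmod z)\<^sup>2 / (pi * exp 1 * \<sigma>\<^sup>2)) \<partial>\<mu>H) = (\<integral>z. ln ((cmod z)\<^sup>2) - (ln (pi * \<sigma>\<^sup>2) + 1) \<partial>\<mu>H)"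
  proof (rule integral_cong_AE)
    show "AE z in \<mu>H. ln ((cmod z)\<^sup>2 / (pi * exp 1 * \<sigma>\<^sup>2)) = ln ((cmod z)\<^sup>2) - (ln (pi * \<sigma>\<^sup>2) + 1)"
      using AE_H_nz
    proof eventually_elim
      case (elim z)
      then show ?case using \<sigma>_pos by (simp add: ln_div ln_mult)
    qed
  qed measurable
  also have "\<dots> = \<delta>ch" using i prob_space by (simp add: \<delta>ch_def meanlog_def)
  finally show ?thesis .
qed

text \<open>The distance is taken in \<open>ereal\<close>, where infinities have infinite absolute
  value, so the inequality also asserts that the optimal NLD is finite for large
  \<open>n\<close>.\<close>

theorem theorem4p4:
  fixes f :: "real \<Rightarrow> real" and \<mu>H :: "complex measure" and \<sigma> \<epsilon> :: real
  assumes "regular_fading_pdf f"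
    and "prob_space \<mu>H" and "sets \<mu>H = sets borel"
    and "distributed \<mu>H lborel (\<lambda>z. cmod z) (\<lambda>h. ennreal (indicator {0..} h * f h))"
    and "integrable \<mu>H (\<lambda>z. (cmod z)\<^sup>2)" and "(\<integral>z. (cmod z)\<^sup>2 \<partial>\<mu>H) = 1"
    and "\<sigma> > 0" and "0 < \<epsilon>" and "\<epsilon> < 1"
  defines "\<delta>c \<equiv> (\<lambda>z::complex. ln ((cmod z)\<^sup>2 / (pi * exp 1 * \<sigma>\<^sup>2)))"
  defines "\<delta>star \<equiv> (\<integral>z. \<delta>c z \<partial>\<mu>H)"
  defines "Vc \<equiv> 1 + (\<integral>z. (ln ((cmod z)\<^sup>2) - (\<integral>w. ln ((cmod w)\<^sup>2) \<partial>\<mu>H))\<^sup>2 \<partial>\<mu>H)"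
  shows "\<exists>C N. \<forall>n\<ge>N. \<bar>opt_NLD n \<sigma> \<mu>H \<epsilon> - ereal (\<delta>star - sqrt (Vc / real n) * Qinv \<epsilon>)\<bar>
            \<le> ereal (C * ln (real n) / real n)"
proof -
  have ch: "fading_channel \<mu>H \<sigma>" by (rule fading_channel_of_regular) fact+
  interpret fading_channel \<mu>H \<sigma> by (rule ch)
  have "\<delta>star = \<delta>ch" unfolding \<delta>star_def \<delta>c_def by (rule integral_ln_scaled[OF ch])
  moreover have "Vc = Vch" unfolding Vc_def Vch_def meanlog_def ..
  ultimately show ?thesis using second_order_expansion[OF assms(8,9)] by simp
qed

end
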